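(* Let $X=\{(z,w)\in\mathbb{C}^2 : w^2=z(z-2)(z-\tfrac12)\}$ and $X'=X\setminus\{(0,0)\}$. There exist $\lambda_1,\lambda_2\in\mathbb{R}$ such that, with $$\omega_1=\frac{z+\lambda_1}{w}\,dz,\qquad \omega_2=i\,\frac{z+\lambda_2}{w}\,dz,\qquad \omega_3=\frac1z\,dz,$$ the map $f(z)=\operatorname{Re}\int^z(\omega_1,\omega_2,\omega_3)$ is well defined (single valued) on $X'$ and is a proper harmonic embedding of $X'$ into $\mathbb{R}^3$.
   Context: The affine curve $X$ is a torus minus the point at infinity; the forms $\omega_1,\omega_2,\omega_3$ are holomorphic on $X'$ and meromorphic on the compactified torus. The integral is taken along paths in $X'$ from a fixed base point. "Proper embedding" means proper injective immersion. *)

theory Defs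
  imports "HOL-Complex_Analysis.Complex_Analysis"
begin

definition cubic :: "complex \<Rightarrow> complex" where
  "cubic z = z * (z - 2) * (z - 1/2)"

definition curve :: "(complex \<times> complex) set" where
  "curve = {(z, w). w\<^sup>2 = cubic z}"

definition punctured_curve :: "(complex \<times> complex) set" where
  "punctured_curve = curve - {(0, 0)}"

text \<open>
  A one-form (or a vector of one-forms) on a curve in \<open>\<complex>\<^sup>2\<close> is represented by its value
  \<open>\<omega> p v\<close> at a point \<open>p\<close> of the curve and a tangent vector \<open>v = (dz, dw)\<close> at \<open>p\<close>.

  The form \<open>dz/w\<close> is holomorphic on the whole curve. Differentiating the equation of the
  curve gives \<open>2 w dw = cubic'(z) dz\<close>, so its value at the branch points \<open>w = 0\<close>
  is \<open>2 dw / cubic'(z)\<close>; the derivative does not vanish there, since the roots are simple.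
\<close>

definition dz_over_w :: "complex \<times> complex \<Rightarrow> complex \<times> complex \<Rightarrow> complex" where
  "dz_over_w p v =
     (if snd p \<noteq> 0 then fst v / snd p else 2 * snd v / deriv cubic (fst p))"

definition omega1 :: "real \<Rightarrow> complex \<times> complex \<Rightarrow> complex \<times> complex \<Rightarrow> complex" where
  "omega1 l p v = (fst p + of_real l) * dz_over_w p v"

definition omega2 :: "real \<Rightarrow> complex \<times> complex \<Rightarrow> complex \<times> complex \<Rightarrow> complex" where
  "omega2 l p v = \<i> * (fst p + of_real l) * dz_over_w p v"

definition omega3 :: "complex \<times> complex \<Rightarrow> complex \<times> complex \<Rightarrow> complex" where
  "omega3 p v = fst v / fst p"

definition omega :: "real \<Rightarrow> real \<Rightarrow> complex \<times> complex \<Rightarrow> complex \<times> complex \<Rightarrow> complex^3" where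
  "omega l1 l2 p v = vector [omega1 l1 p v, omega2 l2 p v, omega3 p v]"


definition paths_in :: "'a::real_normed_vector set \<Rightarrow> 'a \<Rightarrow> 'a \<Rightarrow> (real \<Rightarrow> 'a) set" where
  "paths_in S a b =
     {\<gamma>. valid_path \<gamma> \<and> path_image \<gamma> \<subseteq> S \<and> pathstart \<gamma> = a \<and> pathfinish \<gamma> = b}"

text \<open>As for \<^const>\<open>has_contour_integral\<close>, with the value of the form at the velocity vector.\<close>

definition has_form_integral ::
    "('a::real_normed_vector \<Rightarrow> 'a \<Rightarrow> complex^'n) \<Rightarrow> complex^'n \<Rightarrow> (real \<Rightarrow> 'a) \<Rightarrow> bool" where
  "has_form_integral \<omega> I \<gamma> \<longleftrightarrow>
     ((\<lambda>t. \<omega> (\<gamma> t) (vector_derivative \<gamma> (at t within {0..1}))) has_integral I) {0..1}"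

definition Re_vec :: "complex^'n \<Rightarrow> real^'n" where
  "Re_vec I = (\<chi> i. Re (I $ i))"

text \<open>
  Every point of \<open>S\<close> can be reached from the base point \<open>a\<close>, the forms are integrable along
  every path, and the real part of the integral depends only on the end point.
\<close>

definition Re_integral_well_defined ::
    "'a::real_normed_vector set \<Rightarrow> ('a \<Rightarrow> 'a \<Rightarrow> complex^'n) \<Rightarrow> 'a \<Rightarrow> bool" where
  "Re_integral_well_defined S \<omega> a \<longleftrightarrow>
     (\<forall>p\<in>S. paths_in S a p \<noteq> {} \<and>
        (\<forall>\<gamma>\<in>paths_in S a p. \<exists>I. has_form_integral \<omega> I \<gamma>) \<and>
        (\<forall>\<gamma>\<in>paths_in S a p. \<forall>\<gamma>'\<in>paths_in S a p. \<forall>I I'.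
           has_form_integral \<omega> I \<gamma> \<longrightarrow> has_form_integral \<omega> I' \<gamma>' \<longrightarrow> Re_vec I = Re_vec I'))"

definition Re_integral_map ::
    "'a::real_normed_vector set \<Rightarrow> ('a \<Rightarrow> 'a \<Rightarrow> complex^'n) \<Rightarrow> 'a \<Rightarrow> 'a \<Rightarrow> real^'n" where
  "Re_integral_map S \<omega> a p =
     (THE v. \<exists>\<gamma>\<in>paths_in S a p. \<exists>I. has_form_integral \<omega> I \<gamma> \<and> v = Re_vec I)"


text \<open>Inverse of a holomorphic chart: \<open>\<phi>\<close> parametrizes the open subset \<open>\<phi> ` U\<close> of the curve \<open>S\<close>.\<close>

definition local_parametrization ::
    "(complex \<times> complex) set \<Rightarrow> complex set \<Rightarrow> (complex \<Rightarrow> complex \<times> complex) \<Rightarrow> bool" where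
  "local_parametrization S U \<phi> \<longleftrightarrow>
     open U \<and> (fst \<circ> \<phi>) holomorphic_on U \<and> (snd \<circ> \<phi>) holomorphic_on U \<and>
     inj_on \<phi> U \<and> openin (top_of_set S) (\<phi> ` U) \<and>
     (\<forall>\<zeta>\<in>U. (deriv (fst \<circ> \<phi>) \<zeta>, deriv (snd \<circ> \<phi>) \<zeta>) \<noteq> (0, 0))"

text \<open>
  Twice continuously differentiable with vanishing Laplacian; \<open>ux\<close>, \<open>uy\<close>, \<open>uxx\<close>, \<dots> are the
  partial derivatives in the real coordinates \<open>x + \<i> y\<close>.
\<close>

definition harmonic_on :: "(complex \<Rightarrow> 'a::real_normed_vector) \<Rightarrow> complex set \<Rightarrow> bool" where
  "harmonic_on u U \<longleftrightarrow> open U \<and>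
     (\<exists>ux uy uxx uxy uyx uyy.
        (\<forall>\<zeta>\<in>U.
           (u has_derivative (\<lambda>h. Re h *\<^sub>R ux \<zeta> + Im h *\<^sub>R uy \<zeta>)) (at \<zeta>) \<and>
           (ux has_derivative (\<lambda>h. Re h *\<^sub>R uxx \<zeta> + Im h *\<^sub>R uxy \<zeta>)) (at \<zeta>) \<and>
           (uy has_derivative (\<lambda>h. Re h *\<^sub>R uyx \<zeta> + Im h *\<^sub>R uyy \<zeta>)) (at \<zeta>)) \<and>
        continuous_on U uxx \<and> continuous_on U uxy \<and>
        continuous_on U uyx \<and> continuous_on U uyy \<and>
        (\<forall>\<zeta>\<in>U. uxx \<zeta> + uyy \<zeta> = 0))"

text \<open>
  Harmonicity and injectivity of the differential do not depend on the chart, so one chart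
  around each point suffices.
\<close>

definition harmonic_map :: "(complex \<times> complex) set \<Rightarrow> (complex \<times> complex \<Rightarrow> real^'n) \<Rightarrow> bool" where
  "harmonic_map S f \<longleftrightarrow>
     (\<forall>p\<in>S. \<exists>U \<phi>. local_parametrization S U \<phi> \<and> p \<in> \<phi> ` U \<and> harmonic_on (f \<circ> \<phi>) U)"

definition immersion :: "(complex \<times> complex) set \<Rightarrow> (complex \<times> complex \<Rightarrow> real^'n) \<Rightarrow> bool" where
  "immersion S f \<longleftrightarrow>
     (\<forall>p\<in>S. \<exists>U \<phi>. local_parametrization S U \<phi> \<and>
        (\<exists>\<zeta>\<in>U. \<phi> \<zeta> = p \<and> (\<exists>D. ((f \<circ> \<phi>) has_derivative D) (at \<zeta>) \<and> inj D)))"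

definition proper_embedding ::
    "(complex \<times> complex) set \<Rightarrow> (complex \<times> complex \<Rightarrow> real^'n) \<Rightarrow> bool" where
  "proper_embedding S f \<longleftrightarrow>
     proper_map (top_of_set S) euclidean f \<and> inj_on f S \<and> immersion S f"

end

(* Around each of the branch points 0, 1/2, 2 the curve is uniformized by s with z = e + s^2, and
   the forms have odd primitives in s. These primitives have the same real parts on overlaps
   once l1 in (-1/2, 0) and l2 in (-2, -1/2) kill the remaining two periods; such values exist because
   the periods are affine in l and change sign on these intervals. This gives the map (x1, x2, ln |z|).

   It is proper because of the third coordinate. For injectivity one compares points with the same |z|.
   The involution (z, w) -> (z, -w) and complex conjugation act on (x1, x2) by sign changes, so consider
   only the closed upper half-plane with one branch of w. There x1 >= 0 and x2 <= 0 on the positive axis,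
   x1 increases along vertical lines and x2 decreases strictly along the arcs |z| = const. Hence x1 > 0 > x2 in the
   open half-plane, the four copies of it have images in different quadrants, and x2 separates
   the points of an arc. The same inequalities, together with the signs on the real axis, show that the
   differential is injective. *)
theory Submission
  imports Defs
begin

text \<open>The bounds on \<open>l1\<close> and \<open>l2\<close> do double duty. Within them
  \<open>z + l\<close> is a convex combination of \<open>z - e\<close> for two neighbouring branch
  points \<open>e\<close>, so the quotients in the monotonicity arguments become positive
  combinations of products of three square roots whose arguments are ordered on the upper
  half-plane. At the ends of the same bounds \<open>z + l\<close> has constant sign between these
  branch points, which makes the period change sign. No homology is used. Each of the three charts
  contains both sheets over its slit plane. Over an overlap of two slit planes the sheets separate,
  and since the primitives are odd, their difference is a constant \<open>c\<close> on one sheet and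
  \<open>-c\<close> on the other. Single-valuedness is thus the vanishing of one real number for
  each overlap and form. The slit planes at 0 and 2 meet only off the real axis, inside the one at
  1/2, so two overlaps decide everything. The puncture adds no condition: \<open>omega1\<close> and
  \<open>omega2\<close> are holomorphic there, and the real part of \<open>dz/z\<close> has the
  primitive \<open>ln |z|\<close>.\<close>

section \<open>Square roots on the upper half-plane\<close>

text \<open>The projection equations of \<^const>\<open>csqrt\<close> would unfold every real and imaginary part.\<close>

declare csqrt.sel [simp del]

lemma csqrt_upper_half:
  assumes "Im z > 0"
  shows "Re (csqrt z) > 0" "Im (csqrt z) > 0"
proof -
  have "Im z = Im ((csqrt z)\<^sup>2)" by (simp only: power2_csqrt)
  then have "Im z = 2 * Re (csqrt z) * Im (csqrt z)" by (simp only: Im_power2)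
  with assms have "0 < 2 * Re (csqrt z) * Im (csqrt z)" by (simp only:)
  then have *: "Re (csqrt z) * Im (csqrt z) > 0" by linarith
  show "Re (csqrt z) > 0" "Im (csqrt z) > 0"
    using * Re_csqrt[of z] by (auto simp: zero_less_mult_iff)
qed

text \<open>The argument of \<open>csqrt (z - a)\<close> increases with \<open>a\<close>.\<close>

lemma Im_csqrt_mult_cnj_neg:
  fixes a b :: real
  assumes "Im z > 0" "a < b"
  shows "Im (csqrt (z - a) * cnj (csqrt (z - b))) < 0"
proof -
  let ?u = "csqrt (z - a)" and ?v = "csqrt (z - b)"
  have q: "Re ?u > 0" "Im ?u > 0" "Re ?v > 0" "Im ?v > 0"
    using csqrt_upper_half[of "z - a"] csqrt_upper_half[of "z - b"] assms by auto
  \<comment> \<open>Squaring removes the roots. The real part of the product is positive because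
    both roots lie in the open first quadrant, so the sign of the square's imaginary part
    decides.\<close>
  have "Im ((?u * cnj ?v)\<^sup>2) = Im ((z - a) * cnj (z - b))"
    by (metis complex_cnj_power power2_csqrt power_mult_distrib)
  also have "\<dots> = (a - b) * Im z"
    by (simp add: algebra_simps)
  also have "\<dots> < 0"
    using assms by (simp add: mult_neg_pos)
  finally have "Re (?u * cnj ?v) * Im (?u * cnj ?v) < 0"
    by (simp only: Im_power2)
  moreover have "Re (?u * cnj ?v) > 0"
    using mult_pos_pos[OF q(1,3)] mult_pos_pos[OF q(2,4)] by simp
  ultimately show ?thesis
    by (simp add: mult_less_0_iff)
qed

text \<open>\<open>b * cnj c\<close> lies in the open fourth quadrant; its product with
  \<open>a\<close> has argument between -pi/2 and pi/2, and its product with \<open>cnj a\<close>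
  has argument between -pi and 0.\<close>

lemma quadrant_products:
  assumes "Re a > 0" "Im a > 0" "Re b > 0" "Im b > 0" "Re c > 0" "Im c > 0"
    and "Im (b * cnj c) < 0"
  shows "Re (a * (b * cnj c)) > 0" "Im (cnj a * (b * cnj c)) < 0"
proof -
  have P: "Re (b * cnj c) > 0" using mult_pos_pos[OF assms(3,5)] mult_pos_pos[OF assms(4,6)] by simp
  show "Re (a * (b * cnj c)) > 0"
    using mult_pos_pos[OF assms(1) P] mult_pos_neg[OF assms(2) assms(7)]
    by (subst times_complex.sel) linarith
  show "Im (cnj a * (b * cnj c)) < 0"
    using mult_pos_pos[OF assms(2) P] mult_pos_neg[OF assms(1) assms(7)]
    by (subst times_complex.sel) simp
qed

text \<open>Three principal roots instead of \<open>csqrt (cubic z)\<close>: each factor is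
  continuous on the closed upper half-plane, so this follows one sheet of the curve over it.\<close>

definition upper_root :: "complex \<Rightarrow> complex" where
  "upper_root z = csqrt z * csqrt (z - 1/2) * csqrt (z - 2)"

lemma upper_root_power2: "(upper_root z)\<^sup>2 = cubic z"
  by (simp add: upper_root_def cubic_def power_mult_distrib mult_ac)

lemma upper_half_csqrts:
  assumes "Im z > 0"
  defines "a \<equiv> csqrt z" and "b \<equiv> csqrt (z - 1/2)" and "c \<equiv> csqrt (z - 2)"
  shows "Re a > 0" "Im a > 0" "Re b > 0" "Im b > 0" "Re c > 0" "Im c > 0"
    "Im (a * cnj b) < 0" "Im (b * cnj c) < 0"
  using csqrt_upper_half[of z] csqrt_upper_half[of "z - 1/2"] csqrt_upper_half[of "z - 2"]
    Im_csqrt_mult_cnj_neg[of z 0 "1/2"] Im_csqrt_mult_cnj_neg[of z "1/2" 2] assms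
  by simp_all

lemma Re_of_real_mult: "Re (of_real r * z) = r * Re z"
  by simp

lemma Im_of_real_mult: "Im (of_real r * z) = r * Im z"
  by simp

lemma divide_as_cnj: "x / (y::complex) = (x * cnj y) / of_real ((cmod y)\<^sup>2)"
  by (simp add: complex_div_cnj[of x y])

text \<open>
  Since \<open>z + l\<close> is a convex combination of \<open>z - 1/2\<close> and \<open>z - 2\<close>, the quotient is a convex
  combination of \<open>a b / c\<close> and \<open>a c / b\<close> with \<open>a, b, c\<close> the three square roots. Its real part is minus
  the angular derivative of the second coordinate along \<open>\<bar>z\<bar> = const\<close>.
\<close>

lemma Re_angular_pos:
  assumes z: "Im z > 0" and l: "-2 < l" "l < -1/2"
  shows "Re (z * (z + of_real l) / upper_root z) > 0"
proof -
  define a b c where "a = csqrt z" and "b = csqrt (z - 1/2)" and "c = csqrt (z - 2)"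
  note abc = a_def b_def c_def
  note q = upper_half_csqrts[OF z, folded abc]
  \<comment> \<open>The weight that solves
    \<open>z + l = t (z - 1/2) + (1 - t) (z - 2)\<close>.\<close>
  define t where "t = (2 + l) / (3/2)"
  have t: "0 < t" "t < 1" using l by (auto simp: t_def)
  have nz: "a \<noteq> 0" "b \<noteq> 0" "c \<noteq> 0" using q by auto
  have sq: "z = a\<^sup>2" "z - 1/2 = b\<^sup>2" "z - 2 = c\<^sup>2" by (simp_all add: abc)
  have zl: "z + of_real l = of_real t * b\<^sup>2 + of_real (1 - t) * c\<^sup>2"
    unfolding sq(2,3)[symmetric] t_def by (simp add: field_simps)
  have "z * (z + of_real l) / upper_root z = a\<^sup>2 * (of_real t * b\<^sup>2 + of_real (1 - t) * c\<^sup>2) / (a * b * c)"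
    unfolding zl[symmetric] upper_root_def abc[symmetric] by (simp flip: sq)
  also have "\<dots> = of_real t * (a * (b / c)) + of_real (1 - t) * (c * (a / b))"
    using nz by (simp add: field_simps power2_eq_square)
  also have "\<dots> = of_real (t / (cmod c)\<^sup>2) * (a * (b * cnj c)) + of_real ((1 - t) / (cmod b)\<^sup>2) * (c * (a * cnj b))"
    unfolding divide_as_cnj[of b c] divide_as_cnj[of a b] by simp
  finally have "Re (z * (z + of_real l) / upper_root z) =
     (t / (cmod c)\<^sup>2) * Re (a * (b * cnj c)) + ((1 - t) / (cmod b)\<^sup>2) * Re (c * (a * cnj b))"
    by (simp only: plus_complex.sel Re_of_real_mult)
  moreover have "(t / (cmod c)\<^sup>2) * Re (a * (b * cnj c)) > 0"
    using quadrant_products(1)[OF q(1-6) q(8)] t nz by (intro mult_pos_pos divide_pos_pos) auto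
  moreover have "((1 - t) / (cmod b)\<^sup>2) * Re (c * (a * cnj b)) > 0"
    using quadrant_products(1)[OF q(5,6) q(1-4) q(7)] t nz by (intro mult_pos_pos divide_pos_pos) auto
  ultimately show ?thesis by linarith
qed

text \<open>The imaginary part is minus the derivative of the first coordinate along vertical lines.\<close>

lemma Im_vertical_neg:
  assumes z: "Im z > 0" and l: "-1/2 < l" "l < 0"
  shows "Im ((z + of_real l) / upper_root z) < 0"
proof -
  define a b c where "a = csqrt z" and "b = csqrt (z - 1/2)" and "c = csqrt (z - 2)"
  note abc = a_def b_def c_def
  note q = upper_half_csqrts[OF z, folded abc]
  \<comment> \<open>Now the neighbouring branch points are 0 and 1/2:
    \<open>z + l = t z + (1 - t) (z - 1/2)\<close>.\<close>
  define t where "t = 1 + 2 * l"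
  have t: "0 < t" "t < 1" using l by (auto simp: t_def)
  have nz: "a \<noteq> 0" "b \<noteq> 0" "c \<noteq> 0" using q by auto
  have sq: "z = a\<^sup>2" "z - 1/2 = b\<^sup>2" "z - 2 = c\<^sup>2" by (simp_all add: abc)
  have zl: "z + of_real l = of_real t * a\<^sup>2 + of_real (1 - t) * b\<^sup>2"
    unfolding sq(1,2)[symmetric] t_def by (simp add: field_simps)
  have "(z + of_real l) / upper_root z = (of_real t * a\<^sup>2 + of_real (1 - t) * b\<^sup>2) / (a * b * c)"
    unfolding zl[symmetric] upper_root_def abc[symmetric] by simp
  also have "\<dots> = of_real t * (a / (b * c)) + of_real (1 - t) * (b / (c * a))"
    using nz by (simp add: field_simps power2_eq_square)
  also have "\<dots> = of_real (t / (cmod (b * c))\<^sup>2) * (cnj c * (a * cnj b)) +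
      of_real ((1 - t) / (cmod (c * a))\<^sup>2) * (cnj a * (b * cnj c))"
    unfolding divide_as_cnj[of a "b * c"] divide_as_cnj[of b "c * a"] by (simp add: mult_ac)
  finally have "Im ((z + of_real l) / upper_root z) =
     (t / (cmod (b * c))\<^sup>2) * Im (cnj c * (a * cnj b)) + ((1 - t) / (cmod (c * a))\<^sup>2) * Im (cnj a * (b * cnj c))"
    by (simp only: plus_complex.sel Im_of_real_mult)
  moreover have "(t / (cmod (b * c))\<^sup>2) * Im (cnj c * (a * cnj b)) < 0"
    using quadrant_products(2)[OF q(5,6) q(1-4) q(7)] t nz by (intro mult_pos_neg divide_pos_pos) auto
  moreover have "((1 - t) / (cmod (c * a))\<^sup>2) * Im (cnj a * (b * cnj c)) < 0"
    using quadrant_products(2)[OF q(1-6) q(8)] t nz by (intro mult_pos_neg divide_pos_pos) auto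
  ultimately show ?thesis by linarith
qed

text \<open>Trades a root with its cut to the left of the branch point for one with its cut to the
  right, as they occur in \<open>r0\<close> and \<open>rh\<close>. On the positive axis the two
  sides differ by a sign, hence the second assumption.\<close>

lemma csqrt_eq_i_times:
  assumes "Im z \<ge> 0" "Im z > 0 \<or> Re z \<le> 0"
  shows "csqrt z = \<i> * csqrt (- z)"
proof (rule csqrt_unique)
  show "(\<i> * csqrt (- z))\<^sup>2 = z" by (simp add: power_mult_distrib)
  show "0 < Re (\<i> * csqrt (- z)) \<or> Re (\<i> * csqrt (- z)) = 0 \<and> 0 \<le> Im (\<i> * csqrt (- z))"
  proof (cases "Im z = 0")
    case True
    with assms(2) have "Re z \<le> 0" by auto
    with True show ?thesis by simp
  next
    case False
    then have "Im z > 0" using assms by auto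
    have "Im (- z) = Im ((csqrt (- z))\<^sup>2)" by (simp only: power2_csqrt)
    then have "- Im z = 2 * Re (csqrt (- z)) * Im (csqrt (- z))"
      by (simp only: Im_power2 uminus_complex.sel)
    with \<open>Im z > 0\<close> have "Re (csqrt (- z)) * Im (csqrt (- z)) < 0" by linarith
    then have "Im (csqrt (- z)) < 0"
      using Re_csqrt[of "- z"] by (auto simp: mult_less_0_iff)
    then show ?thesis by simp
  qed
qed

text \<open>The cut is part of the boundary, and the principal value on it is the limit from above.
  The half-angle formulas without the sign of \<open>Im z\<close> make this explicit.\<close>

lemma continuous_on_csqrt_upper: "continuous_on {z. Im z \<ge> 0} csqrt"
proof -
  have eq: "csqrt z = Complex (sqrt ((cmod z + Re z) / 2)) (sqrt ((cmod z - Re z) / 2))"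
    if "z \<in> {z. Im z \<ge> 0}" for z
  proof (cases "Im z = 0")
    case True
    then show ?thesis by (simp add: complex_eq_iff csqrt.sel)
  next
    case False
    then show ?thesis using that by (simp add: complex_eq_iff csqrt.sel)
  qed
  have "continuous_on {z. Im z \<ge> 0}
    (\<lambda>z. Complex (sqrt ((cmod z + Re z) / 2)) (sqrt ((cmod z - Re z) / 2)))"
    by (intro continuous_intros) auto
  then show ?thesis by (subst continuous_on_cong[OF refl eq])
qed

lemma continuous_on_upper_root: "continuous_on {z. Im z \<ge> 0} upper_root"
proof -
  have "continuous_on {z. Im z \<ge> 0} (\<lambda>z. csqrt (z - of_real a))" for a
    by (rule continuous_on_compose2[OF continuous_on_csqrt_upper]) (auto intro!: continuous_intros)
  from this[of 0] this[of "1/2"] this[of 2] show ?thesis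
    unfolding upper_root_def by (auto intro!: continuous_intros)
qed

section \<open>Charts at the branch points\<close>

lemma has_vector_derivative_cong_eventually:
  assumes "eventually (\<lambda>u. f u = g u) (nhds t)"
  shows "(f has_vector_derivative v) (at t) \<longleftrightarrow> (g has_vector_derivative v) (at t)"
  by (rule has_vector_derivative_cong_ev)
    (use assms in \<open>auto dest: eventually_nhds_x_imp_x\<close>)

text \<open>
  A chart around the branch point \<open>e\<close>: the curve is parametrized by \<open>z = e + s\<^sup>2\<close>,
  \<open>w = s \<cdot> r z\<close> with \<open>r\<close> a branch of the square root of \<open>cubic z / (z - e)\<close>. The pull-back of
  \<open>(z + l) dz / w\<close> is \<open>2 (e + s\<^sup>2 + l) / r (e + s\<^sup>2) ds\<close>, which is even, so that its primitive is odd.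
\<close>

locale sqrt_chart =
  fixes e :: real and D :: "complex set" and r :: "complex \<Rightarrow> complex" and \<epsilon> :: real
  assumes open_D: "open D"
    and e_in_D: "of_real e \<in> D"
    and segment_D: "z \<in> D \<Longrightarrow> closed_segment (of_real e) z \<subseteq> D"
    and cnj_D: "z \<in> D \<Longrightarrow> cnj z \<in> D"
    and r_holomorphic: "r holomorphic_on D"
    and r_power2: "z \<in> D \<Longrightarrow> (z - of_real e) * (r z)\<^sup>2 = cubic z"
    and r_nonzero: "z \<in> D \<Longrightarrow> r z \<noteq> 0"
    and r_cnj: "z \<in> D \<Longrightarrow> r (cnj z) = of_real \<epsilon> * cnj (r z)"
    and eps: "\<epsilon> = 1 \<or> \<epsilon> = -1"
begin

definition S :: "complex set" where
  "S = {s. of_real e + s\<^sup>2 \<in> D}"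

definition chart :: "complex \<Rightarrow> complex \<times> complex" where
  "chart s = (of_real e + s\<^sup>2, s * r (of_real e + s\<^sup>2))"

definition coord :: "complex \<times> complex \<Rightarrow> complex" where
  "coord p = snd p / r (fst p)"

definition integrand :: "real \<Rightarrow> complex \<Rightarrow> complex" where
  "integrand l s = 2 * (of_real e + s\<^sup>2 + of_real l) / r (of_real e + s\<^sup>2)"

definition prim :: "real \<Rightarrow> complex \<Rightarrow> complex" where
  "prim l s = contour_integral (linepath 0 s) (integrand l)"

lemma open_S: "open S"
proof -
  have "S = (\<lambda>s. of_real e + s\<^sup>2) -` D" by (auto simp: S_def)
  moreover have "open ((\<lambda>s. of_real e + s\<^sup>2) -` D)"
    by (intro open_vimage[OF open_D] continuous_intros)
  ultimately show ?thesis by simp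
qed

lemma zero_in_S: "0 \<in> S"
  using e_in_D by (simp add: S_def)

text \<open>Scaling \<open>s\<close> by \<open>u\<close> moves \<open>e + s^2\<close> along the
  segment from \<open>e\<close> in the ratio \<open>u^2\<close>, so that star-shapedness of
  \<open>D\<close> about \<open>e\<close> becomes star-shapedness of \<open>S\<close> about
  0.\<close>

lemma scaled_in_S:
  assumes "s \<in> S" "0 \<le> u" "u \<le> 1"
  shows "of_real u * s \<in> S"
proof -
  have "of_real e + (of_real u * s)\<^sup>2 = (1 - u\<^sup>2) *\<^sub>R of_real e + u\<^sup>2 *\<^sub>R (of_real e + s\<^sup>2)"
    by (simp add: scaleR_conv_of_real algebra_simps power_mult_distrib)
  moreover have "u\<^sup>2 \<le> 1" using assms by (simp add: power_le_one)
  ultimately have "of_real e + (of_real u * s)\<^sup>2 \<in> closed_segment (of_real e) (of_real e + s\<^sup>2)"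
    unfolding closed_segment_def by (auto intro!: exI[of _ "u\<^sup>2"])
  then show ?thesis using segment_D assms(1) by (auto simp: S_def)
qed

lemma segment_S: "s \<in> S \<Longrightarrow> closed_segment 0 s \<subseteq> S"
  using scaled_in_S by (force simp: closed_segment_def scaleR_conv_of_real)

lemma starlike_S: "starlike S"
  unfolding starlike_def using zero_in_S segment_S by auto

lemma connected_S: "connected S"
  using starlike_S starlike_imp_connected by blast

lemma minus_in_S: "s \<in> S \<Longrightarrow> - s \<in> S"
  by (simp add: S_def)

lemma cnj_in_S: "s \<in> S \<Longrightarrow> cnj s \<in> S"
  using cnj_D[of "of_real e + s\<^sup>2"] by (simp add: S_def)

lemma coord_chart: "s \<in> S \<Longrightarrow> coord (chart s) = s"
  using r_nonzero by (simp add: coord_def chart_def S_def)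

lemma chart_in_curve: "s \<in> S \<Longrightarrow> chart s \<in> curve"
  using r_power2[of "of_real e + s\<^sup>2"] by (simp add: curve_def chart_def S_def power_mult_distrib)

lemma coord_power2:
  assumes "p \<in> curve" "fst p \<in> D"
  shows "of_real e + (coord p)\<^sup>2 = fst p"
proof -
  have "(snd p)\<^sup>2 = (fst p - of_real e) * (r (fst p))\<^sup>2"
    using assms r_power2 by (auto simp: curve_def)
  then show ?thesis
    using r_nonzero[OF assms(2)] by (simp add: coord_def power_divide)
qed

lemma coord_in_S: "p \<in> curve \<Longrightarrow> fst p \<in> D \<Longrightarrow> coord p \<in> S"
  by (simp add: S_def coord_power2)

lemma chart_coord: "p \<in> curve \<Longrightarrow> fst p \<in> D \<Longrightarrow> chart (coord p) = p"
  using r_nonzero by (simp add: chart_def coord_power2) (simp add: coord_def)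

lemma r_chart_holomorphic: "(\<lambda>s. r (of_real e + s\<^sup>2)) holomorphic_on S"
proof -
  have "(r \<circ> (\<lambda>s. of_real e + s\<^sup>2)) holomorphic_on S"
    by (rule holomorphic_on_compose_gen[OF _ r_holomorphic])
      (auto intro!: holomorphic_intros simp: S_def)
  then show ?thesis by (simp add: o_def)
qed

lemma integrand_holomorphic: "integrand l holomorphic_on S"
  unfolding integrand_def[abs_def] using r_nonzero
  by (intro holomorphic_intros r_chart_holomorphic) (auto simp: S_def)

lemma prim_0 [simp]: "prim l 0 = 0"
  by (simp add: prim_def)

lemma prim_deriv:
  assumes "s \<in> S"
  shows "(prim l has_field_derivative integrand l s) (at s)"
proof -
  obtain H where H: "\<And>x. x \<in> S \<Longrightarrow> (H has_field_derivative integrand l x) (at x)"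
    using holomorphic_starlike_primitive[of S "integrand l" "{}"] starlike_S open_S
      integrand_holomorphic[of l] holomorphic_on_imp_continuous_on holomorphic_on_imp_differentiable_at
    by (metis Diff_empty finite.emptyI)
  have "prim l x = H x - H 0" if "x \<in> S" for x
  proof -
    have "(integrand l has_contour_integral (H (pathfinish (linepath 0 x)) - H (pathstart (linepath 0 x))))
      (linepath 0 x)"
      by (rule contour_integral_primitive[OF has_field_derivative_at_within[OF H] valid_path_linepath])
        (use segment_S[OF that] in auto)
    then show ?thesis
      unfolding prim_def by (simp add: contour_integral_unique)
  qed
  moreover have "((\<lambda>x. H x - H 0) has_field_derivative integrand l s) (at s)"
    using H[OF assms] by (auto intro!: derivative_eq_intros)
  ultimately show ?thesis
    using has_field_derivative_transform_within_open[OF _ open_S assms, of "\<lambda>x. H x - H 0" _ "prim l"] by simp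
qed

text \<open>Source of the next three identities: both sides vanish at 0, and only their derivatives
  have to be compared.\<close>

lemma prim_unique:
  assumes der: "\<And>x. x \<in> S \<Longrightarrow> (Q has_field_derivative integrand l x) (at x)"
    and "Q 0 = 0" and s: "s \<in> S"
  shows "Q s = prim l s"
proof -
  have "(\<lambda>x. Q x - prim l x) constant_on S"
    by (rule has_field_derivative_0_imp_constant_on[OF _ connected_S open_S])
      (use der prim_deriv in \<open>auto intro!: derivative_eq_intros\<close>)
  then obtain c where "\<And>x. x \<in> S \<Longrightarrow> Q x - prim l x = c"
    by (auto simp: constant_on_def)
  from this[OF zero_in_S] this[OF s] assms(2) show ?thesis by simp
qed

lemma prim_minus:
  assumes "s \<in> S"
  shows "prim l (- s) = - prim l s"
proof -
  have "- prim l (- s) = prim l s"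
  proof (rule prim_unique[OF _ _ assms])
    fix x assume "x \<in> S"
    then have "(prim l has_field_derivative integrand l (- x)) (at (- x))"
      by (intro prim_deriv minus_in_S)
    then have "((\<lambda>x. - prim l (- x)) has_field_derivative - (integrand l (- x) * (- 1))) (at x)"
      by (intro DERIV_minus DERIV_chain2) (auto intro!: derivative_eq_intros)
    then show "((\<lambda>x. - prim l (- x)) has_field_derivative integrand l x) (at x)"
      by (simp add: integrand_def)
  qed simp
  then show ?thesis by (metis minus_minus)
qed

lemma prim_cnj:
  assumes "s \<in> S"
  shows "prim l (cnj s) = of_real \<epsilon> * cnj (prim l s)"
proof -
  have "of_real \<epsilon> * (cnj \<circ> prim l \<circ> cnj) s = prim l s"
  proof (rule prim_unique[OF _ _ assms])
    fix x assume x: "x \<in> S"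
    have "(prim l has_field_derivative integrand l (cnj x)) (at (cnj x))"
      using x by (intro prim_deriv cnj_in_S)
    then have "((cnj \<circ> prim l \<circ> cnj) has_field_derivative cnj (integrand l (cnj x))) (at x)"
      by (auto dest: has_field_derivative_cnj_cnj)
    then have "((\<lambda>x. of_real \<epsilon> * (cnj \<circ> prim l \<circ> cnj) x) has_field_derivative
        of_real \<epsilon> * cnj (integrand l (cnj x))) (at x)"
      by (rule DERIV_cmult)
    moreover have "of_real \<epsilon> * cnj (integrand l (cnj x)) = integrand l x"
      using r_cnj[of "of_real e + x\<^sup>2"] x eps by (auto simp: integrand_def S_def)
    ultimately show "((\<lambda>x. of_real \<epsilon> * (cnj \<circ> prim l \<circ> cnj) x) has_field_derivative
        integrand l x) (at x)"
      by simp
  qed simp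
  then have "cnj (prim l s) = cnj (of_real \<epsilon> * (cnj \<circ> prim l \<circ> cnj) s)" by simp
  then show ?thesis using eps by auto
qed

text \<open>The integrand is affine in \<open>l\<close>. The periods inherit this, which is what the
  search for \<open>l1\<close> and \<open>l2\<close> by intermediate values relies on.\<close>

lemma prim_affine:
  assumes "s \<in> S"
  shows "prim l s = (1 - of_real l) * prim 0 s + of_real l * prim 1 s"
proof -
  have "(1 - of_real l) * prim 0 s + of_real l * prim 1 s = prim l s"
  proof (rule prim_unique[OF _ _ assms])
    fix x assume x: "x \<in> S"
    have "r (of_real e + x\<^sup>2) \<noteq> 0" using x r_nonzero by (simp add: S_def)
    then show "((\<lambda>s. (1 - of_real l) * prim 0 s + of_real l * prim 1 s) has_field_derivative integrand l x) (at x)"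
      by (auto intro!: derivative_eq_intros prim_deriv x simp: integrand_def field_simps)
  qed simp
  then show ?thesis by simp
qed

text \<open>On the real and on the imaginary axis of the parameter plane the forms are real up to a
  constant phase, which the value of the primitive inherits.\<close>

lemma prim_ray:
  fixes d \<rho> :: complex and \<delta> \<tau> :: real
  assumes d: "d\<^sup>2 = of_real \<delta>" "d \<noteq> 0" and "0 < \<tau>" and "\<rho> \<noteq> 0"
    and inD: "\<And>\<sigma>. 0 \<le> \<sigma> \<Longrightarrow> \<sigma> \<le> \<tau> \<Longrightarrow> of_real (e + \<delta> * \<sigma>\<^sup>2) \<in> D"
    and rP: "\<And>\<sigma>. 0 \<le> \<sigma> \<Longrightarrow> \<sigma> \<le> \<tau> \<Longrightarrow> r (of_real (e + \<delta> * \<sigma>\<^sup>2)) = \<rho> * of_real (P \<sigma>)"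
    and P: "\<And>\<sigma>. 0 \<le> \<sigma> \<Longrightarrow> \<sigma> \<le> \<tau> \<Longrightarrow> P \<sigma> > 0"
  obtains R where "prim l (d * of_real \<tau>) = d / \<rho> * of_real R"
    and "(\<And>\<sigma>. 0 < \<sigma> \<Longrightarrow> \<sigma> < \<tau> \<Longrightarrow> e + \<delta> * \<sigma>\<^sup>2 + l > 0) \<Longrightarrow> R > 0"
    and "(\<And>\<sigma>. 0 < \<sigma> \<Longrightarrow> \<sigma> < \<tau> \<Longrightarrow> e + \<delta> * \<sigma>\<^sup>2 + l < 0) \<Longrightarrow> R < 0"
proof -
  \<comment> \<open>The factor \<open>\<rho> / d\<close> cancels the phase of the integrand along
    the ray, so that \<open>h\<close> has the real derivative \<open>q\<close>, with the sign of
    \<open>z + l\<close>.\<close>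
  define h where "h \<sigma> = \<rho> / d * prim l (d * of_real \<sigma>)" for \<sigma> :: real
  define q where "q \<sigma> = 2 * (e + \<delta> * \<sigma>\<^sup>2 + l) / P \<sigma>" for \<sigma>
  have h: "(h has_vector_derivative of_real (q \<sigma>)) (at \<sigma>)" if "0 \<le> \<sigma>" "\<sigma> \<le> \<tau>" for \<sigma>
  proof -
    have sq: "of_real e + (d * of_real \<sigma>)\<^sup>2 = (of_real (e + \<delta> * \<sigma>\<^sup>2) :: complex)"
      by (simp add: power_mult_distrib d)
    have "d * of_real \<sigma> \<in> S"
      unfolding S_def mem_Collect_eq sq using inD that by blast
    from prim_deriv[OF this, of l]
    have "((\<lambda>z. \<rho> / d * prim l (d * z)) has_field_derivative
       \<rho> / d * (integrand l (d * of_real \<sigma>) * d)) (at (of_real \<sigma>))"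
      by (intro DERIV_cmult DERIV_chain2[of "prim l"]) (auto intro!: derivative_eq_intros)
    moreover have "\<rho> / d * (integrand l (d * of_real \<sigma>) * d) = of_real (q \<sigma>)"
      using d(2) \<open>\<rho> \<noteq> 0\<close> P[OF that]
      unfolding integrand_def sq rP[OF that] q_def by (simp add: field_simps)
    ultimately show ?thesis
      unfolding h_def[abs_def]
      using has_vector_derivative_real_field[of "\<lambda>z. \<rho> / d * prim l (d * z)"] by simp
  qed
  have Re: "((\<lambda>\<sigma>. Re (h \<sigma>)) has_real_derivative q \<sigma>) (at \<sigma>)"
    and Im: "((\<lambda>\<sigma>. Im (h \<sigma>)) has_real_derivative 0) (at \<sigma>)" if "0 \<le> \<sigma>" "\<sigma> \<le> \<tau>" for \<sigma>
    using has_vector_derivative_complex_iff[of h "of_real (q \<sigma>)" "at \<sigma>"] h[OF that] 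
    by (simp_all add: has_real_derivative_iff_has_vector_derivative)
  have cont: "continuous_on {0..\<tau>} (\<lambda>\<sigma>. Re (h \<sigma>))" "continuous_on {0..\<tau>} (\<lambda>\<sigma>. Im (h \<sigma>))"
    using Re Im by (auto intro!: DERIV_atLeastAtMost_imp_continuous_on)
  have h0: "h 0 = 0" by (simp add: h_def)
  have "Im (h \<tau>) = Im (h 0)"
    by (rule DERIV_isconst_end[OF \<open>0 < \<tau>\<close> cont(2)]) (use Im in auto)
  with h0 have "h \<tau> = of_real (Re (h \<tau>))"
    by (simp add: complex_eq_iff)
  then have 1: "prim l (d * of_real \<tau>) = d / \<rho> * of_real (Re (h \<tau>))"
    using d(2) \<open>\<rho> \<noteq> 0\<close> by (simp add: h_def field_simps)
  have 2: "Re (h \<tau>) > 0" if "\<And>\<sigma>. 0 < \<sigma> \<Longrightarrow> \<sigma> < \<tau> \<Longrightarrow> e + \<delta> * \<sigma>\<^sup>2 + l > 0"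
  proof -
    have "Re (h 0) < Re (h \<tau>)"
    proof (rule DERIV_pos_imp_increasing_open[OF \<open>0 < \<tau>\<close> _ cont(1)])
      fix \<sigma> assume "0 < \<sigma>" "\<sigma> < \<tau>"
      then show "\<exists>y. ((\<lambda>\<sigma>. Re (h \<sigma>)) has_real_derivative y) (at \<sigma>) \<and> y > 0"
        using Re[of \<sigma>] P[of \<sigma>] that[of \<sigma>]
        by (auto intro!: exI[of _ "q \<sigma>"] divide_pos_pos simp: q_def)
    qed
    then show ?thesis by (simp add: h0)
  qed
  have 3: "Re (h \<tau>) < 0" if "\<And>\<sigma>. 0 < \<sigma> \<Longrightarrow> \<sigma> < \<tau> \<Longrightarrow> e + \<delta> * \<sigma>\<^sup>2 + l < 0"
  proof -
    have "Re (h 0) > Re (h \<tau>)"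
    proof (rule DERIV_neg_imp_decreasing_open[OF \<open>0 < \<tau>\<close> _ cont(1)])
      fix \<sigma> assume "0 < \<sigma>" "\<sigma> < \<tau>"
      then show "\<exists>y. ((\<lambda>\<sigma>. Re (h \<sigma>)) has_real_derivative y) (at \<sigma>) \<and> y < 0"
        using Re[of \<sigma>] P[of \<sigma>] that[of \<sigma>]
        by (auto intro!: exI[of _ "q \<sigma>"] divide_neg_pos simp: q_def)
    qed
    then show ?thesis by (simp add: h0)
  qed
  show ?thesis using that[OF 1 2 3] by blast
qed

text \<open>A local branch \<open>q\<close> of the root of \<open>z - e\<close> is a chart
  coordinate with \<open>w = q z * r z\<close>. In the variable \<open>z\<close> the derivative is
  \<open>(z + l) / w\<close> whatever the chart, which makes primitives of different charts
  comparable.\<close>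

lemma prim_sqrt_deriv:
  assumes "z \<in> D" and q: "(q has_field_derivative 1 / (2 * q z)) (at z)"
    and "(q z)\<^sup>2 = z - of_real e" "q z \<noteq> 0"
  shows "((\<lambda>z. prim l (q z)) has_field_derivative (z + of_real l) / (q z * r z)) (at z)"
proof -
  have z: "of_real e + (q z)\<^sup>2 = z" using assms by simp
  then have "q z \<in> S" using assms(1) by (simp add: S_def)
  from DERIV_chain2[OF prim_deriv[OF this] q]
  have "((\<lambda>z. prim l (q z)) has_field_derivative integrand l (q z) * (1 / (2 * q z))) (at z)" .
  moreover have "integrand l (q z) * (1 / (2 * q z)) = (z + of_real l) / (q z * r z)"
    using r_nonzero[OF assms(1)] assms(4) by (simp add: integrand_def z field_simps)
  ultimately show ?thesis by simp
qed

definition val :: "real \<Rightarrow> complex \<times> complex \<Rightarrow> complex" where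
  "val l p = prim l (coord p)"

lemma val_chart: "s \<in> S \<Longrightarrow> val l (chart s) = prim l s"
  by (simp add: val_def coord_chart)

lemma val_minus:
  assumes "p \<in> curve" "fst p \<in> D"
  shows "val l (fst p, - snd p) = - val l p"
  using prim_minus[OF coord_in_S[OF assms]] by (simp add: val_def coord_def)

text \<open>The sign \<epsilon> enters through \<open>coord\<close> and through
  \<open>prim_cnj\<close>; it cancels because \<open>prim\<close> is odd.\<close>

lemma val_cnj:
  assumes "p \<in> curve" "fst p \<in> D"
  shows "val l (cnj (fst p), cnj (snd p)) = cnj (val l p)"
proof -
  have S: "coord p \<in> S" "cnj (coord p) \<in> S"
    using coord_in_S[OF assms] cnj_in_S by auto
  have "coord (cnj (fst p), cnj (snd p)) = of_real \<epsilon> * cnj (coord p)"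
    using r_cnj[OF assms(2)] eps by (auto simp: coord_def)
  then show ?thesis
    using eps prim_minus[OF S(2)] prim_cnj[OF S(1)] by (auto simp: val_def)
qed

lemma continuous_on_coord: "continuous_on (fst -` D) coord"
  unfolding coord_def[abs_def] using r_nonzero
  by (intro continuous_intros continuous_on_compose2[OF holomorphic_on_imp_continuous_on[OF r_holomorphic]])
    auto

lemma continuous_on_val: "continuous_on (curve \<inter> fst -` D) (val l)"
proof -
  have "continuous_on S (prim l)"
    using prim_deriv DERIV_continuous_on has_field_derivative_at_within by metis
  then show ?thesis
    unfolding val_def[abs_def]
    by (rule continuous_on_compose2) (auto intro!: continuous_on_subset[OF continuous_on_coord] coord_in_S)
qed

text \<open>The chain rule goes through \<open>s\<close> and not through \<open>z\<close>: at the
  branch point the velocity of \<open>z\<close> vanishes, and the form has to be read off from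
  \<open>snd v\<close>.\<close>

lemma val_along_path:
  assumes \<gamma>: "(\<gamma> has_vector_derivative v) (at t)"
    and curve: "eventually (\<lambda>u. \<gamma> u \<in> curve) (nhds t)"
    and D: "fst (\<gamma> t) \<in> D"
  shows "((\<lambda>u. val l (\<gamma> u)) has_vector_derivative (fst (\<gamma> t) + of_real l) * dz_over_w (\<gamma> t) v) (at t)"
proof -
  define z where "z = fst (\<gamma> t)"
  define s where "s u = coord (\<gamma> u)" for u
  have curve_t: "\<gamma> t \<in> curve" using curve eventually_nhds_x_imp_x by blast
  have rz: "r z \<noteq> 0" using r_nonzero D z_def by simp
  have f: "((\<lambda>u. fst (\<gamma> u)) has_vector_derivative fst v) (at t)"
    and g: "((\<lambda>u. snd (\<gamma> u)) has_vector_derivative snd v) (at t)"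
    using bounded_linear.has_vector_derivative[OF bounded_linear_fst \<gamma>]
      bounded_linear.has_vector_derivative[OF bounded_linear_snd \<gamma>] by auto
  obtain r' where r': "(r has_field_derivative r') (at z)"
    using r_holomorphic open_D D holomorphic_on_imp_differentiable_at
    by (metis field_differentiable_def z_def)
  have rf: "((\<lambda>u. r (fst (\<gamma> u))) has_vector_derivative fst v * r') (at t)"
    using field_vector_diff_chain_at[OF f r'[unfolded z_def]] by (simp add: o_def)
  obtain s' where s': "(s has_vector_derivative s') (at t)"
  proof -
    have "(inverse has_field_derivative - (inverse (r z) ^ Suc (Suc 0))) (at (r (fst (\<gamma> t))))"
      using DERIV_inverse rz by (simp add: z_def)
    from has_vector_derivative_mult[OF g field_vector_diff_chain_at[OF rf this]]
    show ?thesis using that unfolding s_def[abs_def] coord_def divide_inverse o_def by blast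
  qed
  have nearD: "eventually (\<lambda>u. fst (\<gamma> u) \<in> D) (nhds t)"
  proof -
    have "isCont (\<lambda>u. fst (\<gamma> u)) t"
      using f has_vector_derivative_continuous by blast
    then show ?thesis
      using D open_D by (metis isCont_def topological_tendstoD tendsto_at_iff_tendsto_nhds)
  qed
  have fst_eq: "eventually (\<lambda>u. fst (\<gamma> u) = of_real e + (s u)\<^sup>2) (nhds t)"
    using curve nearD by eventually_elim (simp add: s_def coord_power2)
  have snd_eq: "eventually (\<lambda>u. snd (\<gamma> u) = s u * r (fst (\<gamma> u))) (nhds t)"
    using nearD by eventually_elim (simp add: s_def coord_def r_nonzero)
  have "((\<lambda>u. of_real e + (s u)\<^sup>2) has_vector_derivative 2 * s t * s') (at t)"
  proof -
    have "((\<lambda>x. of_real e + x\<^sup>2) has_field_derivative 2 * s t) (at (s t))"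
      by (auto intro!: derivative_eq_intros)
    from field_vector_diff_chain_at[OF s' this] show ?thesis
      by (simp only: o_def mult.commute)
  qed
  then have "((\<lambda>u. fst (\<gamma> u)) has_vector_derivative 2 * s t * s') (at t)"
    using has_vector_derivative_cong_eventually[OF fst_eq] by blast
  then have v1: "fst v = 2 * s t * s'"
    using f vector_derivative_unique_at by blast
  have "((\<lambda>u. s u * r (fst (\<gamma> u))) has_vector_derivative s t * (fst v * r') + s' * r z) (at t)"
    using has_vector_derivative_mult[OF s' rf] by (simp add: z_def)
  then have "((\<lambda>u. snd (\<gamma> u)) has_vector_derivative s t * (fst v * r') + s' * r z) (at t)"
    using has_vector_derivative_cong_eventually[OF snd_eq] by blast
  then have v2: "snd v = s t * (fst v * r') + s' * r z"
    using g vector_derivative_unique_at by blast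
  have w: "snd (\<gamma> t) = s t * r z"
    using rz by (simp add: s_def coord_def z_def)
  have dz: "dz_over_w (\<gamma> t) v = 2 * s' / r z"
  proof (cases "s t = 0")
    case False
    then show ?thesis using w rz v1 by (simp add: dz_over_w_def)
  next
    case True
    then have ze: "z = of_real e"
      using eventually_nhds_x_imp_x[OF fst_eq] by (simp add: z_def)
    \<comment> \<open>At the branch point the derivative of \<open>cubic\<close> is
      \<open>(r e)^2\<close> and \<open>snd v = s' * r e\<close>, so the second clause of
      \<open>dz_over_w\<close> also yields \<open>2 s' / r e\<close>.\<close>
    have "((\<lambda>x. (x - of_real e) * (r x)\<^sup>2) has_field_derivative (r z)\<^sup>2) (at z)"
      using r' by (auto intro!: derivative_eq_intros simp: ze)
    then have "(cubic has_field_derivative (r z)\<^sup>2) (at z)"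
      by (rule has_field_derivative_transform_within_open[OF _ open_D]) (use D r_power2 z_def in auto)
    then have "deriv cubic z = (r z)\<^sup>2" by (rule DERIV_imp_deriv)
    then show ?thesis
      using True v2 w rz by (simp add: dz_over_w_def z_def[symmetric] power2_eq_square)
  qed
  have st: "s t \<in> S" "of_real e + (s t)\<^sup>2 = z"
    using coord_in_S[OF curve_t D] coord_power2[OF curve_t D] by (auto simp: s_def z_def)
  have "((\<lambda>u. prim l (s u)) has_vector_derivative s' * integrand l (s t)) (at t)"
    using field_vector_diff_chain_at[OF s' prim_deriv[OF st(1)]] by (simp add: o_def)
  then show ?thesis
    by (simp add: val_def s_def[symmetric] dz integrand_def st(2) z_def[symmetric] mult_ac)
qed

text \<open>Openness of the image comes from the continuous inverse \<open>coord\<close>. At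
  \<open>s = 0\<close> the derivative of \<open>z\<close> vanishes, but that of \<open>w\<close> is
  \<open>r e\<close>, which does not.\<close>

lemma local_parametrization_chart:
  assumes U: "open U" "U \<subseteq> S" and nz: "\<And>s. s \<in> U \<Longrightarrow> of_real e + s\<^sup>2 \<noteq> 0"
  shows "local_parametrization punctured_curve U chart"
  unfolding local_parametrization_def
proof (intro conjI ballI)
  show "open U" by fact
  have fc: "fst \<circ> chart = (\<lambda>s. of_real e + s\<^sup>2)" "snd \<circ> chart = (\<lambda>s. s * r (of_real e + s\<^sup>2))"
    by (auto simp: chart_def)
  show "(fst \<circ> chart) holomorphic_on U"
    unfolding fc by (intro holomorphic_intros)
  show "(snd \<circ> chart) holomorphic_on U"
    unfolding fc by (intro holomorphic_intros holomorphic_on_subset[OF r_chart_holomorphic U(2)])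
  show "inj_on chart U"
    using coord_chart U(2) by (intro inj_on_inverseI[of U coord]) auto
  have "chart ` U = punctured_curve \<inter> ((fst -` D) \<inter> coord -` U)"
  proof (intro equalityI subsetI)
    fix p assume "p \<in> chart ` U"
    then obtain s where s: "s \<in> U" "p = chart s" by auto
    then have "s \<in> S" using U by auto
    with s nz[OF s(1)] show "p \<in> punctured_curve \<inter> ((fst -` D) \<inter> coord -` U)"
      by (auto simp: punctured_curve_def chart_in_curve coord_chart) (auto simp: chart_def S_def)
  next
    fix p assume p: "p \<in> punctured_curve \<inter> ((fst -` D) \<inter> coord -` U)"
    then show "p \<in> chart ` U"
      using chart_coord[of p] by (force simp: punctured_curve_def)
  qed
  moreover have "open (coord -` U \<inter> (fst -` D))"
    using continuous_on_open_vimage[OF open_vimage_fst[OF open_D], of coord] continuous_on_coord U(1)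
    by blast
  ultimately show "openin (top_of_set punctured_curve) (chart ` U)"
    by (simp add: openin_open_Int Int_commute)
  fix s assume "s \<in> U"
  show "(deriv (fst \<circ> chart) s, deriv (snd \<circ> chart) s) \<noteq> (0, 0)"
  proof (cases "s = 0")
    case False
    have "deriv (fst \<circ> chart) s = 2 * s"
      unfolding fc by (rule DERIV_imp_deriv) (auto intro!: derivative_eq_intros)
    with False show ?thesis by simp
  next
    case True
    obtain r' where r': "((\<lambda>s. r (of_real e + s\<^sup>2)) has_field_derivative r') (at 0)"
      using r_chart_holomorphic open_S zero_in_S holomorphic_on_imp_differentiable_at
      by (metis field_differentiable_def)
    have "deriv (snd \<circ> chart) 0 = r (of_real e)"
      unfolding fc by (rule DERIV_imp_deriv) (use r' in \<open>auto intro!: derivative_eq_intros\<close>)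
    with True r_nonzero[OF e_in_D] show ?thesis by simp
  qed
qed

end

section \<open>The three charts and the periods\<close>

text \<open>
  The suffixes \<open>0\<close>, \<open>h\<close>, \<open>2\<close> refer to the branch points \<open>0\<close>, \<open>1/2\<close>, \<open>2\<close>. The branches \<open>r\<close> are
  normalized such that \<open>csqrt (z - e) * r z\<close> is the same function on the upper half-plane for all three.
\<close>

definition D0 :: "complex set" where "D0 = {z. Im z \<noteq> 0 \<or> Re z < 1/2}"
definition Dh :: "complex set" where "Dh = {z. Im z \<noteq> 0 \<or> 0 < Re z \<and> Re z < 2}"
definition D2 :: "complex set" where "D2 = {z. Im z \<noteq> 0 \<or> 1/2 < Re z}"

definition r0 :: "complex \<Rightarrow> complex" where "r0 z = - (csqrt (1/2 - z) * csqrt (2 - z))"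
definition rh :: "complex \<Rightarrow> complex" where "rh z = \<i> * csqrt z * csqrt (2 - z)"
definition r2 :: "complex \<Rightarrow> complex" where "r2 z = csqrt z * csqrt (z - 1/2)"

lemma cnj_csqrt': "Im z \<noteq> 0 \<or> Re z > 0 \<Longrightarrow> csqrt (cnj z) = cnj (csqrt z)"
  by (rule cnj_csqrt[symmetric]) (auto simp: complex_nonpos_Reals_iff)

lemma csqrt_eq_0D: "csqrt z = 0 \<Longrightarrow> Re z = 0 \<and> Im z = 0"
  by simp

lemma segment_avoids:
  assumes "z \<in> closed_segment (of_real e) y"
  obtains u where "0 \<le> u" "u \<le> 1" "Im z = u * Im y" "Re z = (1 - u) * e + u * Re y"
  using assms by (auto simp: closed_segment_def)

lemma open_slits: "open D0" "open Dh" "open D2"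
proof -
  have eq: "D0 = {z. Im z > 0} \<union> {z. Im z < 0} \<union> {z. Re z < 1/2}"
    "Dh = {z. Im z > 0} \<union> {z. Im z < 0} \<union> ({z. 0 < Re z} \<inter> {z. Re z < 2})"
    "D2 = {z. Im z > 0} \<union> {z. Im z < 0} \<union> {z. 1/2 < Re z}"
    by (auto simp: D0_def Dh_def D2_def)
  show "open D0" "open Dh" "open D2"
    unfolding eq by (intro open_Un open_Int open_halfspace_Im_gt open_halfspace_Im_lt
        open_halfspace_Re_gt open_halfspace_Re_lt)+
qed

text \<open>The slits are real rays pointing away from the branch point, so the slit plane is
  star-shaped about it; likewise in the next two interpretations.\<close>

interpretation c0: sqrt_chart 0 D0 r0 1
proof
  show "open D0" by (rule open_slits)
  show "closed_segment (of_real 0) z \<subseteq> D0" if "z \<in> D0" for z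
  proof
    fix y assume "y \<in> closed_segment (of_real 0) z"
    then obtain u where u: "0 \<le> u" "u \<le> 1" "Im y = u * Im z" "Re y = (1 - u) * 0 + u * Re z"
      by (rule segment_avoids)
    show "y \<in> D0"
    proof (cases "Im z \<noteq> 0 \<and> u \<noteq> 0")
      case False
      have "u * Re z < 1/2" if "Re z < 1/2"
      proof -
        have "u * Re z \<le> u * max 0 (Re z)" using u by (intro mult_left_mono) auto
        also have "\<dots> \<le> max 0 (Re z)" using u by (intro mult_left_le_one_le) auto
        also have "\<dots> < 1/2" using that by auto
        finally show ?thesis .
      qed
      with False that u show ?thesis by (auto simp: D0_def)
    qed (use u in \<open>auto simp: D0_def\<close>)
  qed
  show "r0 holomorphic_on D0"
    unfolding r0_def[abs_def]
    by (intro holomorphic_intros) (auto simp: D0_def complex_nonpos_Reals_iff)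
  fix z assume z: "z \<in> D0"
  show "(z - of_real 0) * (r0 z)\<^sup>2 = cubic z"
    by (simp add: r0_def cubic_def power_mult_distrib field_simps)
  show "r0 z \<noteq> 0" using z by (auto simp: r0_def D0_def simp del: csqrt_eq_0 dest!: csqrt_eq_0D)
  show "r0 (cnj z) = of_real 1 * cnj (r0 z)"
    using z cnj_csqrt'[of "1/2 - z"] cnj_csqrt'[of "2 - z"] by (auto simp: r0_def D0_def)
qed (auto simp: D0_def)

text \<open>The factor \<open>\<i>\<close> in \<open>rh\<close> causes the sign -1 under
  conjugation.\<close>

interpretation ch: sqrt_chart "1/2" Dh rh "- 1"
proof
  show "open Dh" by (rule open_slits)
  show "closed_segment (of_real (1/2)) z \<subseteq> Dh" if "z \<in> Dh" for z
  proof
    fix y assume "y \<in> closed_segment (of_real (1/2)) z"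
    then obtain u where u: "0 \<le> u" "u \<le> 1" "Im y = u * Im z" "Re y = (1 - u) * (1/2) + u * Re z"
      by (rule segment_avoids)
    show "y \<in> Dh"
    proof (cases "Im z \<noteq> 0 \<and> u \<noteq> 0")
      case False
      have "0 < Re y \<and> Re y < 2" if "0 < Re z" "Re z < 2"
      proof -
        have "Re y \<in> closed_segment (1/2) (Re z)"
          unfolding u(4) closed_segment_def using u by auto
        then show ?thesis using that by (auto simp: closed_segment_eq_real_ivl split: if_splits)
      qed
      with False that u show ?thesis by (auto simp: Dh_def)
    qed (use u in \<open>auto simp: Dh_def\<close>)
  qed
  show "rh holomorphic_on Dh"
    unfolding rh_def[abs_def]
    by (intro holomorphic_intros) (auto simp: Dh_def complex_nonpos_Reals_iff)
  fix z assume z: "z \<in> Dh"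
  show "(z - of_real (1/2)) * (rh z)\<^sup>2 = cubic z"
    by (simp add: rh_def cubic_def power_mult_distrib field_simps)
  show "rh z \<noteq> 0" using z by (auto simp: rh_def Dh_def simp del: csqrt_eq_0 dest!: csqrt_eq_0D)
  show "rh (cnj z) = of_real (- 1) * cnj (rh z)"
    using z cnj_csqrt'[of "z"] cnj_csqrt'[of "2 - z"] by (auto simp: rh_def Dh_def)
qed (auto simp: Dh_def)

interpretation c2: sqrt_chart 2 D2 r2 1
proof
  show "open D2" by (rule open_slits)
  show "closed_segment (of_real 2) z \<subseteq> D2" if "z \<in> D2" for z
  proof
    fix y assume "y \<in> closed_segment (of_real 2) z"
    then obtain u where u: "0 \<le> u" "u \<le> 1" "Im y = u * Im z" "Re y = (1 - u) * 2 + u * Re z"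
      by (rule segment_avoids)
    show "y \<in> D2"
    proof (cases "Im z \<noteq> 0 \<and> u \<noteq> 0")
      case False
      have "1/2 < Re y" if "1/2 < Re z"
      proof -
        have "Re y \<in> closed_segment 2 (Re z)"
          unfolding u(4) closed_segment_def using u by auto
        then show ?thesis using that by (auto simp: closed_segment_eq_real_ivl split: if_splits)
      qed
      with False that u show ?thesis by (auto simp: D2_def)
    qed (use u in \<open>auto simp: D2_def\<close>)
  qed
  show "r2 holomorphic_on D2"
    unfolding r2_def[abs_def]
    by (intro holomorphic_intros) (auto simp: D2_def complex_nonpos_Reals_iff)
  fix z assume z: "z \<in> D2"
  show "(z - of_real 2) * (r2 z)\<^sup>2 = cubic z"
    by (simp add: r2_def cubic_def power_mult_distrib field_simps)
  show "r2 z \<noteq> 0" using z by (auto simp: r2_def D2_def simp del: csqrt_eq_0 dest!: csqrt_eq_0D)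
  show "r2 (cnj z) = of_real 1 * cnj (r2 z)"
    using z cnj_csqrt'[of "z"] cnj_csqrt'[of "z - 1/2"] by (auto simp: r2_def D2_def)
qed (auto simp: D2_def)

section \<open>Phases and signs of the primitives along real and imaginary rays\<close>

lemma csqrt_of_real_pos: "0 \<le> x \<Longrightarrow> z = of_real x \<Longrightarrow> csqrt z = of_real (sqrt x)"
  by (simp add: csqrt_of_real)

text \<open>In this and the following lemmas a real or imaginary ray in \<open>s\<close> is one side
  of the branch point on the real \<open>z\<close>-axis, stopped before the next branch point if
  there is one. The factor in front of \<open>R\<close> is \<open>d / \<rho>\<close>, here with
  \<open>d = 1\<close> and the negative branch \<open>r0\<close>.\<close>

lemma c0_real_ray:
  assumes "0 < \<tau>" "\<tau>\<^sup>2 < 1/2"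
  obtains R where "c0.prim l (of_real \<tau>) = - of_real R"
    and "(\<And>\<sigma>. 0 < \<sigma> \<Longrightarrow> \<sigma> < \<tau> \<Longrightarrow> \<sigma>\<^sup>2 + l > 0) \<Longrightarrow> R > 0"
    and "(\<And>\<sigma>. 0 < \<sigma> \<Longrightarrow> \<sigma> < \<tau> \<Longrightarrow> \<sigma>\<^sup>2 + l < 0) \<Longrightarrow> R < 0"
proof -
  have sq: "\<sigma>\<^sup>2 < 1/2" if "0 \<le> \<sigma>" "\<sigma> \<le> \<tau>" for \<sigma>
    using power_mono[OF that(2) that(1), of 2] assms by linarith
  show ?thesis
  proof (rule c0.prim_ray[of 1 1 \<tau> "- 1" "\<lambda>\<sigma>. sqrt (1/2 - \<sigma>\<^sup>2) * sqrt (2 - \<sigma>\<^sup>2)" l])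
    fix \<sigma> :: real assume \<sigma>: "0 \<le> \<sigma>" "\<sigma> \<le> \<tau>"
    obtain x where x: "\<sigma>\<^sup>2 = x" "0 \<le> x" by simp
    note sq = sq[OF \<sigma>]
    show "of_real (0 + 1 * \<sigma>\<^sup>2) \<in> D0" "0 < sqrt (1/2 - \<sigma>\<^sup>2) * sqrt (2 - \<sigma>\<^sup>2)"
      using x sq by (auto simp: D0_def)
    show "r0 (of_real (0 + 1 * \<sigma>\<^sup>2)) = - 1 * of_real (sqrt (1/2 - \<sigma>\<^sup>2) * sqrt (2 - \<sigma>\<^sup>2))"
      using x sq csqrt_of_real_pos[of "1/2 - \<sigma>\<^sup>2"] csqrt_of_real_pos[of "2 - \<sigma>\<^sup>2"] by (simp add: r0_def)
  qed (use assms that in auto)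
qed

lemma c0_imaginary_ray:
  assumes "0 < \<tau>"
  obtains R where "c0.prim l (\<i> * of_real \<tau>) = - \<i> * of_real R"
proof -
  show ?thesis
  proof (rule c0.prim_ray[of \<i> "-1" \<tau> "- 1" "\<lambda>\<sigma>. sqrt (1/2 + \<sigma>\<^sup>2) * sqrt (2 + \<sigma>\<^sup>2)" l])
    fix \<sigma> :: real assume \<sigma>: "0 \<le> \<sigma>" "\<sigma> \<le> \<tau>"
    obtain x where x: "\<sigma>\<^sup>2 = x" "0 \<le> x" by simp
    show "of_real (0 + - 1 * \<sigma>\<^sup>2) \<in> D0" "0 < sqrt (1/2 + \<sigma>\<^sup>2) * sqrt (2 + \<sigma>\<^sup>2)"
      using x by (auto simp: D0_def)
    show "r0 (of_real (0 + - 1 * \<sigma>\<^sup>2)) = - 1 * of_real (sqrt (1/2 + \<sigma>\<^sup>2) * sqrt (2 + \<sigma>\<^sup>2))"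
      using x csqrt_of_real_pos[of "1/2 + \<sigma>\<^sup>2"] csqrt_of_real_pos[of "2 + \<sigma>\<^sup>2"] by (simp add: r0_def)
  qed (use assms that in auto)
qed

lemma ch_real_ray:
  assumes "0 < \<tau>" "\<tau>\<^sup>2 < 3/2"
  obtains R where "ch.prim l (of_real \<tau>) = - \<i> * of_real R"
    and "(\<And>\<sigma>. 0 < \<sigma> \<Longrightarrow> \<sigma> < \<tau> \<Longrightarrow> 1/2 + \<sigma>\<^sup>2 + l > 0) \<Longrightarrow> R > 0"
    and "(\<And>\<sigma>. 0 < \<sigma> \<Longrightarrow> \<sigma> < \<tau> \<Longrightarrow> 1/2 + \<sigma>\<^sup>2 + l < 0) \<Longrightarrow> R < 0"
proof -
  have sq: "\<sigma>\<^sup>2 < 3/2" if "0 \<le> \<sigma>" "\<sigma> \<le> \<tau>" for \<sigma>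
    using power_mono[OF that(2) that(1), of 2] assms by linarith
  show ?thesis
  proof (rule ch.prim_ray[of 1 1 \<tau> \<i> "\<lambda>\<sigma>. sqrt (1/2 + \<sigma>\<^sup>2) * sqrt (3/2 - \<sigma>\<^sup>2)" l])
    fix \<sigma> :: real assume \<sigma>: "0 \<le> \<sigma>" "\<sigma> \<le> \<tau>"
    obtain x where x: "\<sigma>\<^sup>2 = x" "0 \<le> x" by simp
    note sq = sq[OF \<sigma>]
    show "of_real (1/2 + 1 * \<sigma>\<^sup>2) \<in> Dh" "0 < sqrt (1/2 + \<sigma>\<^sup>2) * sqrt (3/2 - \<sigma>\<^sup>2)"
      using x sq by (auto simp: Dh_def)
    show "rh (of_real (1/2 + 1 * \<sigma>\<^sup>2)) = \<i> * of_real (sqrt (1/2 + \<sigma>\<^sup>2) * sqrt (3/2 - \<sigma>\<^sup>2))"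
      using x sq csqrt_of_real_pos[of "1/2 + \<sigma>\<^sup>2"] csqrt_of_real_pos[of "3/2 - \<sigma>\<^sup>2"] by (simp add: rh_def)
  qed (use assms that in auto)
qed

lemma ch_imaginary_ray:
  assumes "0 < \<tau>" "\<tau>\<^sup>2 < 1/2"
  obtains R where "ch.prim l (\<i> * of_real \<tau>) = of_real R"
    and "(\<And>\<sigma>. 0 < \<sigma> \<Longrightarrow> \<sigma> < \<tau> \<Longrightarrow> 1/2 - \<sigma>\<^sup>2 + l > 0) \<Longrightarrow> R > 0"
    and "(\<And>\<sigma>. 0 < \<sigma> \<Longrightarrow> \<sigma> < \<tau> \<Longrightarrow> 1/2 - \<sigma>\<^sup>2 + l < 0) \<Longrightarrow> R < 0"
proof -
  have sq: "\<sigma>\<^sup>2 < 1/2" if "0 \<le> \<sigma>" "\<sigma> \<le> \<tau>" for \<sigma>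
    using power_mono[OF that(2) that(1), of 2] assms by linarith
  show ?thesis
  proof (rule ch.prim_ray[of \<i> "-1" \<tau> \<i> "\<lambda>\<sigma>. sqrt (1/2 - \<sigma>\<^sup>2) * sqrt (3/2 + \<sigma>\<^sup>2)" l])
    fix \<sigma> :: real assume \<sigma>: "0 \<le> \<sigma>" "\<sigma> \<le> \<tau>"
    obtain x where x: "\<sigma>\<^sup>2 = x" "0 \<le> x" by simp
    note sq = sq[OF \<sigma>]
    show "of_real (1/2 + - 1 * \<sigma>\<^sup>2) \<in> Dh" "0 < sqrt (1/2 - \<sigma>\<^sup>2) * sqrt (3/2 + \<sigma>\<^sup>2)"
      using x sq by (auto simp: Dh_def)
    show "rh (of_real (1/2 + - 1 * \<sigma>\<^sup>2)) = \<i> * of_real (sqrt (1/2 - \<sigma>\<^sup>2) * sqrt (3/2 + \<sigma>\<^sup>2))"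
      using x sq csqrt_of_real_pos[of "1/2 - \<sigma>\<^sup>2"] csqrt_of_real_pos[of "3/2 + \<sigma>\<^sup>2"] by (simp add: rh_def)
  qed (use assms that in auto)
qed

lemma c2_real_ray:
  assumes "0 < \<tau>"
  obtains R where "c2.prim l (of_real \<tau>) = of_real R"
    and "(\<And>\<sigma>. 0 < \<sigma> \<Longrightarrow> \<sigma> < \<tau> \<Longrightarrow> 2 + \<sigma>\<^sup>2 + l > 0) \<Longrightarrow> R > 0"
proof -
  show ?thesis
  proof (rule c2.prim_ray[of 1 1 \<tau> 1 "\<lambda>\<sigma>. sqrt (2 + \<sigma>\<^sup>2) * sqrt (3/2 + \<sigma>\<^sup>2)" l])
    fix \<sigma> :: real assume \<sigma>: "0 \<le> \<sigma>" "\<sigma> \<le> \<tau>"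
    obtain x where x: "\<sigma>\<^sup>2 = x" "0 \<le> x" by simp
    show "of_real (2 + 1 * \<sigma>\<^sup>2) \<in> D2" "0 < sqrt (2 + \<sigma>\<^sup>2) * sqrt (3/2 + \<sigma>\<^sup>2)"
      using x by (auto simp: D2_def)
    show "r2 (of_real (2 + 1 * \<sigma>\<^sup>2)) = 1 * of_real (sqrt (2 + \<sigma>\<^sup>2) * sqrt (3/2 + \<sigma>\<^sup>2))"
      using x csqrt_of_real_pos[of "2 + \<sigma>\<^sup>2"] csqrt_of_real_pos[of "3/2 + \<sigma>\<^sup>2"] by (simp add: r2_def)
  qed (use assms that in auto)
qed

lemma c2_imaginary_ray:
  assumes "0 < \<tau>" "\<tau>\<^sup>2 < 3/2"
  obtains R where "c2.prim l (\<i> * of_real \<tau>) = \<i> * of_real R"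
    and "(\<And>\<sigma>. 0 < \<sigma> \<Longrightarrow> \<sigma> < \<tau> \<Longrightarrow> 2 - \<sigma>\<^sup>2 + l > 0) \<Longrightarrow> R > 0"
    and "(\<And>\<sigma>. 0 < \<sigma> \<Longrightarrow> \<sigma> < \<tau> \<Longrightarrow> 2 - \<sigma>\<^sup>2 + l < 0) \<Longrightarrow> R < 0"
proof -
  have sq: "\<sigma>\<^sup>2 < 3/2" if "0 \<le> \<sigma>" "\<sigma> \<le> \<tau>" for \<sigma>
    using power_mono[OF that(2) that(1), of 2] assms by linarith
  show ?thesis
  proof (rule c2.prim_ray[of \<i> "-1" \<tau> 1 "\<lambda>\<sigma>. sqrt (2 - \<sigma>\<^sup>2) * sqrt (3/2 - \<sigma>\<^sup>2)" l])
    fix \<sigma> :: real assume \<sigma>: "0 \<le> \<sigma>" "\<sigma> \<le> \<tau>"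
    obtain x where x: "\<sigma>\<^sup>2 = x" "0 \<le> x" by simp
    note sq = sq[OF \<sigma>]
    show "of_real (2 + - 1 * \<sigma>\<^sup>2) \<in> D2" "0 < sqrt (2 - \<sigma>\<^sup>2) * sqrt (3/2 - \<sigma>\<^sup>2)"
      using x sq by (auto simp: D2_def)
    show "r2 (of_real (2 + - 1 * \<sigma>\<^sup>2)) = 1 * of_real (sqrt (2 - \<sigma>\<^sup>2) * sqrt (3/2 - \<sigma>\<^sup>2))"
      using x sq csqrt_of_real_pos[of "2 - \<sigma>\<^sup>2"] csqrt_of_real_pos[of "3/2 - \<sigma>\<^sup>2"] by (simp add: r2_def)
  qed (use assms that in auto)
qed

section \<open>Choice of the two parameters\<close>

lemma affine_root:
  fixes f :: "real \<Rightarrow> real"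
  assumes "\<And>l. f l = (1 - l) * A + l * B" "f a < 0" "f b > 0" "a < b"
  obtains l where "a < l" "l < b" "f l = 0"
proof -
  have "continuous_on {a..b} f"
    unfolding assms(1) by (intro continuous_intros)
  then obtain l where "a \<le> l" "l \<le> b" "f l = 0"
    using IVT'[of f a 0 b] assms by auto
  moreover from this have "l \<noteq> a" "l \<noteq> b" using assms by auto
  ultimately show ?thesis using that[of l] by linarith
qed

text \<open>Coordinates of the points at which the periods are cut in two: \<open>z = 1/4\<close>
  seen from 1/2 and from 0, and \<open>z = 1\<close> seen from 1/2 and from 2.\<close>

lemma in_S: "\<i> * of_real (1/2) \<in> ch.S" "of_real (1/2) \<in> c0.S" "of_real (sqrt (1/2)) \<in> ch.S" "\<i> \<in> c2.S"
  unfolding ch.S_def c0.S_def c2.S_def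
  by (simp_all add: Dh_def D0_def D2_def power2_eq_square flip: of_real_mult)

text \<open>The function \<open>f\<close> of the proof is the integral of
  \<open>(x + l) / |w|\<close> over \<open>0 < x < 1/2\<close>, split at 1/4 into a ray from each
  end. Its integrand is negative throughout for \<open>l = -1/2\<close> and positive for
  \<open>l = 0\<close>.\<close>

lemma exists_l1:
  obtains l where "-1/2 < l" "l < 0"
    "Re (ch.prim l (\<i> * of_real (1/2))) = Re (c0.prim l (of_real (1/2)))"
proof -
  define f where "f l = Re (ch.prim l (\<i> * of_real (1/2))) - Re (c0.prim l (of_real (1/2)))" for l
  define A where "A = f 0"
  define B where "B = f 1"
  have 1: "f l = (1 - l) * A + l * B" for l
    unfolding f_def A_def B_def ch.prim_affine[OF in_S(1), of l] c0.prim_affine[OF in_S(2), of l]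
    by (simp add: algebra_simps)
  have 2: "f (-1/2) < 0"
  proof -
    obtain R where R: "ch.prim (-1/2) (\<i> * of_real (1/2)) = of_real R"
      "(\<And>\<sigma>::real. 0 < \<sigma> \<Longrightarrow> \<sigma> < 1/2 \<Longrightarrow> 1/2 - \<sigma>\<^sup>2 + -1/2 < 0) \<Longrightarrow> R < 0"
      by (rule ch_imaginary_ray[of "1/2" "-1/2"], simp, simp add: power2_eq_square) blast
    obtain R' where R': "c0.prim (-1/2) (of_real (1/2)) = - of_real R'"
      "(\<And>\<sigma>::real. 0 < \<sigma> \<Longrightarrow> \<sigma> < 1/2 \<Longrightarrow> \<sigma>\<^sup>2 + -1/2 < 0) \<Longrightarrow> R' < 0"
      by (rule c0_real_ray[of "1/2" "-1/2"], simp, simp add: power2_eq_square) blast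
    have "\<sigma>\<^sup>2 < 1/2" if "0 < \<sigma>" "\<sigma> < 1/2" for \<sigma> :: real
      using power_strict_mono[OF that(2), of 2] that by (simp add: power2_eq_square)
    with R R' show ?thesis by (auto simp: f_def)
  qed
  have 3: "f 0 > 0"
  proof -
    obtain R where R: "ch.prim 0 (\<i> * of_real (1/2)) = of_real R"
      "(\<And>\<sigma>::real. 0 < \<sigma> \<Longrightarrow> \<sigma> < 1/2 \<Longrightarrow> 1/2 - \<sigma>\<^sup>2 + 0 > 0) \<Longrightarrow> R > 0"
      by (rule ch_imaginary_ray[of "1/2" 0], simp, simp add: power2_eq_square) blast
    obtain R' where R': "c0.prim 0 (of_real (1/2)) = - of_real R'"
      "(\<And>\<sigma>::real. 0 < \<sigma> \<Longrightarrow> \<sigma> < 1/2 \<Longrightarrow> \<sigma>\<^sup>2 + 0 > 0) \<Longrightarrow> R' > 0"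
      by (rule c0_real_ray[of "1/2" 0], simp, simp add: power2_eq_square) blast
    have "\<sigma>\<^sup>2 < 1/2" if "0 < \<sigma>" "\<sigma> < 1/2" for \<sigma> :: real
      using power_strict_mono[OF that(2), of 2] that by (simp add: power2_eq_square)
    with R R' show ?thesis by (auto simp: f_def)
  qed
  obtain l where "-1/2 < l" "l < 0" "f l = 0"
    by (rule affine_root[OF 1 2 3]) auto
  with that[of l] show ?thesis by (simp add: f_def)
qed

text \<open>Here \<open>f\<close> is the integral of \<open>(x + l) / |w|\<close> over
  \<open>1/2 < x < 2\<close>, split at 1. The integrand is negative for \<open>l = -2\<close> and
  positive for \<open>l = -1/2\<close>.\<close>

lemma exists_l2:
  obtains l where "-2 < l" "l < -1/2"
    "Im (ch.prim l (of_real (sqrt (1/2)))) = Im (c2.prim l \<i>)"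
proof -
  define f where "f l = Im (c2.prim l \<i>) - Im (ch.prim l (of_real (sqrt (1/2))))" for l
  define A where "A = f 0"
  define B where "B = f 1"
  have 1: "f l = (1 - l) * A + l * B" for l
    unfolding f_def A_def B_def ch.prim_affine[OF in_S(3), of l] c2.prim_affine[OF in_S(4), of l]
    by (simp add: algebra_simps)
  have sq: "0 < \<sigma>\<^sup>2" "\<sigma>\<^sup>2 < 1" if "0 < \<sigma>" "\<sigma> < 1" for \<sigma> :: real
    using power_strict_mono[OF that(2), of 2] that by auto
  have sq2: "\<sigma>\<^sup>2 < 1" if "0 < \<sigma>" "\<sigma> < sqrt (1/2)" for \<sigma> :: real
    using power_strict_mono[OF that(2), of 2] that by auto
  have 2: "f (-2) < 0"
  proof -
    obtain R where R: "c2.prim (-2) (\<i> * of_real 1) = \<i> * of_real R"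
      "(\<And>\<sigma>::real. 0 < \<sigma> \<Longrightarrow> \<sigma> < 1 \<Longrightarrow> 2 - \<sigma>\<^sup>2 + -2 < 0) \<Longrightarrow> R < 0"
      by (rule c2_imaginary_ray[of 1 "-2"]) auto
    obtain R' where R': "ch.prim (-2) (of_real (sqrt (1/2))) = - \<i> * of_real R'"
      "(\<And>\<sigma>::real. 0 < \<sigma> \<Longrightarrow> \<sigma> < sqrt (1/2) \<Longrightarrow> 1/2 + \<sigma>\<^sup>2 + -2 < 0) \<Longrightarrow> R' < 0"
      by (rule ch_real_ray[of "sqrt (1/2)" "-2"]) auto
    have "R < 0" using R(2) sq by auto
    moreover have "R' < 0" by (rule R'(2)) (use sq2 in fastforce)
    ultimately show ?thesis using R(1) R'(1) by (simp add: f_def)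
  qed
  have 3: "f (-1/2) > 0"
  proof -
    obtain R where R: "c2.prim (-1/2) (\<i> * of_real 1) = \<i> * of_real R"
      "(\<And>\<sigma>::real. 0 < \<sigma> \<Longrightarrow> \<sigma> < 1 \<Longrightarrow> 2 - \<sigma>\<^sup>2 + -1/2 > 0) \<Longrightarrow> R > 0"
      by (rule c2_imaginary_ray[of 1 "-1/2"]) auto
    obtain R' where R': "ch.prim (-1/2) (of_real (sqrt (1/2))) = - \<i> * of_real R'"
      "(\<And>\<sigma>::real. 0 < \<sigma> \<Longrightarrow> \<sigma> < sqrt (1/2) \<Longrightarrow> 1/2 + \<sigma>\<^sup>2 + -1/2 > 0) \<Longrightarrow> R' > 0"
      by (rule ch_real_ray[of "sqrt (1/2)" "-1/2"]) auto
    have "R > 0" by (rule R(2)) (use sq in fastforce)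
    moreover have "R' > 0" by (rule R'(2)) auto
    ultimately show ?thesis using R(1) R'(1) by (simp add: f_def)
  qed
  obtain l where "-2 < l" "l < -1/2" "f l = 0"
    by (rule affine_root[OF 1 2 3]) auto
  with that[of l] show ?thesis by (simp add: f_def)
qed

section \<open>Comparison of the primitives of two charts on their overlap\<close>

lemma csqrt_deriv_forms:
  fixes a :: complex
  shows "z - a \<notin> \<real>\<^sub>\<le>\<^sub>0 \<Longrightarrow> ((\<lambda>z. csqrt (z - a)) has_field_derivative 1 / (2 * csqrt (z - a))) (at z)"
    and "a - z \<notin> \<real>\<^sub>\<le>\<^sub>0 \<Longrightarrow> ((\<lambda>z. \<i> * csqrt (a - z)) has_field_derivative 1 / (2 * (\<i> * csqrt (a - z)))) (at z)"
proof -
  have "((\<lambda>z. csqrt (z - a)) has_field_derivative inverse (2 * csqrt (z - a)) * (1 - 0)) (at z)"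
    if "z - a \<notin> \<real>\<^sub>\<le>\<^sub>0"
    using that by (intro DERIV_chain2[OF has_field_derivative_csqrt] DERIV_diff DERIV_ident DERIV_const)
  then show "z - a \<notin> \<real>\<^sub>\<le>\<^sub>0 \<Longrightarrow> ((\<lambda>z. csqrt (z - a)) has_field_derivative 1 / (2 * csqrt (z - a))) (at z)"
    unfolding divide_inverse diff_0_right mult_1_left mult_1_right .
  have eq: "\<i> * (inverse (2 * c) * (0 - 1)) = 1 / (2 * (\<i> * c))" for c :: complex
  proof -
    have "\<i> * (inverse (2 * c) * (0 - 1)) = inverse \<i> * inverse (2 * c)" by simp
    also have "\<dots> = 1 / (2 * (\<i> * c))" by (simp only: inverse_mult_distrib divide_inverse mult_1_left mult_ac)
    finally show ?thesis .
  qed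
  show "((\<lambda>z. \<i> * csqrt (a - z)) has_field_derivative 1 / (2 * (\<i> * csqrt (a - z)))) (at z)"
    if "a - z \<notin> \<real>\<^sub>\<le>\<^sub>0"
    unfolding eq[symmetric] using that
    by (intro DERIV_cmult DERIV_chain2[OF has_field_derivative_csqrt] DERIV_diff DERIV_ident DERIV_const)
qed

text \<open>On one sheet both primitives have the derivative \<open>(z + l) / w\<close> in
  \<open>z\<close>, hence differ by a constant over the connected overlap; it is read off at
  \<open>z = 1\<close>. The other sheet arises by negating both coordinates, and oddness gives
  \<open>- c\<close>.\<close>

lemma primitives_differ_h2:
  fixes l :: real
  assumes p: "p \<in> curve" and z: "fst p \<in> Dh" "fst p \<in> D2"
  defines "c \<equiv> ch.prim l (of_real (sqrt (1/2))) - c2.prim l \<i>"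
  shows "ch.val l p - c2.val l p = c \<or> ch.val l p - c2.val l p = - c"
proof -
  let ?O = "Dh \<inter> D2"
  \<comment> \<open>Branches of the two roots with cuts outside the overlap, matched so that
    \<open>q * rh\<close> and \<open>q' * r2\<close> are the same \<open>w\<close>.\<close>
  define q where "q z = csqrt (z - 1/2)" for z
  define q' where "q' z = \<i> * csqrt (2 - z)" for z
  have eq: "q z * rh z = q' z * r2 z" for z
    by (simp add: q_def q'_def rh_def r2_def)
  have q0: "q z \<noteq> 0" "q' z \<noteq> 0" if "z \<in> ?O" for z
    using that by (auto simp: q_def q'_def Dh_def D2_def simp del: csqrt_eq_0 dest!: csqrt_eq_0D)
  have "((\<lambda>z. ch.prim l (q z) - c2.prim l (q' z)) has_field_derivative 0) (at z)" if "z \<in> ?O" for z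
  proof -
    have "((\<lambda>z. ch.prim l (q z)) has_field_derivative (z + of_real l) / (q z * rh z)) (at z)"
      by (rule ch.prim_sqrt_deriv)
        (use that q0 csqrt_deriv_forms(1)[of z "1/2"] in
          \<open>auto simp: q_def[abs_def] Dh_def D2_def complex_nonpos_Reals_iff\<close>)
    moreover have "((\<lambda>z. c2.prim l (q' z)) has_field_derivative (z + of_real l) / (q' z * r2 z)) (at z)"
      by (rule c2.prim_sqrt_deriv)
        (use that q0 csqrt_deriv_forms(2)[of 2 z] in
          \<open>auto simp: q'_def[abs_def] Dh_def D2_def complex_nonpos_Reals_iff power_mult_distrib\<close>)
    ultimately show ?thesis
      using DERIV_diff eq by fastforce
  qed
  moreover have "connected ?O"
  proof -
    have "closed_segment 1 x \<subseteq> ?O" if x: "x \<in> ?O" for x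
    proof
      fix y assume "y \<in> closed_segment 1 x"
      then obtain u where u: "0 \<le> u" "u \<le> 1" "Im y = u * Im x" "Re y = (1 - u) * 1 + u * Re x"
        using segment_avoids[of y 1 x] by auto
      show "y \<in> ?O"
      proof (cases "Im x \<noteq> 0 \<and> u \<noteq> 0")
        case False
        have "1/2 < Re y \<and> Re y < 2" if "1/2 < Re x" "Re x < 2"
        proof -
          have "Re y \<in> closed_segment 1 (Re x)"
            unfolding u(4) closed_segment_def using u by auto
          then show ?thesis using that by (auto simp: closed_segment_eq_real_ivl split: if_splits)
        qed
        with False x u show ?thesis by (auto simp: Dh_def D2_def)
      qed (use u in \<open>auto simp: Dh_def D2_def\<close>)
    qed
    then have "starlike ?O"
      unfolding starlike_def by (intro bexI[of _ 1]) (auto simp: Dh_def D2_def)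
    then show ?thesis by (rule starlike_imp_connected)
  qed
  ultimately have "(\<lambda>z. ch.prim l (q z) - c2.prim l (q' z)) constant_on ?O"
    using open_slits by (intro has_field_derivative_0_imp_constant_on) auto
  then obtain k where k: "\<And>z. z \<in> ?O \<Longrightarrow> ch.prim l (q z) - c2.prim l (q' z) = k"
    by (auto simp: constant_on_def)
  have "q 1 = of_real (sqrt (1/2))" "q' 1 = \<i>"
    using csqrt_of_real_pos[of "1/2"] by (auto simp: q_def q'_def)
  with k[of 1] have kc: "k = c" by (auto simp: c_def Dh_def D2_def)
  have zO: "fst p \<in> ?O" using z by auto
  have "(q (fst p) * rh (fst p))\<^sup>2 = (snd p)\<^sup>2"
    using ch.r_power2[OF z(1)] p by (auto simp: q_def power_mult_distrib curve_def)
  then have "snd p = q (fst p) * rh (fst p) \<or> snd p = - (q (fst p) * rh (fst p))"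
    by (metis power2_eq_iff)
  moreover have "snd p = q (fst p) * rh (fst p) \<Longrightarrow> ch.coord p = q (fst p) \<and> c2.coord p = q' (fst p)"
    and "snd p = - (q (fst p) * rh (fst p)) \<Longrightarrow> ch.coord p = - q (fst p) \<and> c2.coord p = - q' (fst p)"
    using ch.r_nonzero[OF z(1)] c2.r_nonzero[OF z(2)] eq[of "fst p"]
    by (simp_all add: ch.coord_def c2.coord_def divide_eq_eq)
  moreover have "q (fst p) \<in> ch.S" "q' (fst p) \<in> c2.S"
    using z by (auto simp: ch.S_def c2.S_def q_def q'_def power_mult_distrib)
  ultimately show ?thesis
    using k[OF zO] kc by (auto simp: ch.val_def c2.val_def ch.prim_minus c2.prim_minus)
qed

text \<open>The same argument between the charts at 1/2 and 0, with the constant read off at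
  \<open>z = 1/4\<close>.\<close>

lemma primitives_differ_h0:
  fixes l :: real
  assumes p: "p \<in> curve" and z: "fst p \<in> Dh" "fst p \<in> D0"
  defines "c \<equiv> ch.prim l (\<i> * of_real (1/2)) - c0.prim l (of_real (1/2))"
  shows "ch.val l p - c0.val l p = c \<or> ch.val l p - c0.val l p = - c"
proof -
  let ?O = "Dh \<inter> D0"
  define q where "q z = \<i> * csqrt (1/2 - z)" for z
  define q' where "q' z = csqrt z" for z
  have eq: "q z * rh z = q' z * r0 z" for z
  proof -
    \<comment> \<open>The product \<open>\<i> * \<i>\<close> is the minus sign built into
      \<open>r0\<close>.\<close>
    have "q z * rh z = (\<i> * \<i>) * (csqrt z * (csqrt (1/2 - z) * csqrt (2 - z)))"
      unfolding q_def rh_def by (simp only: mult_ac)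
    then show ?thesis by (simp add: q'_def r0_def)
  qed
  have q0: "q z \<noteq> 0" "q' z \<noteq> 0" if "z \<in> ?O" for z
    using that by (auto simp: q_def q'_def Dh_def D0_def simp del: csqrt_eq_0 dest!: csqrt_eq_0D)
  have "((\<lambda>z. ch.prim l (q z) - c0.prim l (q' z)) has_field_derivative 0) (at z)" if "z \<in> ?O" for z
  proof -
    have "((\<lambda>z. ch.prim l (q z)) has_field_derivative (z + of_real l) / (q z * rh z)) (at z)"
      by (rule ch.prim_sqrt_deriv)
        (use that q0 csqrt_deriv_forms(2)[of "1/2" z] in
          \<open>auto simp: q_def[abs_def] Dh_def D0_def complex_nonpos_Reals_iff power_mult_distrib\<close>)
    moreover have "((\<lambda>z. c0.prim l (q' z)) has_field_derivative (z + of_real l) / (q' z * r0 z)) (at z)"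
      by (rule c0.prim_sqrt_deriv)
        (use that q0 csqrt_deriv_forms(1)[of z 0] in
          \<open>auto simp: q'_def[abs_def] Dh_def D0_def complex_nonpos_Reals_iff\<close>)
    ultimately show ?thesis
      using DERIV_diff eq by fastforce
  qed
  moreover have "connected ?O"
  proof -
    have "closed_segment (of_real (1/4)) x \<subseteq> ?O" if x: "x \<in> ?O" for x
    proof
      fix y assume "y \<in> closed_segment (of_real (1/4)) x"
      then obtain u where u: "0 \<le> u" "u \<le> 1" "Im y = u * Im x" "Re y = (1 - u) * (1/4) + u * Re x"
        by (rule segment_avoids)
      show "y \<in> ?O"
      proof (cases "Im x \<noteq> 0 \<and> u \<noteq> 0")
        case False
        have "0 < Re y \<and> Re y < 1/2 \<and> Re y < 2" if "0 < Re x" "Re x < 1/2"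
        proof -
          have "Re y \<in> closed_segment (1/4) (Re x)"
            unfolding u(4) closed_segment_def using u by auto
          then show ?thesis using that by (auto simp: closed_segment_eq_real_ivl split: if_splits)
        qed
        with False x u show ?thesis by (auto simp: Dh_def D0_def)
      qed (use u in \<open>auto simp: Dh_def D0_def\<close>)
    qed
    then have "starlike ?O"
      unfolding starlike_def by (intro bexI[of _ "of_real (1/4)"]) (auto simp: Dh_def D0_def)
    then show ?thesis by (rule starlike_imp_connected)
  qed
  ultimately have "(\<lambda>z. ch.prim l (q z) - c0.prim l (q' z)) constant_on ?O"
    using open_slits by (intro has_field_derivative_0_imp_constant_on) auto
  then obtain k where k: "\<And>z. z \<in> ?O \<Longrightarrow> ch.prim l (q z) - c0.prim l (q' z) = k"
    by (auto simp: constant_on_def)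
  have "csqrt (1/4) = 1/2" by (rule csqrt_unique) (auto simp: power2_eq_square)
  then have "q (of_real (1/4)) = \<i> * of_real (1/2)" "q' (of_real (1/4)) = of_real (1/2)"
    by (auto simp: q_def q'_def)
  moreover have "ch.prim l (q (of_real (1/4))) - c0.prim l (q' (of_real (1/4))) = k"
    by (rule k) (auto simp: Dh_def D0_def)
  ultimately have kc: "k = c" by (simp only: c_def)
  have zO: "fst p \<in> ?O" using z by auto
  have "(q (fst p) * rh (fst p))\<^sup>2 = (snd p)\<^sup>2"
    using ch.r_power2[OF z(1)] p by (auto simp: q_def power_mult_distrib curve_def)
  then have "snd p = q (fst p) * rh (fst p) \<or> snd p = - (q (fst p) * rh (fst p))"
    by (metis power2_eq_iff)
  moreover have "snd p = q (fst p) * rh (fst p) \<Longrightarrow> ch.coord p = q (fst p) \<and> c0.coord p = q' (fst p)"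
    and "snd p = - (q (fst p) * rh (fst p)) \<Longrightarrow> ch.coord p = - q (fst p) \<and> c0.coord p = - q' (fst p)"
    using ch.r_nonzero[OF z(1)] c0.r_nonzero[OF z(2)] eq[of "fst p"]
    by (simp_all add: ch.coord_def c0.coord_def divide_eq_eq)
  moreover have "q (fst p) \<in> ch.S" "q' (fst p) \<in> c0.S"
    using z by (auto simp: ch.S_def c0.S_def q_def q'_def power_mult_distrib)
  ultimately show ?thesis
    using k[OF zO] kc by (auto simp: ch.val_def c0.val_def ch.prim_minus c0.prim_minus)
qed

section \<open>The single-valued primitive\<close>

text \<open>As a complex number this may jump between charts; only the real part for
  \<open>l1\<close> and the imaginary part for \<open>l2\<close> will agree on overlaps.\<close>

definition glued :: "real \<Rightarrow> complex \<times> complex \<Rightarrow> complex" where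
  "glued l p = (if fst p \<in> Dh then ch.val l p else if fst p \<in> D2 then c2.val l p else c0.val l p)"

section \<open>Vector-valued calculus and integrability from local primitives\<close>

lemma vector_3_axis: "(vector [a, b, c] :: 'a::real_normed_vector^3) = axis 1 a + axis 2 b + axis 3 c"
  by (simp add: vec_eq_iff forall_3 axis_def)

lemma bounded_linear_axis: "bounded_linear (axis i :: 'a::euclidean_space \<Rightarrow> 'a^'n)"
proof -
  have "linear (axis i :: 'a \<Rightarrow> 'a^'n)"
    by (intro linearI) (auto simp: vec_eq_iff axis_def)
  then show ?thesis by (simp add: linear_conv_bounded_linear)
qed

lemma has_integral_vector_3:
  fixes f g h :: "real \<Rightarrow> 'a::euclidean_space"
  assumes "(f has_integral a) S" "(g has_integral b) S" "(h has_integral c) S"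
  shows "((\<lambda>t. vector [f t, g t, h t] :: 'a^3) has_integral vector [a, b, c]) S"
  unfolding vector_3_axis
  using has_integral_linear[OF assms(1) bounded_linear_axis[of 1]]
    has_integral_linear[OF assms(2) bounded_linear_axis[of 2]]
    has_integral_linear[OF assms(3) bounded_linear_axis[of 3]]
  unfolding o_def by (intro has_integral_add) auto

lemma has_derivative_vector_3:
  fixes f g h :: "'b::real_normed_vector \<Rightarrow> 'a::euclidean_space"
  assumes "(f has_derivative f') F" "(g has_derivative g') F" "(h has_derivative h') F"
  shows "((\<lambda>t. vector [f t, g t, h t] :: 'a^3) has_derivative (\<lambda>x. vector [f' x, g' x, h' x])) F"
  unfolding vector_3_axis
  by (intro has_derivative_add bounded_linear.has_derivative[OF bounded_linear_axis] assms)

lemma continuous_on_vector_3: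
  fixes f g h :: "'b::topological_space \<Rightarrow> 'a::euclidean_space"
  assumes "continuous_on S f" "continuous_on S g" "continuous_on S h"
  shows "continuous_on S (\<lambda>t. vector [f t, g t, h t] :: 'a^3)"
  unfolding vector_3_axis
  by (intro continuous_on_add bounded_linear.continuous_on[OF bounded_linear_axis] assms)

lemma ln_cmod_has_derivative:
  assumes "z \<noteq> 0"
  shows "((\<lambda>z. ln (cmod z)) has_derivative (\<lambda>h. Re (h / z))) (at z)"
proof -
  \<comment> \<open>Dividing by \<open>z\<close> moves the point of differentiation to 1, away from
    the cut of \<open>Ln\<close>, while the real part plus \<open>ln (cmod z)\<close> is
    \<open>ln (cmod y)\<close> for every nonzero \<open>y\<close>.\<close>
  have "((\<lambda>y. Ln (y / z)) has_field_derivative (1 / z)) (at z)"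
    using assms by (auto intro!: derivative_eq_intros)
  then have "((\<lambda>y. Ln (y / z)) has_derivative (\<lambda>h. 1 / z * h)) (at z)"
    by (rule has_field_derivative_imp_has_derivative)
  then have "((\<lambda>y. Re (Ln (y / z)) + ln (cmod z)) has_derivative (\<lambda>h. Re (1 / z * h) + 0)) (at z)"
    by (intro derivative_intros)
  then have "((\<lambda>y. Re (Ln (y / z)) + ln (cmod z)) has_derivative (\<lambda>h. Re (h / z))) (at z)"
    by simp
  then show ?thesis
    by (rule has_derivative_transform_within_open[of _ _ _ _ "- {0}"])
      (use assms in \<open>auto simp: norm_divide ln_div\<close>)
qed

text \<open>Made for forms whose complex primitives are known only locally: the fundamental theorem
  gives integrability on short intervals, and \<open>K\<close> absorbs the kinks of a piecewise
  smooth path.\<close>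

lemma integrable_local_primitive:
  fixes f :: "real \<Rightarrow> 'a::banach"
  assumes K: "finite K"
    and loc: "\<And>t. t \<in> {0..1} \<Longrightarrow> \<exists>d>0. \<exists>g. continuous_on ({0..1} \<inter> ball t d) g \<and>
      (\<forall>u \<in> {0<..<1} \<inter> ball t d - K. (g has_vector_derivative f u) (at u))"
  shows "f integrable_on {0..1}"
proof -
  have "f integrable_on cbox 0 1"
  proof (rule integrable_on_little_subintervals, rule ballI)
    fix t :: real assume "t \<in> cbox 0 1"
    then obtain d g where d: "d > 0" and g: "continuous_on ({0..1} \<inter> ball t d) g"
      "\<And>u. u \<in> {0<..<1} \<inter> ball t d - K \<Longrightarrow> (g has_vector_derivative f u) (at u)"
      using loc[of t] by auto
    have "f integrable_on cbox u v"
      if "t \<in> cbox u v" "cbox u v \<subseteq> ball t d" "cbox u v \<subseteq> cbox 0 1" for u v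
    proof -
      have uv: "u \<le> v" "0 \<le> u" "v \<le> 1" using that by auto
      have "(f has_integral (g v - g u)) {u..v}"
      proof (rule fundamental_theorem_of_calculus_interior_strong[OF K \<open>u \<le> v\<close>])
        fix x assume "x \<in> {u<..<v} - K"
        moreover from this have "x \<in> cbox u v" by auto
        ultimately show "(g has_vector_derivative f x) (at x)"
          using g(2)[of x] that uv by (auto simp: subset_iff)
      next
        show "continuous_on {u..v} g"
          using that by (intro continuous_on_subset[OF g(1)]) auto
      qed
      then show ?thesis by (auto simp: integrable_on_def)
    qed
    with d show "\<exists>d>0. \<forall>u v. t \<in> cbox u v \<and> cbox u v \<subseteq> ball t d \<and> cbox u v \<subseteq> cbox 0 1 \<longrightarrow>
        f integrable_on cbox u v" by auto
  qed
  then show ?thesis by simp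
qed

text \<open>
  The two equations say that \<open>\<omega>\<^sub>1\<close> has no real period over the cycle around \<open>[0, 1/2]\<close> and \<open>\<omega>\<^sub>2\<close>
  none over the cycle around \<open>[1/2, 2]\<close>; they are stated at the points above \<open>z = 1/4\<close> and \<open>z = 1\<close>.
  The other two real periods vanish because the forms are imaginary on the other interval.
\<close>

locale period_free =
  fixes l1 l2 :: real
  assumes l1: "-1/2 < l1" "l1 < 0"
      "Re (ch.prim l1 (\<i> * of_real (1/2))) = Re (c0.prim l1 (of_real (1/2)))"
    and l2: "-2 < l2" "l2 < -1/2" "Im (ch.prim l2 (of_real (sqrt (1/2)))) = Im (c2.prim l2 \<i>)"
begin

definition x1 :: "complex \<times> complex \<Rightarrow> real" where "x1 p = Re (glued l1 p)"
text \<open>The form \<open>omega2\<close> carries a factor \<open>\<i>\<close>, and the real part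
  of \<open>\<i> * g\<close> is \<open>- Im g\<close>.\<close>

definition x2 :: "complex \<times> complex \<Rightarrow> real" where "x2 p = - Im (glued l2 p)"
definition F :: "complex \<times> complex \<Rightarrow> real^3" where
  "F p = vector [x1 p, x2 p, ln (cmod (fst p))]"

text \<open>Between 1/2 and 2 the primitives of \<open>(z + l) dz / w\<close> are imaginary, so the
  constant has real part 0 whatever \<open>l1\<close> is. That its imaginary part vanishes for
  \<open>l2\<close> is the equation imposed on \<open>l2\<close>.\<close>

lemma glue_h2:
  assumes "p \<in> curve" "fst p \<in> Dh" "fst p \<in> D2"
  shows "Re (ch.val l1 p) = Re (c2.val l1 p)" "Im (ch.val l2 p) = Im (c2.val l2 p)"
proof -
  obtain R where "ch.prim l1 (of_real (sqrt (1/2))) = - \<i> * of_real R"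
    by (rule ch_real_ray[of "sqrt (1/2)"]) auto
  moreover obtain R' where "c2.prim l1 (\<i> * of_real 1) = \<i> * of_real R'"
    by (rule c2_imaginary_ray[of 1]) auto
  ultimately show "Re (ch.val l1 p) = Re (c2.val l1 p)"
    using primitives_differ_h2[OF assms, of l1]
    by (auto simp: complex_eq_iff)
  show "Im (ch.val l2 p) = Im (c2.val l2 p)"
    using primitives_differ_h2[OF assms, of l2] l2(3) by (auto simp: complex_eq_iff)
qed

text \<open>Between 0 and 1/2 the roles are exchanged: the equation for \<open>l1\<close> is used,
  and the primitives for \<open>l2\<close> are real there.\<close>

lemma glue_h0:
  assumes "p \<in> curve" "fst p \<in> Dh" "fst p \<in> D0"
  shows "Re (ch.val l1 p) = Re (c0.val l1 p)" "Im (ch.val l2 p) = Im (c0.val l2 p)"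
proof -
  show "Re (ch.val l1 p) = Re (c0.val l1 p)"
    using primitives_differ_h0[OF assms, of l1] l1(3) by (auto simp: complex_eq_iff)
  obtain R where "ch.prim l2 (\<i> * of_real (1/2)) = of_real R"
    by (rule ch_imaginary_ray[of "1/2"]) (auto simp: power2_eq_square)
  moreover obtain R' where "c0.prim l2 (of_real (1/2)) = - of_real R'"
    by (rule c0_real_ray[of "1/2"]) (auto simp: power2_eq_square)
  ultimately show "Im (ch.val l2 p) = Im (c0.val l2 p)"
    using primitives_differ_h0[OF assms, of l2] by (auto simp: complex_eq_iff)
qed

lemma x_ch:
  assumes "p \<in> curve" "fst p \<in> Dh"
  shows "x1 p = Re (ch.val l1 p)" "x2 p = - Im (ch.val l2 p)"
  using assms by (auto simp: x1_def x2_def glued_def)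

lemma x_c2:
  assumes "p \<in> curve" "fst p \<in> D2"
  shows "x1 p = Re (c2.val l1 p)" "x2 p = - Im (c2.val l2 p)"
  using assms glue_h2[OF assms(1)] by (auto simp: x1_def x2_def glued_def)

lemma x_c0:
  assumes "p \<in> curve" "fst p \<in> D0"
  shows "x1 p = Re (c0.val l1 p)" "x2 p = - Im (c0.val l2 p)"
proof -
  \<comment> \<open>\<open>D0\<close> and \<open>D2\<close> meet only off the real axis, so
    agreement of these two charts passes through \<open>Dh\<close>.\<close>
  have "fst p \<in> Dh" if "fst p \<in> D2" using that assms by (auto simp: Dh_def D0_def D2_def)
  then show "x1 p = Re (c0.val l1 p)" "x2 p = - Im (c0.val l2 p)"
    using assms glue_h0[OF assms(1)] by (auto simp: x1_def x2_def glued_def)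
qed

text \<open>Lets later arguments run once, in an arbitrary \<open>sqrt_chart\<close> containing
  \<open>z\<close>, instead of three times.\<close>

lemma chart_at:
  obtains e D r \<epsilon> where "sqrt_chart e D r \<epsilon>" "z \<in> D" "e \<in> {0, 1/2, 2}"
    "\<And>q. q \<in> curve \<Longrightarrow> fst q \<in> D \<Longrightarrow> x1 q = Re (sqrt_chart.val e r l1 q)"
    "\<And>q. q \<in> curve \<Longrightarrow> fst q \<in> D \<Longrightarrow> x2 q = - Im (sqrt_chart.val e r l2 q)"
proof -
  consider "z \<in> D0" | "z \<in> Dh" | "z \<in> D2"
    unfolding D0_def Dh_def D2_def by fastforce
  then show ?thesis
  proof cases
    case 1
    then show ?thesis using that[OF c0.sqrt_chart_axioms] x_c0 by blast
  next
    case 2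
    then show ?thesis using that[OF ch.sqrt_chart_axioms] x_ch by blast
  next
    case 3
    then show ?thesis using that[OF c2.sqrt_chart_axioms] x_c2 by blast
  qed
qed

lemma x_minus:
  assumes "(z, w) \<in> curve"
  shows "x1 (z, - w) = - x1 (z, w)" "x2 (z, - w) = - x2 (z, w)"
proof -
  obtain e D r \<epsilon> where c: "sqrt_chart e D r \<epsilon>" "z \<in> D"
    and x: "\<And>q. q \<in> curve \<Longrightarrow> fst q \<in> D \<Longrightarrow> x1 q = Re (sqrt_chart.val e r l1 q)"
      "\<And>q. q \<in> curve \<Longrightarrow> fst q \<in> D \<Longrightarrow> x2 q = - Im (sqrt_chart.val e r l2 q)"
    using chart_at by metis
  interpret sqrt_chart e D r \<epsilon> by fact
  have "(z, - w) \<in> curve" using assms by (simp add: curve_def)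
  with assms c x val_minus[of "(z, w)"]
  show "x1 (z, - w) = - x1 (z, w)" "x2 (z, - w) = - x2 (z, w)" by simp_all
qed

lemma x_cnj:
  assumes "(z, w) \<in> curve"
  shows "(cnj z, cnj w) \<in> curve" "x1 (cnj z, cnj w) = x1 (z, w)" "x2 (cnj z, cnj w) = - x2 (z, w)"
proof -
  obtain e D r \<epsilon> where c: "sqrt_chart e D r \<epsilon>" "z \<in> D"
    and x: "\<And>q. q \<in> curve \<Longrightarrow> fst q \<in> D \<Longrightarrow> x1 q = Re (sqrt_chart.val e r l1 q)"
      "\<And>q. q \<in> curve \<Longrightarrow> fst q \<in> D \<Longrightarrow> x2 q = - Im (sqrt_chart.val e r l2 q)"
    using chart_at by metis
  interpret sqrt_chart e D r \<epsilon> by fact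
  have "(cnj w)\<^sup>2 = cnj (cubic z)" using assms by (simp add: curve_def flip: complex_cnj_power)
  also have "\<dots> = cubic (cnj z)" by (simp add: cubic_def)
  finally show *: "(cnj z, cnj w) \<in> curve" by (simp add: curve_def)
  with assms c x cnj_D val_cnj[of "(z, w)"]
  show "x1 (cnj z, cnj w) = x1 (z, w)" "x2 (cnj z, cnj w) = - x2 (z, w)" by simp_all
qed

text \<open>The puncture is included, since \<open>omega1\<close> and \<open>omega2\<close> are
  holomorphic there; the vertical line \<open>Re z = 0\<close> starts at it when \<open>y1\<close>
  is followed upwards.\<close>

lemma continuous_on_x: "continuous_on curve x1" "continuous_on curve x2"
proof -
  have "continuous (at p within curve) x1 \<and> continuous (at p within curve) x2" if p: "p \<in> curve" for p
  proof -
    obtain e D r \<epsilon> where c: "sqrt_chart e D r \<epsilon>" "fst p \<in> D"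
      and x: "\<And>q. q \<in> curve \<Longrightarrow> fst q \<in> D \<Longrightarrow> x1 q = Re (sqrt_chart.val e r l1 q)"
        "\<And>q. q \<in> curve \<Longrightarrow> fst q \<in> D \<Longrightarrow> x2 q = - Im (sqrt_chart.val e r l2 q)"
      using chart_at by metis
    interpret sqrt_chart e D r \<epsilon> by fact
    let ?T = "curve \<inter> fst -` D"
    have "at p within curve = at p within ?T"
      by (rule at_within_nhd[of _ "fst -` D"]) (use c open_vimage_fst[OF open_D] in auto)
    moreover have "continuous_on ?T x1"
      using continuous_on_cong[of ?T ?T x1 "\<lambda>q. Re (val l1 q)"] x(1)
      by (auto intro!: continuous_intros continuous_on_val)
    moreover have "continuous_on ?T x2"
      using continuous_on_cong[of ?T ?T x2 "\<lambda>q. - Im (val l2 q)"] x(2)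
      by (auto intro!: continuous_intros continuous_on_val)
    ultimately show ?thesis
      using c p by (simp add: continuous_on_eq_continuous_within)
  qed
  then show "continuous_on curve x1" "continuous_on curve x2"
    by (auto simp: continuous_on_eq_continuous_within)
qed

lemma continuous_on_F: "continuous_on punctured_curve F"
proof -
  have "fst p \<noteq> 0" if "p \<in> punctured_curve" for p
    using that by (cases p) (auto simp: punctured_curve_def curve_def cubic_def)
  moreover have "continuous_on punctured_curve x1" "continuous_on punctured_curve x2"
    by (rule continuous_on_subset[OF continuous_on_x(1)] continuous_on_subset[OF continuous_on_x(2)];
        simp add: punctured_curve_def)+
  ultimately show ?thesis
    unfolding F_def[abs_def] by (intro continuous_on_vector_3 continuous_intros) auto
qed

lemma x_along_path:
  assumes \<gamma>: "(\<gamma> has_vector_derivative v) (at t)"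
    and curve: "eventually (\<lambda>u. \<gamma> u \<in> curve) (nhds t)"
  shows "((\<lambda>u. x1 (\<gamma> u)) has_vector_derivative Re (omega1 l1 (\<gamma> t) v)) (at t)"
    "((\<lambda>u. x2 (\<gamma> u)) has_vector_derivative Re (omega2 l2 (\<gamma> t) v)) (at t)"
proof -
  obtain e D r \<epsilon> where c: "sqrt_chart e D r \<epsilon>" "fst (\<gamma> t) \<in> D"
    and x: "\<And>q. q \<in> curve \<Longrightarrow> fst q \<in> D \<Longrightarrow> x1 q = Re (sqrt_chart.val e r l1 q)"
      "\<And>q. q \<in> curve \<Longrightarrow> fst q \<in> D \<Longrightarrow> x2 q = - Im (sqrt_chart.val e r l2 q)"
    using chart_at by metis
  interpret sqrt_chart e D r \<epsilon> by fact
  have nearD: "eventually (\<lambda>u. fst (\<gamma> u) \<in> D) (nhds t)"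
  proof -
    have "isCont (\<lambda>u. fst (\<gamma> u)) t"
      using has_vector_derivative_continuous[OF \<gamma>] by (intro continuous_intros)
    then show ?thesis
      using c open_D by (metis isCont_def topological_tendstoD tendsto_at_iff_tendsto_nhds)
  qed
  have 1: "eventually (\<lambda>u. x1 (\<gamma> u) = Re (val l1 (\<gamma> u))) (nhds t)"
    and 2: "eventually (\<lambda>u. x2 (\<gamma> u) = - Im (val l2 (\<gamma> u))) (nhds t)"
    using curve nearD by (eventually_elim, simp add: x)+
  note d = val_along_path[OF \<gamma> curve c(2)]
  show "((\<lambda>u. x1 (\<gamma> u)) has_vector_derivative Re (omega1 l1 (\<gamma> t) v)) (at t)"
    unfolding has_vector_derivative_cong_eventually[OF 1] omega1_def
    by (rule bounded_linear.has_vector_derivative[OF bounded_linear_Re d])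
  have "Re (omega2 l2 (\<gamma> t) v) = - Im ((fst (\<gamma> t) + of_real l2) * dz_over_w (\<gamma> t) v)"
    by (simp add: omega2_def mult.assoc)
  then show "((\<lambda>u. x2 (\<gamma> u)) has_vector_derivative Re (omega2 l2 (\<gamma> t) v)) (at t)"
    unfolding has_vector_derivative_cong_eventually[OF 2]
    using has_vector_derivative_minus[OF bounded_linear.has_vector_derivative[OF bounded_linear_Im d]] by simp
qed

end

section \<open>Integrals of the forms along paths\<close>

lemma path_data:
  assumes "\<gamma> \<in> paths_in punctured_curve a p"
  obtains K where "finite K" "continuous_on {0..1} \<gamma>" "\<gamma> 0 = a" "\<gamma> 1 = p"
    "\<forall>t\<in>{0..1}. \<gamma> t \<in> curve" "\<forall>t\<in>{0..1}. fst (\<gamma> t) \<noteq> 0"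
    "\<forall>t\<in>{0<..<1}. eventually (\<lambda>u. \<gamma> u \<in> curve) (nhds t)"
    "\<forall>t\<in>{0<..<1} - K.
       (\<gamma> has_vector_derivative vector_derivative \<gamma> (at t within {0..1})) (at t)"
proof -
  from assms have vp: "valid_path \<gamma>" and im: "path_image \<gamma> \<subseteq> punctured_curve"
    and ends: "\<gamma> 0 = a" "\<gamma> 1 = p"
    by (auto simp: paths_in_def pathstart_def pathfinish_def)
  from vp obtain K where K: "finite K" "continuous_on {0..1} \<gamma>" "\<gamma> C1_differentiable_on ({0..1} - K)"
    by (auto simp: valid_path_def piecewise_C1_differentiable_on_def)
  have C: "\<gamma> t \<in> punctured_curve" if "t \<in> {0..1}" for t
    using im that by (auto simp: path_image_def)
  have nz: "fst q \<noteq> 0" if "q \<in> punctured_curve" for q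
    using that by (cases q) (auto simp: punctured_curve_def curve_def cubic_def)
  show ?thesis
  proof (rule that[OF K(1,2) ends]; intro ballI)
    fix t :: real
    show "\<gamma> t \<in> curve" "fst (\<gamma> t) \<noteq> 0" if "t \<in> {0..1}"
      using C[OF that] nz by (auto simp: punctured_curve_def)
    show "eventually (\<lambda>u. \<gamma> u \<in> curve) (nhds t)" if "t \<in> {0<..<1}"
      unfolding eventually_nhds
      using C that by (intro exI[of _ "{0<..<1}"]) (auto simp: punctured_curve_def)
    show "(\<gamma> has_vector_derivative vector_derivative \<gamma> (at t within {0..1})) (at t)" if t: "t \<in> {0<..<1} - K"
    proof -
      have "at t within {0..1} = at t"
        using t by (intro at_within_interior) auto
      moreover have "\<gamma> differentiable at t"
        using K(3) t by (auto simp: C1_differentiable_on_eq)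
      ultimately show ?thesis
        by (simp add: vector_derivative_works)
    qed
  qed
qed

lemma path_near:
  fixes g :: "real \<Rightarrow> 'a::metric_space"
  assumes "continuous_on {0..1} g" "t \<in> {0..1}" "open U" "g t \<in> U"
  obtains d where "d > 0" "\<And>u. u \<in> {0..1} \<inter> ball t d \<Longrightarrow> g u \<in> U"
proof -
  obtain \<epsilon> where "\<epsilon> > 0" "ball (g t) \<epsilon> \<subseteq> U" using assms openE by blast
  then obtain d where "d > 0" "\<forall>u\<in>{0..1}. dist u t < d \<longrightarrow> dist (g u) (g t) < \<epsilon>"
    using assms(1,2) unfolding continuous_on_iff by blast
  with \<open>ball (g t) \<epsilon> \<subseteq> U\<close> show ?thesis
    using that[of d] by (auto simp: dist_commute subset_iff)
qed

text \<open>Near each time the path stays over one slit plane, and \<open>val l\<close> of that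
  chart is a local primitive.\<close>

lemma holomorphic_form_integrable:
  assumes "\<gamma> \<in> paths_in punctured_curve a p"
  shows "(\<lambda>t. (fst (\<gamma> t) + of_real l) * dz_over_w (\<gamma> t) (vector_derivative \<gamma> (at t within {0..1})))
    integrable_on {0..1}"
proof -
  obtain K where K: "finite K" "continuous_on {0..1} \<gamma>" "\<gamma> 0 = a" "\<gamma> 1 = p"
    and C': "\<forall>t\<in>{0..1}. \<gamma> t \<in> curve" "\<forall>t\<in>{0..1}. fst (\<gamma> t) \<noteq> 0"
      "\<forall>t\<in>{0<..<1}. eventually (\<lambda>u. \<gamma> u \<in> curve) (nhds t)"
      "\<forall>t\<in>{0<..<1} - K.
        (\<gamma> has_vector_derivative vector_derivative \<gamma> (at t within {0..1})) (at t)"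
    by (rule path_data[OF assms])
  note C = C'[rule_format]
  show ?thesis
  proof (rule integrable_local_primitive[OF K(1)])
    fix t :: real assume t: "t \<in> {0..1}"
    obtain e D r \<epsilon> where c: "sqrt_chart e D r \<epsilon>" "fst (\<gamma> t) \<in> D"
    proof -
      consider "fst (\<gamma> t) \<in> D0" | "fst (\<gamma> t) \<in> Dh" | "fst (\<gamma> t) \<in> D2"
        unfolding D0_def Dh_def D2_def by fastforce
      then show ?thesis
        using that c0.sqrt_chart_axioms ch.sqrt_chart_axioms c2.sqrt_chart_axioms by metis
    qed
    interpret sqrt_chart e D r \<epsilon> by fact
    obtain d where d: "d > 0" "\<And>u. u \<in> {0..1} \<inter> ball t d \<Longrightarrow> \<gamma> u \<in> fst -` D"
      by (rule path_near[OF K(2) t open_vimage_fst[OF open_D]]) (use c in auto)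
    have "continuous_on ({0..1} \<inter> ball t d) (\<lambda>u. val l (\<gamma> u))"
      by (rule continuous_on_compose2[OF continuous_on_val])
        (use d C in \<open>auto intro!: continuous_on_subset[OF K(2)]\<close>)
    with d C val_along_path[of \<gamma>]
    show "\<exists>d>0. \<exists>g. continuous_on ({0..1} \<inter> ball t d) g \<and>
      (\<forall>u \<in> {0<..<1} \<inter> ball t d - K. (g has_vector_derivative
        (fst (\<gamma> u) + of_real l) * dz_over_w (\<gamma> u) (vector_derivative \<gamma> (at u within {0..1}))) (at u))"
      by (intro exI[of _ d] conjI exI[of _ "\<lambda>u. val l (\<gamma> u)"] ballI) auto
  qed
qed

lemma omega3_integrable:
  assumes "\<gamma> \<in> paths_in punctured_curve a p"
  shows "(\<lambda>t. omega3 (\<gamma> t) (vector_derivative \<gamma> (at t within {0..1}))) integrable_on {0..1}"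
proof -
  obtain K where K: "finite K" "continuous_on {0..1} \<gamma>" "\<gamma> 0 = a" "\<gamma> 1 = p"
    and C': "\<forall>t\<in>{0..1}. \<gamma> t \<in> curve" "\<forall>t\<in>{0..1}. fst (\<gamma> t) \<noteq> 0"
      "\<forall>t\<in>{0<..<1}. eventually (\<lambda>u. \<gamma> u \<in> curve) (nhds t)"
      "\<forall>t\<in>{0<..<1} - K.
        (\<gamma> has_vector_derivative vector_derivative \<gamma> (at t within {0..1})) (at t)"
    by (rule path_data[OF assms])
  note C = C'[rule_format]
  show ?thesis
  proof (rule integrable_local_primitive[OF K(1)])
    fix t :: real assume t: "t \<in> {0..1}"
    define z where "z = fst (\<gamma> t)"
    have z: "z \<noteq> 0" using C(2)[OF t] z_def by auto
    \<comment> \<open>The branch of the logarithm is centred at the current point, where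
      \<open>y / z\<close> is 1.\<close>
    let ?U = "{y. y / z \<in> - \<real>\<^sub>\<le>\<^sub>0}"
    have "open ?U"
      using z by (intro open_vimage[of _ "\<lambda>y. y / z", unfolded vimage_def]) (auto intro!: continuous_intros)
    then have "open (fst -` ?U :: (complex \<times> complex) set)" by (rule open_vimage_fst)
    then obtain d where d: "d > 0" "\<And>u. u \<in> {0..1} \<inter> ball t d \<Longrightarrow> \<gamma> u \<in> fst -` ?U"
      by (rule path_near[OF K(2) t]) (use z in \<open>auto simp: z_def\<close>)
    let ?g = "\<lambda>u. Ln (fst (\<gamma> u) / z)"
    have "continuous_on ({0..1} \<inter> ball t d) ?g"
      using d z by (intro continuous_intros continuous_on_subset[OF K(2)]) auto
    moreover have "(?g has_vector_derivative omega3 (\<gamma> u) (vector_derivative \<gamma> (at u within {0..1}))) (at u)"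
      if u: "u \<in> {0<..<1} \<inter> ball t d - K" for u
    proof -
      have "fst (\<gamma> u) \<in> ?U" "fst (\<gamma> u) \<noteq> 0" using d(2)[of u] C(2)[of u] u by auto
      then have "((\<lambda>y. Ln (y / z)) has_field_derivative 1 / fst (\<gamma> u)) (at (fst (\<gamma> u)))"
        using z by (auto intro!: derivative_eq_intros simp: field_simps)
      moreover have "((\<lambda>u. fst (\<gamma> u)) has_vector_derivative fst (vector_derivative \<gamma> (at u within {0..1}))) (at u)"
        by (rule bounded_linear.has_vector_derivative[OF bounded_linear_fst C(4)]) (use u in auto)
      ultimately show ?thesis
        using field_vector_diff_chain_at by (fastforce simp: omega3_def o_def)
    qed
    ultimately show "\<exists>d>0. \<exists>g. continuous_on ({0..1} \<inter> ball t d) g \<and>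
      (\<forall>u \<in> {0<..<1} \<inter> ball t d - K. (g has_vector_derivative
        omega3 (\<gamma> u) (vector_derivative \<gamma> (at u within {0..1}))) (at u))"
      using d(1) by (intro exI[of _ d] conjI exI[of _ ?g] ballI) auto
  qed
qed

context period_free
begin

text \<open>Existence and value are separated: the complex integrals exist by local primitives,
  while the real parts are evaluated with the global primitives \<open>x1\<close>, \<open>x2\<close>
  and \<open>ln |z|\<close>.\<close>

lemma path_integral:
  assumes "\<gamma> \<in> paths_in punctured_curve a p"
  obtains I where "has_form_integral (omega l1 l2) I \<gamma>" "Re_vec I = F p - F a"
proof -
  obtain K where K: "finite K" "continuous_on {0..1} \<gamma>" "\<gamma> 0 = a" "\<gamma> 1 = p"
    and C': "\<forall>t\<in>{0..1}. \<gamma> t \<in> curve" "\<forall>t\<in>{0..1}. fst (\<gamma> t) \<noteq> 0"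
      "\<forall>t\<in>{0<..<1}. eventually (\<lambda>u. \<gamma> u \<in> curve) (nhds t)"
      "\<forall>t\<in>{0<..<1} - K.
        (\<gamma> has_vector_derivative vector_derivative \<gamma> (at t within {0..1})) (at t)"
    by (rule path_data[OF assms])
  note C = C'[rule_format]
  define v where "v t = vector_derivative \<gamma> (at t within {0..1})" for t
  have "(\<lambda>t. omega1 l1 (\<gamma> t) (v t)) integrable_on {0..1}"
    "(\<lambda>t. omega2 l2 (\<gamma> t) (v t)) integrable_on {0..1}"
    "(\<lambda>t. omega3 (\<gamma> t) (v t)) integrable_on {0..1}"
    using holomorphic_form_integrable[OF assms, of l1] holomorphic_form_integrable[OF assms, of l2]
      omega3_integrable[OF assms]
    by (auto simp: omega1_def omega2_def v_def mult.assoc integrable_on_cmult_left)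
  then obtain J1 J2 J3 where J: "((\<lambda>t. omega1 l1 (\<gamma> t) (v t)) has_integral J1) {0..1}"
    "((\<lambda>t. omega2 l2 (\<gamma> t) (v t)) has_integral J2) {0..1}"
    "((\<lambda>t. omega3 (\<gamma> t) (v t)) has_integral J3) {0..1}"
    by (auto simp: integrable_on_def)
  have FTC: "Re J = y p - y a"
    if "(f has_integral J) {0..1}" "continuous_on {0..1} (\<lambda>t. y (\<gamma> t))"
      "\<And>t. t \<in> {0<..<1} - K \<Longrightarrow> ((\<lambda>t. y (\<gamma> t)) has_vector_derivative Re (f t)) (at t)"
    for f J and y :: "complex \<times> complex \<Rightarrow> real"
  proof -
    have "((\<lambda>t. Re (f t)) has_integral (y (\<gamma> 1) - y (\<gamma> 0))) {0..1}"
      by (rule fundamental_theorem_of_calculus_interior_strong[OF K(1)]) (use that in auto)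
    moreover have "((\<lambda>t. Re (f t)) has_integral Re J) {0..1}"
      using has_integral_linear[OF that(1) bounded_linear_Re] by (simp add: o_def)
    ultimately show ?thesis using has_integral_unique K by metis
  qed
  have cont: "continuous_on {0..1} (\<lambda>t. x1 (\<gamma> t))" "continuous_on {0..1} (\<lambda>t. x2 (\<gamma> t))"
    "continuous_on {0..1} (\<lambda>t. ln (cmod (fst (\<gamma> t))))"
    using C K(2) by (auto intro!: continuous_on_compose2[OF continuous_on_x(1)]
        continuous_on_compose2[OF continuous_on_x(2)] continuous_intros)
  have "Re J1 = x1 p - x1 a"
    by (rule FTC[OF J(1) cont(1)]) (use x_along_path(1) C v_def in auto)
  moreover have "Re J2 = x2 p - x2 a"
    by (rule FTC[OF J(2) cont(2)]) (use x_along_path(2) C v_def in auto)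
  moreover have "Re J3 = ln (cmod (fst p)) - ln (cmod (fst a))"
  proof (rule FTC[OF J(3) cont(3)])
    fix t assume t: "t \<in> {0<..<1} - K"
    have "((\<lambda>u. fst (\<gamma> u)) has_vector_derivative fst (v t)) (at t)"
      unfolding v_def by (rule bounded_linear.has_vector_derivative[OF bounded_linear_fst C(4)[OF t]])
    then have d: "((\<lambda>u. fst (\<gamma> u)) has_derivative (\<lambda>x. x *\<^sub>R fst (v t))) (at t)"
      by (simp add: has_vector_derivative_def)
    have eq: "Re (x *\<^sub>R y / z) = x *\<^sub>R Re (y / z)" for x y z
      using Re_of_real_mult[of x "y / z"] by (simp add: scaleR_conv_of_real)
    from has_derivative_compose[OF d ln_cmod_has_derivative] C(2)[of t] t
    show "((\<lambda>t. ln (cmod (fst (\<gamma> t)))) has_vector_derivative Re (omega3 (\<gamma> t) (v t))) (at t)"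
      by (simp only: has_vector_derivative_def omega3_def eq) simp
  qed
  ultimately have "Re_vec (vector [J1, J2, J3]) = F p - F a"
    by (simp add: F_def Re_vec_def vec_eq_iff forall_3)
  moreover have "has_form_integral (omega l1 l2) (vector [J1, J2, J3]) \<gamma>"
    unfolding has_form_integral_def omega_def v_def[symmetric] by (intro has_integral_vector_3 J)
  ultimately show ?thesis using that by blast
qed

lemma form_integral_Re:
  assumes "\<gamma> \<in> paths_in punctured_curve a p" "has_form_integral (omega l1 l2) I \<gamma>"
  shows "Re_vec I = F p - F a"
  using path_integral[OF assms(1)] assms(2) has_integral_unique unfolding has_form_integral_def by metis

end

section \<open>Injectivity\<close>

context period_free
begin

definition y1 :: "complex \<Rightarrow> real" where "y1 z = x1 (z, upper_root z)"
definition y2 :: "complex \<Rightarrow> real" where "y2 z = x2 (z, upper_root z)"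

lemma upper_root_in_curve: "(z, upper_root z) \<in> curve"
  by (simp add: curve_def upper_root_power2)

text \<open>The normalization of the branches pays off: on the closed upper half-plane the sheet
  \<open>upper_root\<close> has the principal root of \<open>z - e\<close> as chart coordinate, here
  for \<open>e = 0\<close> and in the next two lemmas for 1/2 and 2.\<close>

lemma y_c0:
  assumes "Im z \<ge> 0" "z \<in> D0"
  shows "y1 z = Re (c0.prim l1 (csqrt z))" "y2 z = - Im (c0.prim l2 (csqrt z))"
proof -
  have "csqrt (z - 1/2) = \<i> * csqrt (- (z - 1/2))" "csqrt (z - 2) = \<i> * csqrt (- (z - 2))"
    using assms by (intro csqrt_eq_i_times; auto simp: D0_def)+
  then have "upper_root z = (\<i> * \<i>) * (csqrt z * (csqrt (- (z - 1/2)) * csqrt (- (z - 2))))"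
    unfolding upper_root_def by (simp only: mult_ac)
  then have "upper_root z = csqrt z * r0 z"
    by (simp add: r0_def)
  then have "c0.coord (z, upper_root z) = csqrt z"
    using c0.r_nonzero[OF assms(2)] by (simp add: c0.coord_def)
  then show "y1 z = Re (c0.prim l1 (csqrt z))" "y2 z = - Im (c0.prim l2 (csqrt z))"
    using x_c0[OF upper_root_in_curve] assms(2) by (auto simp: y1_def y2_def c0.val_def)
qed

lemma y_ch:
  assumes "Im z \<ge> 0" "z \<in> Dh"
  shows "y1 z = Re (ch.prim l1 (csqrt (z - 1/2)))" "y2 z = - Im (ch.prim l2 (csqrt (z - 1/2)))"
proof -
  have "csqrt (z - 2) = \<i> * csqrt (- (z - 2))"
    using assms by (intro csqrt_eq_i_times) (auto simp: Dh_def)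
  then have "upper_root z = csqrt (z - 1/2) * rh z"
    by (simp add: upper_root_def rh_def)
  then have "ch.coord (z, upper_root z) = csqrt (z - 1/2)"
    using ch.r_nonzero[OF assms(2)] by (simp add: ch.coord_def)
  then show "y1 z = Re (ch.prim l1 (csqrt (z - 1/2)))" "y2 z = - Im (ch.prim l2 (csqrt (z - 1/2)))"
    using x_ch[OF upper_root_in_curve] assms(2) by (auto simp: y1_def y2_def ch.val_def)
qed

lemma y_c2:
  assumes "z \<in> D2"
  shows "y1 z = Re (c2.prim l1 (csqrt (z - 2)))" "y2 z = - Im (c2.prim l2 (csqrt (z - 2)))"
proof -
  have "upper_root z = csqrt (z - 2) * r2 z"
    by (simp add: upper_root_def r2_def)
  then have "c2.coord (z, upper_root z) = csqrt (z - 2)"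
    using c2.r_nonzero[OF assms] by (simp add: c2.coord_def)
  then show "y1 z = Re (c2.prim l1 (csqrt (z - 2)))" "y2 z = - Im (c2.prim l2 (csqrt (z - 2)))"
    using x_c2[OF upper_root_in_curve] assms by (auto simp: y1_def y2_def c2.val_def)
qed

lemma upper_primitive:
  assumes "Im z > 0"
  shows "((\<lambda>z. c2.prim l (csqrt (z - 2))) has_field_derivative (z + of_real l) / upper_root z) (at z)"
proof -
  have z: "z \<in> D2" "z - 2 \<noteq> 0" "z - 2 \<notin> \<real>\<^sub>\<le>\<^sub>0"
    using assms by (auto simp: D2_def complex_eq_iff complex_nonpos_Reals_iff)
  have "((\<lambda>z. c2.prim l (csqrt (z - 2))) has_field_derivative (z + of_real l) / (csqrt (z - 2) * r2 z)) (at z)"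
    by (rule c2.prim_sqrt_deriv) (use z csqrt_deriv_forms(1) in auto)
  moreover have "csqrt (z - 2) * r2 z = upper_root z" by (simp add: upper_root_def r2_def)
  ultimately show ?thesis by simp
qed

lemma continuous_on_y: "continuous_on {z. Im z \<ge> 0} y1" "continuous_on {z. Im z \<ge> 0} y2"
  unfolding y1_def[abs_def] y2_def[abs_def]
  by (rule continuous_on_compose2[OF continuous_on_x(1)] continuous_on_compose2[OF continuous_on_x(2)];
      use upper_root_in_curve in \<open>auto intro!: continuous_intros continuous_on_upper_root\<close>)+

lemma y_along_path:
  assumes g: "(g has_vector_derivative g') (at t)" and "Im (g t) > 0"
  shows "((\<lambda>t. y1 (g t)) has_real_derivative Re (g' * ((g t + of_real l1) / upper_root (g t)))) (at t)"
    "((\<lambda>t. y2 (g t)) has_real_derivative - Im (g' * ((g t + of_real l2) / upper_root (g t)))) (at t)"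
proof -
  have "isCont g t" using has_vector_derivative_continuous[OF g] .
  then have "isCont (\<lambda>u. Im (g u)) t" by (rule continuous_Im)
  then have "eventually (\<lambda>u. Im (g u) > 0) (nhds t)"
    using assms(2) by (metis isCont_def order_tendstoD(1) tendsto_at_iff_tendsto_nhds)
  then have 1: "eventually (\<lambda>u. y1 (g u) = Re (c2.prim l1 (csqrt (g u - 2)))) (nhds t)"
    and 2: "eventually (\<lambda>u. y2 (g u) = - Im (c2.prim l2 (csqrt (g u - 2)))) (nhds t)"
    by (eventually_elim, simp add: y_c2 D2_def)+
  have d: "((\<lambda>u. c2.prim l (csqrt (g u - 2))) has_vector_derivative g' * ((g t + of_real l) / upper_root (g t))) (at t)" for l
    using field_vector_diff_chain_at[OF g upper_primitive[OF assms(2)]] by (simp add: o_def)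
  show "((\<lambda>t. y1 (g t)) has_real_derivative Re (g' * ((g t + of_real l1) / upper_root (g t)))) (at t)"
    unfolding has_real_derivative_iff_has_vector_derivative has_vector_derivative_cong_eventually[OF 1]
    by (rule bounded_linear.has_vector_derivative[OF bounded_linear_Re d])
  show "((\<lambda>t. y2 (g t)) has_real_derivative - Im (g' * ((g t + of_real l2) / upper_root (g t)))) (at t)"
    unfolding has_real_derivative_iff_has_vector_derivative has_vector_derivative_cong_eventually[OF 2]
    by (rule has_vector_derivative_minus[OF bounded_linear.has_vector_derivative[OF bounded_linear_Im d]])
qed

text \<open>On (0, 1/2) the factor \<open>x + l1\<close> changes sign at \<open>- l1\<close>. Points
  up to there are reached from 0 and the others from 1/2, each along a stretch of constant sign; the
  period equation makes both evaluations the same function. On the negative axis and on (1/2, 2) the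
  primitives are imaginary.\<close>

lemma y1_real_axis: "y1 (of_real x) \<ge> 0"
  and y1_real_axis_pos: "0 < x \<and> x < 1/2 \<or> 2 < x \<Longrightarrow> y1 (of_real x) > 0"
proof -
  have sq: "\<sigma>\<^sup>2 < y" if "0 < \<sigma>" "\<sigma> < sqrt y" for \<sigma> y :: real
  proof -
    have "0 < sqrt y" using that by linarith
    then show ?thesis using power_strict_mono[OF that(2), of 2] that by simp
  qed
  have a: "y1 (of_real x) > 0" if x: "2 < x"
  proof -
    obtain R where R: "c2.prim l1 (of_real (sqrt (x - 2))) = of_real R"
      "(\<And>\<sigma>. 0 < \<sigma> \<Longrightarrow> \<sigma> < sqrt (x - 2) \<Longrightarrow> 2 + \<sigma>\<^sup>2 + l1 > 0) \<Longrightarrow> R > 0"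
      by (rule c2_real_ray[of "sqrt (x - 2)" l1]) (use x in auto)
    have "2 + \<sigma>\<^sup>2 + l1 > 0" for \<sigma> using l1(1) zero_le_power2[of \<sigma>] by linarith
    then have "R > 0" by (intro R(2))
    then show ?thesis
      using y_c2(1)[of "of_real x"] R(1) csqrt_of_real_pos[of "x - 2"] x by (simp add: D2_def)
  qed
  have b: "y1 (of_real x) > 0" if x: "0 < x" "x < 1/2"
  proof (cases "x \<le> - l1")
    case True
    obtain R where R: "c0.prim l1 (of_real (sqrt x)) = - of_real R"
      "(\<And>\<sigma>. 0 < \<sigma> \<Longrightarrow> \<sigma> < sqrt x \<Longrightarrow> \<sigma>\<^sup>2 + l1 < 0) \<Longrightarrow> R < 0"
      by (rule c0_real_ray[of "sqrt x" l1]) (use x in auto)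
    have "R < 0" by (rule R(2)) (use True sq in force)
    then show ?thesis
      using y_c0(1)[of "of_real x"] R(1) csqrt_of_real_pos[of x] x by (simp add: D0_def)
  next
    case False
    obtain R where R: "ch.prim l1 (\<i> * of_real (sqrt (1/2 - x))) = of_real R"
      "(\<And>\<sigma>. 0 < \<sigma> \<Longrightarrow> \<sigma> < sqrt (1/2 - x) \<Longrightarrow> 1/2 - \<sigma>\<^sup>2 + l1 > 0) \<Longrightarrow> R > 0"
      by (rule ch_imaginary_ray[of "sqrt (1/2 - x)" l1]) (use x in auto)
    have "R > 0" by (rule R(2)) (use False sq in force)
    moreover have "csqrt (of_real x - 1/2) = \<i> * of_real (sqrt (1/2 - x))"
      using csqrt_of_real_nonpos[of "of_real x - 1/2"] x by simp
    ultimately show ?thesis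
      using y_ch(1)[of "of_real x"] R(1) x by (simp add: Dh_def)
  qed
  have c: "y1 (of_real x) = 0" if x: "x < 0"
  proof -
    obtain R where R: "c0.prim l1 (\<i> * of_real (sqrt (- x))) = - \<i> * of_real R"
      by (rule c0_imaginary_ray[of "sqrt (- x)" l1]) (use x in auto)
    moreover have "csqrt (of_real x) = \<i> * of_real (sqrt (- x))"
      using csqrt_of_real_nonpos[of "of_real x"] x by simp
    ultimately show ?thesis
      using y_c0(1)[of "of_real x"] x by (simp add: D0_def)
  qed
  have d: "y1 (of_real x) = 0" if x: "1/2 < x" "x < 2"
  proof -
    obtain R where R: "c2.prim l1 (\<i> * of_real (sqrt (2 - x))) = \<i> * of_real R"
      by (rule c2_imaginary_ray[of "sqrt (2 - x)" l1]) (use x in auto)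
    moreover have "csqrt (of_real x - 2) = \<i> * of_real (sqrt (2 - x))"
      using csqrt_of_real_nonpos[of "of_real x - 2"] x by simp
    ultimately show ?thesis
      using y_c2(1)[of "of_real x"] x by (simp add: D2_def)
  qed
  have e: "y1 0 = 0" "y1 (of_real (1/2)) = 0" "y1 (of_real 2) = 0"
    using y_c0(1)[of 0] y_ch(1)[of "of_real (1/2)"] y_c2(1)[of "of_real 2"]
    by (auto simp: D0_def Dh_def D2_def)
  have e: "x = 0 \<or> x = 1/2 \<or> x = 2 \<Longrightarrow> y1 (of_real x) = 0" using e by (metis of_real_0)
  show "0 < x \<and> x < 1/2 \<or> 2 < x \<Longrightarrow> y1 (of_real x) > 0" using a b by auto
  consider "x < 0" | "x = 0" | "0 < x" "x < 1/2" | "x = 1/2" | "1/2 < x" "x < 2" | "x = 2" | "2 < x"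
    by linarith
  then show "y1 (of_real x) \<ge> 0"
    using a b c d e by cases (simp_all only: less_imp_le order_refl simp_thms)
qed

text \<open>As for \<open>y1\<close>, now with (1/2, 2) split at \<open>- l2\<close>; on (0, 1/2)
  and beyond 2 the primitives are real, so that \<open>y2\<close> vanishes.\<close>

lemma y2_real_axis: "x > 0 \<Longrightarrow> y2 (of_real x) \<le> 0"
  and y2_real_axis_neg: "1/2 < x \<Longrightarrow> x < 2 \<Longrightarrow> y2 (of_real x) < 0"
proof -
  have sq: "\<sigma>\<^sup>2 < y" if "0 < \<sigma>" "\<sigma> < sqrt y" for \<sigma> y :: real
  proof -
    have "0 < sqrt y" using that by linarith
    then show ?thesis using power_strict_mono[OF that(2), of 2] that by simp
  qed
  have a: "y2 (of_real x) = 0" if x: "2 < x"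
  proof -
    obtain R where R: "c2.prim l2 (of_real (sqrt (x - 2))) = of_real R"
      by (rule c2_real_ray[of "sqrt (x - 2)" l2]) (use x in auto)
    then show ?thesis
      using y_c2(2)[of "of_real x"] R(1) csqrt_of_real_pos[of "x - 2"] x by (simp add: D2_def)
  qed
  have b: "y2 (of_real x) = 0" if x: "0 < x" "x < 1/2"
  proof -
    obtain R where R: "c0.prim l2 (of_real (sqrt x)) = - of_real R"
      by (rule c0_real_ray[of "sqrt x" l2]) (use x in auto)
    then show ?thesis
      using y_c0(2)[of "of_real x"] R(1) csqrt_of_real_pos[of x] x by (simp add: D0_def)
  qed
  show d: "y2 (of_real x) < 0" if x: "1/2 < x" "x < 2" for x
  proof (cases "x \<ge> - l2")
    case True
    obtain R where R: "c2.prim l2 (\<i> * of_real (sqrt (2 - x))) = \<i> * of_real R"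
      "(\<And>\<sigma>. 0 < \<sigma> \<Longrightarrow> \<sigma> < sqrt (2 - x) \<Longrightarrow> 2 - \<sigma>\<^sup>2 + l2 > 0) \<Longrightarrow> R > 0"
      by (rule c2_imaginary_ray[of "sqrt (2 - x)" l2]) (use x in auto)
    have "R > 0" by (rule R(2)) (use True sq in force)
    moreover have "csqrt (of_real x - 2) = \<i> * of_real (sqrt (2 - x))"
      using csqrt_of_real_nonpos[of "of_real x - 2"] x by simp
    ultimately show ?thesis
      using y_c2(2)[of "of_real x"] R(1) x by (simp add: D2_def)
  next
    case False
    obtain R where R: "ch.prim l2 (of_real (sqrt (x - 1/2))) = - \<i> * of_real R"
      "(\<And>\<sigma>. 0 < \<sigma> \<Longrightarrow> \<sigma> < sqrt (x - 1/2) \<Longrightarrow> 1/2 + \<sigma>\<^sup>2 + l2 < 0) \<Longrightarrow> R < 0"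
      by (rule ch_real_ray[of "sqrt (x - 1/2)" l2]) (use x in auto)
    have "R < 0" by (rule R(2)) (use False sq in force)
    then show ?thesis
      using y_ch(2)[of "of_real x"] R(1) csqrt_of_real_pos[of "x - 1/2"] x by (simp add: Dh_def)
  qed
  have e: "y2 (of_real (1/2)) = 0" "y2 (of_real 2) = 0"
    using y_ch(2)[of "of_real (1/2)"] y_c2(2)[of "of_real 2"]
    by (auto simp: Dh_def D2_def)
  have e: "x = 1/2 \<or> x = 2 \<Longrightarrow> y2 (of_real x) = 0" using e by metis
  consider "x \<le> 0" | "0 < x" "x < 1/2" | "x = 1/2" | "1/2 < x" "x < 2" | "x = 2" | "2 < x"
    by linarith
  then show "x > 0 \<Longrightarrow> y2 (of_real x) \<le> 0"
    using a b d[of x] e by cases (simp_all only: less_imp_le order_refl simp_thms)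
qed

lemma y1_pos:
  assumes z: "Im z > 0"
  shows "y1 z > 0"
proof -
  let ?g = "\<lambda>t. of_real (Re z) + of_real t * \<i>"
  have "y1 (?g 0) < y1 (?g (Im z))"
  proof (rule DERIV_pos_imp_increasing_open[OF z])
    fix t assume t: "0 < t" "t < Im z"
    have "(?g has_vector_derivative \<i>) (at t)"
      unfolding has_vector_derivative_def
      by (auto intro!: derivative_eq_intros simp: scaleR_conv_of_real)
    from y_along_path(1)[OF this] t
    have "((\<lambda>t. y1 (?g t)) has_real_derivative Re (\<i> * ((?g t + of_real l1) / upper_root (?g t)))) (at t)"
      by simp
    moreover have "Re (\<i> * ((?g t + of_real l1) / upper_root (?g t))) > 0"
      using Im_vertical_neg[of "?g t" l1] l1(1,2) t by (simp only: Re_i_times) simp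
    ultimately show "\<exists>y. ((\<lambda>t. y1 (?g t)) has_real_derivative y) (at t) \<and> 0 < y" by blast
  next
    show "continuous_on {0..Im z} (\<lambda>t. y1 (?g t))"
      by (rule continuous_on_compose2[OF continuous_on_y(1)]) (auto intro!: continuous_intros)
  qed
  moreover have "?g (Im z) = z" by (simp add: complex_eq_iff)
  ultimately show ?thesis using y1_real_axis[of "Re z"] by simp
qed

lemma y2_arc:
  assumes "0 < r" "0 \<le> s" "s < t" "t \<le> pi"
  shows "y2 (of_real r * cis t) < y2 (of_real r * cis s)"
proof (rule DERIV_neg_imp_decreasing_open[OF assms(3)])
  fix u assume u: "s < u" "u < t"
  have pos: "Im (of_real r * cis u) > 0"
    using assms u by (simp add: sin_gt_zero)
  \<comment> \<open>The velocity of the arc is \<open>\<i>\<close> times the position, so the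
    derivative of \<open>y2\<close> is minus the real part in \<open>Re_angular_pos\<close>.\<close>
  have "((\<lambda>u. of_real r * cis u) has_vector_derivative \<i> * (of_real r * cis u)) (at u)"
    unfolding has_vector_derivative_def
    by (auto intro!: derivative_eq_intros simp: scaleR_conv_of_real)
  from y_along_path(2)[OF this pos]
  have "((\<lambda>u. y2 (of_real r * cis u)) has_real_derivative
    - Im (\<i> * (of_real r * cis u) * ((of_real r * cis u + of_real l2) / upper_root (of_real r * cis u)))) (at u)" .
  moreover have "- Im (\<i> * a * (b / c)) = - Re (a * b / c)" for a b c
  proof -
    have "\<i> * a * (b / c) = \<i> * (a * b / c)" by simp
    then show ?thesis by (simp only: Im_i_times)
  qed
  then have "- Im (\<i> * (of_real r * cis u) * ((of_real r * cis u + of_real l2) / upper_root (of_real r * cis u))) < 0"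
    using Re_angular_pos[OF pos l2(1,2)] by (simp only: neg_less_0_iff_less)
  ultimately show "\<exists>y. ((\<lambda>u. y2 (of_real r * cis u)) has_real_derivative y) (at u) \<and> y < 0" by blast
next
  show "continuous_on {s..t} (\<lambda>u. y2 (of_real r * cis u))"
    using assms by (intro continuous_on_compose2[OF continuous_on_y(2)])
      (auto intro!: continuous_intros mult_nonneg_nonneg sin_ge_zero)
qed

lemma upper_polar:
  assumes "Im z \<ge> 0" "z \<noteq> 0"
  obtains t where "0 \<le> t" "t \<le> pi" "z = of_real (cmod z) * cis t"
  using that[of "Arg z"] assms(1) Arg_le_pi[of z] Arg_less_0[of z] rcis_cmod_Arg[of z]
  by (simp add: rcis_def)

text \<open>The arc through \<open>z\<close> starts on the positive axis with a value at most 0 and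
  decreases strictly from there; its end at angle pi covers the negative axis.\<close>

lemma y2_neg:
  assumes "Im z > 0 \<or> Im z = 0 \<and> Re z < 0"
  shows "y2 z < 0"
proof -
  have z: "Im z \<ge> 0" "z \<noteq> 0" using assms by auto
  obtain t where t: "0 \<le> t" "t \<le> pi" "z = of_real (cmod z) * cis t"
    using upper_polar[OF z] .
  have "t \<noteq> 0"
  proof
    assume "t = 0"
    with t(3) have "z = of_real (cmod z)" by simp
    with assms show False by (metis Im_complex_of_real Re_complex_of_real linorder_not_less norm_ge_zero order_less_irrefl)
  qed
  then have "y2 (of_real (cmod z) * cis t) < y2 (of_real (cmod z) * cis 0)"
    using t z by (intro y2_arc) auto
  also have "\<dots> \<le> 0" using y2_real_axis[of "cmod z"] z by simp
  finally show ?thesis using t(3) by simp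
qed

lemma y2_nonpos:
  assumes "Im z \<ge> 0" "z \<noteq> 0"
  shows "y2 z \<le> 0"
proof (cases "Im z > 0 \<or> Im z = 0 \<and> Re z < 0")
  case True
  then show ?thesis using y2_neg by fastforce
next
  case False
  with assms have "Im z = 0" "Re z > 0" by (auto simp: complex_eq_iff)
  moreover from this have "z = of_real (Re z)" by (simp add: complex_eq_iff)
  ultimately show ?thesis using y2_real_axis[of "Re z"] by simp
qed

lemma y2_inj_circle:
  assumes "Im z \<ge> 0" "z \<noteq> 0" "Im z' \<ge> 0" "cmod z = cmod z'" "y2 z = y2 z'"
  shows "z = z'"
proof -
  have "z' \<noteq> 0" using assms by auto
  obtain t where t: "0 \<le> t" "t \<le> pi" "z = of_real (cmod z) * cis t"
    using upper_polar[OF assms(1,2)] .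
  obtain t' where t': "0 \<le> t'" "t' \<le> pi" "z' = of_real (cmod z') * cis t'"
    using upper_polar[OF assms(3) \<open>z' \<noteq> 0\<close>] .
  have "t = t'"
    using y2_arc[of "cmod z" t t'] y2_arc[of "cmod z" t' t] t t' assms
    by (metis linorder_cases order_less_irrefl zero_less_norm_iff)
  then show ?thesis using t t' assms(4) by metis
qed

text \<open>Since \<open>x1\<close> and \<open>x2\<close> change sign with \<open>w\<close>, the two
  points over a real \<open>z\<close> can have the same image only if both coordinates vanish; then
  the two points coincide.\<close>

lemma y_zero_real:
  assumes "Im z = 0" "z \<noteq> 0" "y1 z = 0" "y2 z = 0"
  shows "cubic z = 0"
proof -
  have z: "z = of_real (Re z)" using assms by (simp add: complex_eq_iff)
  have "Re z \<noteq> 0" using assms by (simp add: complex_eq_iff)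
  then consider "Re z < 0" | "0 < Re z" "Re z < 1/2" | "Re z = 1/2" | "1/2 < Re z" "Re z < 2" | "Re z = 2" | "2 < Re z"
    by linarith
  then show ?thesis
  proof cases
    case 1
    then show ?thesis using y2_neg[of z] assms by simp
  next
    case 2
    then show ?thesis using y1_real_axis_pos[of "Re z"] assms z by simp
  next
    case 4
    then show ?thesis using y2_real_axis_neg[of "Re z"] assms z by simp
  next
    case 6
    then show ?thesis using y1_real_axis_pos[of "Re z"] assms z by simp
  next
    case 3
    then have "z = of_real (1/2)" using z by metis
    then show ?thesis by (simp add: cubic_def)
  next
    case 5
    then have "z = of_real 2" using z by metis
    then show ?thesis by (simp add: cubic_def)
  qed
qed

text \<open>Here \<open>s\<close> records the sheet and \<open>t\<close> the conjugation. The signs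
  \<open>s\<close> of \<open>x1\<close> and \<open>s * t\<close> of \<open>x2\<close> recover
  both.\<close>

lemma curve_as_upper:
  assumes "p \<in> curve"
  obtains z s t where "Im z \<ge> 0" "s \<in> {1, -1}" "t \<in> {1, -1}"
    "fst p = (if t = 1 then z else cnj z)" "snd p = of_real s * (if t = 1 then upper_root z else cnj (upper_root z))"
    "x1 p = s * y1 z" "x2 p = s * t * y2 z"
proof -
  have upper: "\<exists>s\<in>{1, -1}. w = of_real s * upper_root z \<and> x1 (z, w) = s * y1 z \<and> x2 (z, w) = s * y2 z"
    if "(z, w) \<in> curve" for z w
  proof -
    have "w\<^sup>2 = (upper_root z)\<^sup>2" using that by (simp add: curve_def upper_root_power2)
    then consider "w = upper_root z" | "w = - upper_root z" by (metis power2_eq_iff)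
    then show ?thesis
      using x_minus[OF upper_root_in_curve, of z] by cases (auto simp: y1_def y2_def)
  qed
  obtain z w where p: "p = (z, w)" by (cases p)
  show ?thesis
  proof (cases "Im z \<ge> 0")
    case True
    obtain s where "s \<in> {1, -1}" "w = of_real s * upper_root z" "x1 (z, w) = s * y1 z" "x2 (z, w) = s * y2 z"
      using upper assms p by blast
    then show ?thesis using that[of z s 1] True p by auto
  next
    case False
    note c = x_cnj[OF assms[unfolded p]]
    obtain s where s: "s \<in> {1, -1}" "cnj w = of_real s * upper_root (cnj z)"
      "x1 (cnj z, cnj w) = s * y1 (cnj z)" "x2 (cnj z, cnj w) = s * y2 (cnj z)"
      using upper[OF c(1)] by blast
    have "w = of_real s * cnj (upper_root (cnj z))"
      using arg_cong[OF s(2), of cnj] by simp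
    then show ?thesis using that[of "cnj z" s "- 1"] False p s c by auto
  qed
qed

lemma inj_on_F: "inj_on F punctured_curve"
proof (rule inj_onI)
  fix p q assume pq: "p \<in> punctured_curve" "q \<in> punctured_curve" and eq: "F p = F q"
  have nz: "fst p \<noteq> 0" if "p \<in> punctured_curve" for p
    using that by (cases p) (auto simp: punctured_curve_def curve_def cubic_def)
  have curve: "p \<in> curve" "q \<in> curve" using pq by (auto simp: punctured_curve_def)
  have x: "x1 p = x1 q" "x2 p = x2 q" "ln (cmod (fst p)) = ln (cmod (fst q))"
    using eq by (auto simp: F_def vec_eq_iff forall_3)
  then have mod: "cmod (fst p) = cmod (fst q)"
    using nz pq by simp
  obtain z s t where p: "Im z \<ge> 0" "s \<in> {1, -1}" "t \<in> {1, -1}"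
    "fst p = (if t = 1 then z else cnj z)" "snd p = of_real s * (if t = 1 then upper_root z else cnj (upper_root z))"
    "x1 p = s * y1 z" "x2 p = s * t * y2 z"
    using curve_as_upper[OF curve(1)] .
  obtain z' s' t' where q: "Im z' \<ge> 0" "s' \<in> {1, -1}" "t' \<in> {1, -1}"
    "fst q = (if t' = 1 then z' else cnj z')" "snd q = of_real s' * (if t' = 1 then upper_root z' else cnj (upper_root z'))"
    "x1 q = s' * y1 z'" "x2 q = s' * t' * y2 z'"
    using curve_as_upper[OF curve(2)] .
  have znz: "z \<noteq> 0" "z' \<noteq> 0" using nz[OF pq(1)] nz[OF pq(2)] p q by (auto split: if_splits)
  have "cmod z = cmod z'" using mod p(4) q(4) by (auto split: if_splits)
  \<comment> \<open>\<open>y2\<close> is nonpositive at both points, so equality up to sign is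
    equality.\<close>
  moreover have "y2 z = y2 z'"
    using x(2) p q y2_nonpos[OF p(1) znz(1)] y2_nonpos[OF q(1) znz(2)] by auto
  ultimately have zz: "z = z'" using y2_inj_circle p q znz by blast
  show "p = q"
  proof (cases "Im z > 0")
    case True
    then have "y1 z > 0" "y2 z < 0" using y1_pos y2_neg by auto
    then have "s = s'" "t = t'" using x p q zz by auto
    then show ?thesis using p q zz by (auto simp: prod_eq_iff)
  next
    case False
    then have real: "Im z = 0" "cnj z = z" using p by (auto simp: complex_eq_iff)
    then have f: "fst p = z" "fst q = z" using p q zz by (auto split: if_splits)
    have "(snd p)\<^sup>2 = cubic z" "(snd q)\<^sup>2 = cubic z" using curve f by (auto simp: curve_def)
    \<comment> \<open>On the real axis the four copies meet, and only the sign of \<open>w\<close>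
      is left to decide.\<close>
    then consider "snd p = snd q" | "snd q = - snd p" by (metis power2_eq_iff)
    then show ?thesis
    proof cases
      case 2
      then have pq: "(z, snd p) = p" "(z, - snd p) = q" using f by (auto simp: prod_eq_iff)
      have "x1 q = - x1 p" "x2 q = - x2 p"
        by (rule x_minus[of z "snd p", unfolded pq, OF curve(1)])+
      with x have "x1 p = 0" "x2 p = 0" by linarith+
      moreover have "s \<noteq> 0" "t \<noteq> 0" using p(2,3) by auto
      ultimately have "y1 z = 0" "y2 z = 0" using p(6,7) by (metis mult_eq_0_iff)+
      then have "cubic z = 0" using y_zero_real real znz by blast
      then have "snd p = 0" "snd q = 0" using \<open>(snd p)\<^sup>2 = cubic z\<close> \<open>(snd q)\<^sup>2 = cubic z\<close> by auto
      then show ?thesis using f by (simp add: prod_eq_iff)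
    qed (use f in \<open>simp add: prod_eq_iff\<close>)
  qed
qed

end

section \<open>Harmonicity, immersion and properness\<close>

lemma holomorphic_Re_has_derivative:
  assumes "g holomorphic_on U" "open U" "\<zeta> \<in> U"
  shows "((\<lambda>z. Re (g z)) has_derivative (\<lambda>h. Re (deriv g \<zeta> * h))) (at \<zeta>)"
    "((\<lambda>z. - Im (g z)) has_derivative (\<lambda>h. - Im (deriv g \<zeta> * h))) (at \<zeta>)"
proof -
  have "(g has_derivative (\<lambda>h. deriv g \<zeta> * h)) (at \<zeta>)"
    using holomorphic_derivI[OF assms] has_field_derivative_imp_has_derivative by blast
  note g = this
  show "((\<lambda>z. Re (g z)) has_derivative (\<lambda>h. Re (deriv g \<zeta> * h))) (at \<zeta>)"
    by (intro derivative_intros g)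
  show "((\<lambda>z. - Im (g z)) has_derivative (\<lambda>h. - Im (deriv g \<zeta> * h))) (at \<zeta>)"
    by (intro derivative_intros g)
qed

text \<open>The \<open>g\<close>s are complex derivatives of local primitives: the partials of
  \<open>u\<close> are \<open>Re g\<close> and \<open>- Im g\<close>, and Cauchy-Riemann for
  \<open>g\<close> makes the second pure partials opposite.\<close>

lemma harmonic_on_vector_3:
  fixes u :: "complex \<Rightarrow> real^3"
  assumes U: "open U"
    and g: "g1 holomorphic_on U" "g2 holomorphic_on U" "g3 holomorphic_on U"
    and u: "\<And>\<zeta>. \<zeta> \<in> U \<Longrightarrow>
      (u has_derivative (\<lambda>h. vector [Re (g1 \<zeta> * h), Re (g2 \<zeta> * h), Re (g3 \<zeta> * h)])) (at \<zeta>)"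
  shows "harmonic_on u U"
proof -
  let ?R = "\<lambda>f1 f2 f3 \<zeta>. vector [Re (f1 \<zeta>), Re (f2 \<zeta>), Re (f3 \<zeta> :: complex)] :: real^3"
  let ?I = "\<lambda>f1 f2 f3 \<zeta>. vector [- Im (f1 \<zeta>), - Im (f2 \<zeta>), - Im (f3 \<zeta> :: complex)] :: real^3"
  let ?ux = "?R g1 g2 g3" and ?uy = "?I g1 g2 g3"
  let ?uxx = "?R (deriv g1) (deriv g2) (deriv g3)" and ?uxy = "?I (deriv g1) (deriv g2) (deriv g3)"
  have du: "(u has_derivative (\<lambda>h. Re h *\<^sub>R ?ux \<zeta> + Im h *\<^sub>R ?uy \<zeta>)) (at \<zeta>)" if "\<zeta> \<in> U" for \<zeta>
  proof -
    have "vector [Re (g1 \<zeta> * h), Re (g2 \<zeta> * h), Re (g3 \<zeta> * h)] = Re h *\<^sub>R ?ux \<zeta> + Im h *\<^sub>R ?uy \<zeta>" for h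
      by (simp add: vec_eq_iff forall_3 mult.commute)
    then show ?thesis using u[OF that] by simp
  qed
  have dux: "(?ux has_derivative (\<lambda>h. Re h *\<^sub>R ?uxx \<zeta> + Im h *\<^sub>R ?uxy \<zeta>)) (at \<zeta>)" if "\<zeta> \<in> U" for \<zeta>
  proof -
    have "vector [Re (deriv g1 \<zeta> * h), Re (deriv g2 \<zeta> * h), Re (deriv g3 \<zeta> * h)] =
        Re h *\<^sub>R ?uxx \<zeta> + Im h *\<^sub>R ?uxy \<zeta>" for h
      by (simp add: vec_eq_iff forall_3 mult.commute)
    moreover have "(?ux has_derivative (\<lambda>h. vector [Re (deriv g1 \<zeta> * h), Re (deriv g2 \<zeta> * h), Re (deriv g3 \<zeta> * h)])) (at \<zeta>)"
      by (intro has_derivative_vector_3 holomorphic_Re_has_derivative(1)[OF _ U that] g)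
    ultimately show ?thesis by simp
  qed
  have duy: "(?uy has_derivative (\<lambda>h. Re h *\<^sub>R ?uxy \<zeta> + Im h *\<^sub>R (- ?uxx \<zeta>))) (at \<zeta>)" if "\<zeta> \<in> U" for \<zeta>
  proof -
    have "vector [- Im (deriv g1 \<zeta> * h), - Im (deriv g2 \<zeta> * h), - Im (deriv g3 \<zeta> * h)] =
        Re h *\<^sub>R ?uxy \<zeta> + Im h *\<^sub>R (- ?uxx \<zeta>)" for h
      by (simp add: vec_eq_iff forall_3 algebra_simps)
    moreover have "(?uy has_derivative (\<lambda>h. vector [- Im (deriv g1 \<zeta> * h), - Im (deriv g2 \<zeta> * h), - Im (deriv g3 \<zeta> * h)])) (at \<zeta>)"
      by (intro has_derivative_vector_3 holomorphic_Re_has_derivative(2)[OF _ U that] g)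
    ultimately show ?thesis by simp
  qed
  have cont: "continuous_on U (deriv g1)" "continuous_on U (deriv g2)" "continuous_on U (deriv g3)"
    using g U by (auto intro!: holomorphic_on_imp_continuous_on holomorphic_deriv)
  have "continuous_on U ?uxx" "continuous_on U ?uxy"
    by (intro continuous_on_vector_3 continuous_intros cont)+
  note c = this
  show ?thesis
    unfolding harmonic_on_def
  proof (rule conjI[OF U], rule exI[of _ ?ux], rule exI[of _ ?uy], rule exI[of _ ?uxx], rule exI[of _ ?uxy],
      rule exI[of _ ?uxy], rule exI[of _ "\<lambda>\<zeta>. - ?uxx \<zeta>"], intro conjI ballI)
    show "continuous_on U (\<lambda>\<zeta>. - ?uxx \<zeta>)" by (rule continuous_on_minus[OF c(1)])
  qed (rule du dux duy c right_minus; assumption)+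
qed

section \<open>Path-connectedness of the punctured curve\<close>

lemma paths_in_trans:
  assumes "paths_in S a b \<noteq> {}" "paths_in S b c \<noteq> {}"
  shows "paths_in S a c \<noteq> {}"
proof -
  obtain g h where "g \<in> paths_in S a b" "h \<in> paths_in S b c" using assms by blast
  then have "g +++ h \<in> paths_in S a c"
    using path_image_join_subset[of g h] by (auto simp: paths_in_def valid_path_join)
  then show ?thesis by blast
qed

lemma paths_in_sym:
  assumes "paths_in S a b \<noteq> {}"
  shows "paths_in S b a \<noteq> {}"
proof -
  obtain g where "g \<in> paths_in S a b" using assms by blast
  then have "reversepath g \<in> paths_in S b a" by (auto simp: paths_in_def valid_path_imp_reverse)
  then show ?thesis by blast
qed

lemma punctured_curve_fst_nonzero: "p \<in> punctured_curve \<longleftrightarrow> p \<in> curve \<and> fst p \<noteq> 0"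
  by (cases p) (auto simp: punctured_curve_def curve_def cubic_def)

context sqrt_chart
begin

text \<open>Of the three charts only the one at 0 loses a point by this, namely
  \<open>s = 0\<close>.\<close>

definition S' :: "complex set" where "S' = {s \<in> S. of_real e + s\<^sup>2 \<noteq> 0}"

lemma S'_eq: "S' = S - {csqrt (- of_real e), - csqrt (- of_real e)}"
proof -
  have "of_real e + s\<^sup>2 = 0 \<longleftrightarrow> s = csqrt (- of_real e) \<or> s = - csqrt (- of_real e)" for s
  proof -
    have "of_real e + s\<^sup>2 = 0 \<longleftrightarrow> s\<^sup>2 = (csqrt (- of_real e))\<^sup>2"
      by (simp add: eq_neg_iff_add_eq_0 add.commute)
    then show ?thesis by (simp only: power2_eq_iff)
  qed
  then show ?thesis by (auto simp: S'_def)
qed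

lemma open_S': "open S'"
  unfolding S'_eq by (intro open_Diff open_S finite_imp_closed) auto

lemma connected_S': "connected S'"
  unfolding S'_eq by (rule connected_open_delete_finite[OF open_S connected_S]) auto

lemma chart_S': "s \<in> S' \<Longrightarrow> chart s \<in> punctured_curve"
  using chart_in_curve by (auto simp: S'_def punctured_curve_fst_nonzero) (auto simp: chart_def)

lemma coord_S': "p \<in> punctured_curve \<Longrightarrow> fst p \<in> D \<Longrightarrow> coord p \<in> S'"
  by (simp add: S'_def punctured_curve_fst_nonzero coord_power2 coord_in_S)

text \<open>A connected open set stays connected without finitely many points and is connected by
  polynomial paths; their images under the holomorphic \<open>chart\<close> are continuously
  differentiable.\<close>

lemma paths_in_chart:
  assumes "p \<in> punctured_curve" "fst p \<in> D" "q \<in> punctured_curve" "fst q \<in> D"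
  shows "paths_in punctured_curve p q \<noteq> {}"
proof -
  obtain g where g: "polynomial_function g" "path_image g \<subseteq> S'" "pathstart g = coord p" "pathfinish g = coord q"
    using connected_open_polynomial_connected[OF open_S' connected_S' coord_S'[OF assms(1,2)] coord_S'[OF assms(3,4)]]
    by blast
  obtain g' where g': "polynomial_function g'" "\<And>x. (g has_vector_derivative g' x) (at x)"
    using has_vector_derivative_polynomial_function[OF g(1)] by blast
  have gS: "g t \<in> S'" "g t \<in> S" if "t \<in> {0..1}" for t
  proof -
    show "g t \<in> S'" using g(2) that unfolding path_image_def by blast
    then show "g t \<in> S" by (simp add: S'_def)
  qed
  define c2 where "c2 s = s * r (of_real e + s\<^sup>2)" for s
  have c2: "c2 holomorphic_on S"
    unfolding c2_def[abs_def] by (intro holomorphic_intros r_chart_holomorphic)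
  let ?d = "\<lambda>t. (g' t * (2 * g t), g' t * deriv c2 (g t))"
  have d: "((\<lambda>t. chart (g t)) has_vector_derivative ?d t) (at t)" if "t \<in> {0..1}" for t
  proof -
    have "((\<lambda>s. of_real e + s\<^sup>2) has_field_derivative 2 * g t) (at (g t))"
      by (auto intro!: derivative_eq_intros)
    then have 1: "((\<lambda>t. of_real e + (g t)\<^sup>2) has_vector_derivative g' t * (2 * g t)) (at t)"
      using field_vector_diff_chain_at[OF g'(2)] by (simp add: o_def)
    have 2: "((\<lambda>t. c2 (g t)) has_vector_derivative g' t * deriv c2 (g t)) (at t)"
      using field_vector_diff_chain_at[OF g'(2) holomorphic_derivI[OF c2 open_S gS(2)[OF that]]] by (simp add: o_def)
    show ?thesis
      using has_vector_derivative_Pair[OF 1 2] by (simp add: chart_def c2_def)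
  qed
  have contg: "continuous_on {0..1} g" "continuous_on {0..1} g'"
    using g(1) g'(1) continuous_on_polymonial_function by blast+
  have "continuous_on {0..1} (\<lambda>t. deriv c2 (g t))"
    by (rule continuous_on_compose2[OF holomorphic_on_imp_continuous_on[OF holomorphic_deriv[OF c2 open_S]] contg(1)])
      (use gS in auto)
  then have "continuous_on {0..1} ?d" by (intro continuous_intros contg)
  then have "(\<lambda>t. chart (g t)) C1_differentiable_on {0..1}"
    unfolding C1_differentiable_on_def using d by (intro exI[of _ ?d] conjI ballI) auto
  then have "valid_path (\<lambda>t. chart (g t))"
    unfolding valid_path_def by (rule C1_differentiable_imp_piecewise)
  moreover have "path_image (\<lambda>t. chart (g t)) \<subseteq> punctured_curve"
    using gS chart_S' by (auto simp: path_image_def)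
  moreover have "chart (g 0) = p" "chart (g 1) = q"
    using g(3,4) chart_coord assms by (auto simp: pathstart_def pathfinish_def punctured_curve_fst_nonzero)
  ultimately have "(\<lambda>t. chart (g t)) \<in> paths_in punctured_curve p q"
    by (auto simp: paths_in_def pathstart_def pathfinish_def)
  then show ?thesis by blast
qed

end

lemma paths_in_punctured_curve:
  assumes "p \<in> punctured_curve" "q \<in> punctured_curve"
  shows "paths_in punctured_curve p q \<noteq> {}"
proof -
  \<comment> \<open>Transfer points in the two overlaps with the middle chart. Passing between
    sheets happens inside a chart, since each contains both.\<close>
  define b c where "b = (1 :: complex, upper_root 1)" and "c = (of_real (1/4) :: complex, upper_root (of_real (1/4)))"
  have b: "b \<in> punctured_curve" "fst b \<in> Dh" "fst b \<in> D2"
    and c: "c \<in> punctured_curve" "fst c \<in> Dh" "fst c \<in> D0"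
    by (auto simp: b_def c_def punctured_curve_fst_nonzero curve_def upper_root_power2 Dh_def D0_def D2_def)
  have "paths_in punctured_curve p b \<noteq> {}" if p: "p \<in> punctured_curve" for p
  proof -
    consider "fst p \<in> D0" | "fst p \<in> Dh" | "fst p \<in> D2"
      unfolding D0_def Dh_def D2_def by fastforce
    then show ?thesis
    proof cases
      case 1
      then show ?thesis
        using c0.paths_in_chart[OF p 1 c(1,3)] ch.paths_in_chart[OF c(1,2) b(1,2)] paths_in_trans by blast
    next
      case 2
      then show ?thesis using ch.paths_in_chart[OF p 2 b(1,2)] by blast
    next
      case 3
      then show ?thesis using c2.paths_in_chart[OF p 3 b(1,3)] by blast
    qed
  qed
  then show ?thesis using assms paths_in_sym paths_in_trans by metis
qed

section \<open>Injectivity of the differential\<close>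

context period_free
begin

text \<open>These are the factors by which the first two coordinates change along
  \<open>|z| = const\<close>. Over the real axis a real \<open>w\<close> makes the cubic positive,
  which excludes \<open>- l2\<close> in (1/2, 2); an imaginary \<open>w\<close> makes it negative,
  which excludes \<open>- l1\<close> in (0, 1/2).\<close>

lemma angular_nondegenerate:
  assumes "(z, w) \<in> curve" "w \<noteq> 0"
  shows "Re (z * (z + of_real l2) / w) \<noteq> 0 \<or> Im (z * (z + of_real l1) / w) \<noteq> 0"
proof -
  have upper: "Re (z * (z + of_real l2) / w) \<noteq> 0" if "Im z > 0" "(z, w) \<in> curve" for z w
  proof -
    have "w\<^sup>2 = (upper_root z)\<^sup>2" using that by (simp add: curve_def upper_root_power2)
    then consider "w = upper_root z" | "w = - upper_root z" by (metis power2_eq_iff)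
    then show ?thesis using Re_angular_pos[OF that(1) l2(1,2)] by cases auto
  qed
  consider "Im z > 0" | "Im z < 0" | "Im z = 0" by linarith
  then show ?thesis
  proof cases
    case 1
    then show ?thesis using upper assms by blast
  next
    case 2
    then have "Im (cnj z) > 0" by simp
    from upper[OF this x_cnj(1)[OF assms(1)]] have "Re (cnj (z * (z + of_real l2) / w)) \<noteq> 0"
      by (simp del: cnj.sel)
    then show ?thesis by (auto simp only: cnj.sel)
  next
    case 3
    define x where "x = Re z"
    define k where "k = x * (x - 2) * (x - 1/2)"
    have z: "z = of_real x" using 3 by (simp add: x_def complex_eq_iff)
    have w2: "w\<^sup>2 = of_real k" using assms(1) by (simp add: curve_def cubic_def z k_def)
    have "Re (w\<^sup>2) = k" "Im (w\<^sup>2) = 0"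
      by (simp_all only: w2 Re_complex_of_real Im_complex_of_real)
    then have k: "(Re w)\<^sup>2 - (Im w)\<^sup>2 = k" "Re w * Im w = 0"
      by (simp_all add: Re_power2 Im_power2)
    have "k \<noteq> 0" using w2 assms(2) by auto
    then have x: "x \<noteq> 0" by (auto simp: k_def)
    show ?thesis
    proof (cases "Im w = 0")
      case True
      then have w: "w = of_real (Re w)" by (simp add: complex_eq_iff)
      have "k > 0" using k True \<open>k \<noteq> 0\<close> by (metis diff_zero power_zero_numeral zero_le_power2 order_le_imp_less_or_eq)
      have "x \<noteq> - l2"
      proof
        assume "x = - l2"
        then have "1/2 < x" "x < 2" using l2 by auto
        then have "k < 0" unfolding k_def by (intro mult_neg_pos mult_pos_neg) auto
        with \<open>k > 0\<close> show False by simp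
      qed
      have "z * (z + of_real l2) / w = of_real (x * (x + l2) / Re w)"
        by (subst w) (simp add: z)
      then have "Re (z * (z + of_real l2) / w) = x * (x + l2) / Re w" by (simp only: Re_complex_of_real)
      moreover have "x * (x + l2) / Re w \<noteq> 0"
        using x \<open>x \<noteq> - l2\<close> assms(2) True by (auto simp: complex_eq_iff)
      ultimately show ?thesis by simp
    next
      case False
      then have "Re w = 0" using k by simp
      then have w: "w = \<i> * of_real (Im w)" by (simp add: complex_eq_iff)
      have "k < 0" using k \<open>Re w = 0\<close> False by (metis diff_0 neg_less_0_iff_less power_zero_numeral zero_less_power2)
      have "x \<noteq> - l1"
      proof
        assume "x = - l1"
        then have "0 < x" "x < 1/2" using l1 by auto
        then have "k > 0" unfolding k_def by (intro mult_neg_neg mult_pos_neg) auto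
        with \<open>k < 0\<close> show False by simp
      qed
      have "z * (z + of_real l1) / w = - \<i> * of_real (x * (x + l1) / Im w)"
        by (subst w) (use False in \<open>simp add: z field_simps\<close>)
      then have "Im (z * (z + of_real l1) / w) = - (x * (x + l1) / Im w)"
        by simp
      moreover have "x * (x + l1) / Im w \<noteq> 0"
        using x \<open>x \<noteq> - l1\<close> False by auto
      ultimately show ?thesis by simp
    qed
  qed
qed

end

lemma (in sqrt_chart) chart_differential_injective:
  assumes pf: "period_free l1 l2" and e: "e \<in> {0, 1/2, 2}" and s: "s \<in> S'"
    and 1: "Re (integrand l1 s * h) = 0" and 2: "Re (\<i> * integrand l2 s * h) = 0"
    and 3: "Re (2 * s / (of_real e + s\<^sup>2) * h) = 0"
  shows "h = 0"
proof -
  interpret period_free l1 l2 by fact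
  define z where "z = of_real e + s\<^sup>2"
  have z: "z \<noteq> 0" "r z \<noteq> 0" using s r_nonzero by (auto simp: S'_def S_def z_def)
  show ?thesis
  proof (cases "s = 0")
    case True
    \<comment> \<open>At a branch point \<open>dz\<close> vanishes and the third coordinate gives no
      information; the first two control \<open>Re k\<close> and \<open>Im k\<close> separately, as
      \<open>e\<close> is 1/2 or 2.\<close>
    define k where "k = 2 * h / r z"
    have e2: "e = 1/2 \<or> e = 2" using e z True by (auto simp: z_def)
    have "integrand l1 s * h = of_real (e + l1) * k" "\<i> * integrand l2 s * h = \<i> * (of_real (e + l2) * k)"
      using True by (simp_all add: integrand_def k_def z_def)
    with 1 2 have "(e + l1) * Re k = 0" "(e + l2) * Im k = 0"
      by (simp_all only: Re_i_times Re_of_real_mult Im_of_real_mult neg_equal_0_iff_equal)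
    moreover have "e + l1 \<noteq> 0" "e + l2 \<noteq> 0" using e2 l1 l2 by auto
    ultimately have "k = 0" by (simp add: complex_eq_iff)
    then show ?thesis using z by (simp add: k_def)
  next
    case False
    define w where "w = s * r z"
    define v where "v = 2 * s * h"
    define t where "t = Im (v / z)"
    have w: "w \<noteq> 0" "(z, w) \<in> curve"
      using False z chart_in_curve[of s] s by (auto simp: w_def z_def chart_def S'_def)
    \<comment> \<open>Vanishing of the third coordinate leaves only directions tangent to the circle
      \<open>|z| = const\<close>.\<close>
    have "Re (v / z) = 0" using 3 by (simp add: v_def z_def)
    then have "v / z = \<i> * of_real t" by (simp add: t_def complex_eq_iff)
    then have v: "v = \<i> * of_real t * z" using z by (simp add: divide_eq_eq)
    have i: "integrand l s * h = \<i> * (of_real t * (z * (z + of_real l) / w))" for l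
    proof -
      have "integrand l s * h = (z + of_real l) * v / w"
        using False z by (simp add: integrand_def v_def w_def z_def[symmetric] field_simps)
      then show ?thesis unfolding v by simp
    qed
    have "t * Im (z * (z + of_real l1) / w) = 0"
      using 1 unfolding i by (simp only: Re_i_times Im_of_real_mult neg_equal_0_iff_equal)
    moreover have "t * Re (z * (z + of_real l2) / w) = 0"
      using 2 unfolding mult.assoc i by (simp only: Re_i_times Im_i_times Re_of_real_mult neg_equal_0_iff_equal)
    ultimately have "t = 0" using angular_nondegenerate[OF w(2,1)] by auto
    then show ?thesis using v False by (simp add: v_def)
  qed
qed

context period_free
begin

lemma F_chart_has_derivative:
  assumes c: "sqrt_chart e D r \<epsilon>"
    and x: "\<And>q. q \<in> curve \<Longrightarrow> fst q \<in> D \<Longrightarrow> x1 q = Re (sqrt_chart.val e r l1 q)"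
      "\<And>q. q \<in> curve \<Longrightarrow> fst q \<in> D \<Longrightarrow> x2 q = - Im (sqrt_chart.val e r l2 q)"
    and s: "s \<in> sqrt_chart.S' e D"
  shows "((\<lambda>s. F (sqrt_chart.chart e r s)) has_derivative
    (\<lambda>h. vector [Re (sqrt_chart.integrand e r l1 s * h), Re (\<i> * sqrt_chart.integrand e r l2 s * h),
      Re (2 * s / (of_real e + s\<^sup>2) * h)])) (at s)"
proof -
  interpret sqrt_chart e D r \<epsilon> by fact
  have sS: "s \<in> S" "of_real e + s\<^sup>2 \<noteq> 0" using s by (auto simp: S'_def)
  have p: "(prim l has_derivative (\<lambda>h. integrand l s * h)) (at s)" for l
    using prim_deriv[OF sS(1)] has_field_derivative_imp_has_derivative by blast
  have a: "((\<lambda>s. Re (prim l1 s)) has_derivative (\<lambda>h. Re (integrand l1 s * h))) (at s)"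
    by (intro derivative_intros p)
  have b: "((\<lambda>s. - Im (prim l2 s)) has_derivative (\<lambda>h. - Im (integrand l2 s * h))) (at s)"
    by (intro derivative_intros p)
  have "((\<lambda>s. of_real e + s\<^sup>2) has_field_derivative 2 * s) (at s)"
    by (auto intro!: derivative_eq_intros)
  then have "((\<lambda>s. of_real e + s\<^sup>2) has_derivative (\<lambda>h. 2 * s * h)) (at s)"
    by (rule has_field_derivative_imp_has_derivative)
  from has_derivative_compose[OF this ln_cmod_has_derivative[OF sS(2)]]
  have c: "((\<lambda>s. ln (cmod (of_real e + s\<^sup>2))) has_derivative (\<lambda>h. Re (2 * s * h / (of_real e + s\<^sup>2)))) (at s)" .
  have "((\<lambda>s. vector [Re (prim l1 s), - Im (prim l2 s), ln (cmod (of_real e + s\<^sup>2))] :: real^3) has_derivative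
    (\<lambda>h. vector [Re (integrand l1 s * h), - Im (integrand l2 s * h), Re (2 * s * h / (of_real e + s\<^sup>2))])) (at s)"
    by (rule has_derivative_vector_3[OF a b c])
  then have "((\<lambda>s. F (chart s)) has_derivative
    (\<lambda>h. vector [Re (integrand l1 s * h), - Im (integrand l2 s * h), Re (2 * s * h / (of_real e + s\<^sup>2))])) (at s)"
  proof (rule has_derivative_transform_within_open[OF _ open_S sS(1)])
    fix y assume y: "y \<in> S"
    then have "chart y \<in> curve" "fst (chart y) \<in> D" "fst (chart y) = of_real e + y\<^sup>2"
      by (auto simp: chart_in_curve) (auto simp: chart_def S_def)
    then show "vector [Re (prim l1 y), - Im (prim l2 y), ln (cmod (of_real e + y\<^sup>2))] = F (chart y)"
      using x y by (simp add: F_def val_chart)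
  qed
  then show ?thesis by (simp add: mult.assoc)
qed

text \<open>\<open>f\<close> stands for the integral map, which is identified with
  \<open>F - F a\<close> only on the punctured curve. The data serve harmonicity and immersion
  alike.\<close>

lemma chart_facts:
  assumes p: "p \<in> punctured_curve"
    and f: "\<And>p. p \<in> punctured_curve \<Longrightarrow> f p = F p - F a"
  obtains U \<phi> \<zeta> g1 g2 g3 where "local_parametrization punctured_curve U \<phi>" "\<zeta> \<in> U" "\<phi> \<zeta> = p"
    "g1 holomorphic_on U" "g2 holomorphic_on U" "g3 holomorphic_on U"
    "\<forall>s\<in>U. ((f \<circ> \<phi>) has_derivative
       (\<lambda>h. vector [Re (g1 s * h), Re (g2 s * h), Re (g3 s * h)])) (at s)"
    "\<forall>s\<in>U. \<forall>h. Re (g1 s * h) = 0 \<longrightarrow> Re (g2 s * h) = 0 \<longrightarrow> Re (g3 s * h) = 0 \<longrightarrow> h = 0"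
proof -
  obtain e D r \<epsilon> where c: "sqrt_chart e D r \<epsilon>" "fst p \<in> D" "e \<in> {0, 1/2, 2}"
    and x: "\<And>q. q \<in> curve \<Longrightarrow> fst q \<in> D \<Longrightarrow> x1 q = Re (sqrt_chart.val e r l1 q)"
      "\<And>q. q \<in> curve \<Longrightarrow> fst q \<in> D \<Longrightarrow> x2 q = - Im (sqrt_chart.val e r l2 q)"
    using chart_at by metis
  interpret sqrt_chart e D r \<epsilon> by fact
  show ?thesis
  proof (rule that[of S' chart "coord p" "integrand l1" "\<lambda>s. \<i> * integrand l2 s" "\<lambda>s. 2 * s / (of_real e + s\<^sup>2)"])
    show "local_parametrization punctured_curve S' chart"
      by (rule local_parametrization_chart[OF open_S']) (auto simp: S'_def)
    show "coord p \<in> S'" "chart (coord p) = p"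
      using coord_S'[OF p c(2)] chart_coord c(2) p by (auto simp: punctured_curve_fst_nonzero)
    show "integrand l1 holomorphic_on S'" "(\<lambda>s. \<i> * integrand l2 s) holomorphic_on S'"
      using integrand_holomorphic holomorphic_on_subset[of _ S S'] 
      by (auto intro!: holomorphic_intros simp: S'_def)
    show "(\<lambda>s. 2 * s / (of_real e + s\<^sup>2)) holomorphic_on S'"
      by (intro holomorphic_intros) (auto simp: S'_def)
    show "\<forall>s\<in>S'. \<forall>h. Re (integrand l1 s * h) = 0 \<longrightarrow> Re (\<i> * integrand l2 s * h) = 0 \<longrightarrow>
        Re (2 * s / (of_real e + s\<^sup>2) * h) = 0 \<longrightarrow> h = 0"
      using chart_differential_injective[OF period_free_axioms c(3)] by blast
    show "\<forall>s\<in>S'. ((f \<circ> chart) has_derivative (\<lambda>h. vector [Re (integrand l1 s * h),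
        Re (\<i> * integrand l2 s * h), Re (2 * s / (of_real e + s\<^sup>2) * h)])) (at s)"
    proof
      fix s assume s: "s \<in> S'"
      have "((\<lambda>s. F (chart s) - F a) has_derivative (\<lambda>h. vector [Re (integrand l1 s * h),
          Re (\<i> * integrand l2 s * h), Re (2 * s / (of_real e + s\<^sup>2) * h)] - 0)) (at s)"
        by (intro has_derivative_diff F_chart_has_derivative[OF c(1) x s] has_derivative_const)
      then have "((f \<circ> chart) has_derivative (\<lambda>h. vector [Re (integrand l1 s * h),
          Re (\<i> * integrand l2 s * h), Re (2 * s / (of_real e + s\<^sup>2) * h)] - 0)) (at s)"
        by (rule has_derivative_transform_within_open[OF _ open_S' s]) (simp add: f chart_S')
      then show "((f \<circ> chart) has_derivative (\<lambda>h. vector [Re (integrand l1 s * h),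
          Re (\<i> * integrand l2 s * h), Re (2 * s / (of_real e + s\<^sup>2) * h)])) (at s)"
        by simp
    qed
  qed
qed

lemma harmonic_map_F:
  assumes f: "\<And>p. p \<in> punctured_curve \<Longrightarrow> f p = F p - F a"
  shows "harmonic_map punctured_curve f"
  unfolding harmonic_map_def
proof
  fix p assume p: "p \<in> punctured_curve"
  obtain U \<phi> \<zeta> g1 g2 g3 where
    *: "local_parametrization punctured_curve U \<phi>" "\<zeta> \<in> U" "\<phi> \<zeta> = p"
      "g1 holomorphic_on U" "g2 holomorphic_on U" "g3 holomorphic_on U"
    and d: "\<forall>s\<in>U. ((f \<circ> \<phi>) has_derivative
       (\<lambda>h. vector [Re (g1 s * h), Re (g2 s * h), Re (g3 s * h)])) (at s)"
    and i: "\<forall>s\<in>U. \<forall>h. Re (g1 s * h) = 0 \<longrightarrow> Re (g2 s * h) = 0 \<longrightarrow> Re (g3 s * h) = 0 \<longrightarrow> h = 0"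
    by (rule chart_facts[OF p f])
  have "open U" using *(1) by (simp add: local_parametrization_def)
  then have "harmonic_on (f \<circ> \<phi>) U" by (rule harmonic_on_vector_3[OF _ *(4-6)]) (use d in blast)
  then show "\<exists>U \<phi>. local_parametrization punctured_curve U \<phi> \<and> p \<in> \<phi> ` U \<and> harmonic_on (f \<circ> \<phi>) U"
    using * by blast
qed

lemma immersion_F:
  assumes f: "\<And>p. p \<in> punctured_curve \<Longrightarrow> f p = F p - F a"
  shows "immersion punctured_curve f"
  unfolding immersion_def
proof
  fix p assume p: "p \<in> punctured_curve"
  obtain U \<phi> \<zeta> g1 g2 g3 where
    *: "local_parametrization punctured_curve U \<phi>" "\<zeta> \<in> U" "\<phi> \<zeta> = p"
      "g1 holomorphic_on U" "g2 holomorphic_on U" "g3 holomorphic_on U"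
    and d: "\<forall>s\<in>U. ((f \<circ> \<phi>) has_derivative
       (\<lambda>h. vector [Re (g1 s * h), Re (g2 s * h), Re (g3 s * h)])) (at s)"
    and i: "\<forall>s\<in>U. \<forall>h. Re (g1 s * h) = 0 \<longrightarrow> Re (g2 s * h) = 0 \<longrightarrow> Re (g3 s * h) = 0 \<longrightarrow> h = 0"
    by (rule chart_facts[OF p f])
  let ?D = "\<lambda>h. vector [Re (g1 \<zeta> * h), Re (g2 \<zeta> * h), Re (g3 \<zeta> * h)] :: real^3"
  have "inj ?D"
  proof (rule injI)
    fix h k assume "?D h = ?D k"
    then have "Re (g1 \<zeta> * (h - k)) = 0" "Re (g2 \<zeta> * (h - k)) = 0" "Re (g3 \<zeta> * (h - k)) = 0"
      by (simp_all add: vec_eq_iff forall_3 algebra_simps)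
    then have "h - k = 0" using i *(2) by blast
    then show "h = k" by simp
  qed
  then show "\<exists>U \<phi>. local_parametrization punctured_curve U \<phi> \<and>
      (\<exists>\<zeta>\<in>U. \<phi> \<zeta> = p \<and> (\<exists>D. ((f \<circ> \<phi>) has_derivative D) (at \<zeta>) \<and> inj D))"
    using * d by blast
qed

text \<open>A bounded third coordinate confines \<open>z\<close> to an annulus, away from the
  puncture and from infinity, and the equation of the curve then bounds \<open>w\<close>; so the
  preimage lies in the compact set \<open>C\<close>.\<close>

lemma proper_map_F:
  assumes f: "\<And>p. p \<in> punctured_curve \<Longrightarrow> f p = F p - F a"
  shows "proper_map (top_of_set punctured_curve) euclidean f"
proof (rule compact_imp_proper_map)
  show "k_space (euclidean :: (real^3) topology)"
    by (intro metrizable_imp_k_space metrizable_space_euclidean)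
  show "kc_space (euclidean :: (real^3) topology)"
    by (intro Hausdorff_imp_kc_space) simp
  have "continuous_on punctured_curve (\<lambda>p. F p - F a)"
    by (intro continuous_intros continuous_on_F)
  then have cont: "continuous_on punctured_curve f"
    using continuous_on_cong[OF refl f] by (metis (no_types, lifting) continuous_on_cong f)
  then show "continuous_map (top_of_set punctured_curve) euclidean f \<or> kc_space (top_of_set punctured_curve)"
    by simp
  fix K :: "(real^3) set" assume "compactin euclidean K"
  then have K: "compact K" by simp
  then obtain B where B: "\<And>v. v \<in> K \<Longrightarrow> norm v \<le> B"
    using compact_imp_bounded bounded_iff by metis
  define m M where "m = exp (ln (cmod (fst a)) - B)" and "M = exp (ln (cmod (fst a)) + B)"
  define N where "N = M * (M + 2) * (M + 1/2)"
  define C where "C = {p \<in> curve. m \<le> cmod (fst p) \<and> cmod (fst p) \<le> M}"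
  have "m > 0" "M > 0" by (auto simp: m_def M_def)
  have CX: "C \<subseteq> punctured_curve"
    using \<open>m > 0\<close> by (auto simp: C_def punctured_curve_fst_nonzero)
  have "C = {p. (snd p)\<^sup>2 = cubic (fst p)} \<inter> {p. m \<le> cmod (fst p)} \<inter> {p. cmod (fst p) \<le> M}"
    by (auto simp: C_def curve_def)
  moreover have "closed {p :: complex \<times> complex. (snd p)\<^sup>2 = cubic (fst p)}"
    unfolding cubic_def by (intro closed_Collect_eq continuous_intros)
  moreover have "closed {p :: complex \<times> complex. m \<le> cmod (fst p)}" "closed {p :: complex \<times> complex. cmod (fst p) \<le> M}"
    by (intro closed_Collect_le continuous_intros)+
  ultimately have "closed C" by auto
  have "cmod (snd p) \<le> 1 + N" if "p \<in> C" for p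
  proof -
    have z: "cmod (fst p) \<le> M" "(snd p)\<^sup>2 = cubic (fst p)" using that by (auto simp: C_def curve_def)
    have "(cmod (snd p))\<^sup>2 = cmod (fst p) * cmod (fst p - 2) * cmod (fst p - 1/2)"
      using z(2) by (simp add: cubic_def norm_mult flip: norm_power)
    also have "\<dots> \<le> N"
      unfolding N_def
    proof (intro mult_mono)
      show "cmod (fst p - 2) \<le> M + 2" "cmod (fst p - 1/2) \<le> M + 1/2"
        using norm_triangle_ineq4[of "fst p" 2] norm_triangle_ineq4[of "fst p" "1/2"] z(1) by simp_all
    qed (use z \<open>M > 0\<close> in auto)
    finally have "(cmod (snd p))\<^sup>2 \<le> N" .
    \<comment> \<open>A crude linear estimate that avoids the square root of
      \<open>N\<close>.\<close>
    moreover have "cmod (snd p) \<le> 1 + (cmod (snd p))\<^sup>2"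
      using zero_le_power2[of "cmod (snd p) - 1/2"] by (simp add: power2_eq_square algebra_simps)
    ultimately show ?thesis by linarith
  qed
  then have "C \<subseteq> cball 0 M \<times> cball 0 (1 + N)"
    by (auto simp: C_def)
  then have "bounded C" using bounded_Times bounded_cball bounded_subset by metis
  have "{p \<in> punctured_curve. f p \<in> K} = C \<inter> f -` K"
  proof -
    have "p \<in> C" if p: "p \<in> punctured_curve" "f p \<in> K" for p
    proof -
      have "\<bar>f p $ 3\<bar> \<le> B" using B[OF p(2)] component_le_norm_cart[of "f p" 3] by linarith
      then have "\<bar>ln (cmod (fst p)) - ln (cmod (fst a))\<bar> \<le> B" by (simp add: f[OF p(1)] F_def)
      then have *: "ln (cmod (fst a)) - B \<le> ln (cmod (fst p))" "ln (cmod (fst p)) \<le> ln (cmod (fst a)) + B"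
        by linarith+
      have "cmod (fst p) > 0" using p(1) by (simp add: punctured_curve_fst_nonzero)
      with * have "m \<le> cmod (fst p)" "cmod (fst p) \<le> M"
        unfolding m_def M_def by (metis exp_le_cancel_iff exp_ln)+
      with p(1) show ?thesis by (simp add: C_def punctured_curve_fst_nonzero)
    qed
    with CX show ?thesis by auto
  qed
  moreover have "closed (C \<inter> f -` K)"
    by (intro continuous_closed_preimage continuous_on_subset[OF cont CX] \<open>closed C\<close> compact_imp_closed K)
  moreover have "bounded (C \<inter> f -` K)" using \<open>bounded C\<close> bounded_Int by blast
  ultimately show "compactin (top_of_set punctured_curve) {x \<in> topspace (top_of_set punctured_curve). f x \<in> K}"
    using CX by (auto simp: compactin_subtopology compact_eq_bounded_closed)
qed auto

section \<open>Identification of the integral map with \<open>F p - F a\<close>\<close>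

lemma Re_integral_map_eq:
  assumes "a \<in> punctured_curve" "p \<in> punctured_curve"
  shows "Re_integral_map punctured_curve (omega l1 l2) a p = F p - F a"
  unfolding Re_integral_map_def
proof (rule the_equality)
  obtain \<gamma> where \<gamma>: "\<gamma> \<in> paths_in punctured_curve a p"
    using paths_in_punctured_curve[OF assms] by blast
  then obtain I where "has_form_integral (omega l1 l2) I \<gamma>" "Re_vec I = F p - F a"
    using path_integral by metis
  with \<gamma> show "\<exists>\<gamma>\<in>paths_in punctured_curve a p. \<exists>I. has_form_integral (omega l1 l2) I \<gamma> \<and> F p - F a = Re_vec I"
    by metis
next
  fix v assume "\<exists>\<gamma>\<in>paths_in punctured_curve a p. \<exists>I. has_form_integral (omega l1 l2) I \<gamma> \<and> v = Re_vec I"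
  then show "v = F p - F a" using form_integral_Re by blast
qed

lemma Re_integral_well_defined_omega:
  assumes "a \<in> punctured_curve"
  shows "Re_integral_well_defined punctured_curve (omega l1 l2) a"
  unfolding Re_integral_well_defined_def
  using paths_in_punctured_curve[OF assms] path_integral form_integral_Re by metis

end

theorem proposition5p1:
  shows "\<exists>l1 l2 :: real. \<forall>a\<in>punctured_curve.
           Re_integral_well_defined punctured_curve (omega l1 l2) a \<and>
           harmonic_map punctured_curve (Re_integral_map punctured_curve (omega l1 l2) a) \<and>
           proper_embedding punctured_curve (Re_integral_map punctured_curve (omega l1 l2) a)"
proof -
  obtain l1 where l1: "-1/2 < l1" "l1 < 0"
    "Re (ch.prim l1 (\<i> * of_real (1/2))) = Re (c0.prim l1 (of_real (1/2)))"
    using exists_l1 by blast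
  obtain l2 where l2: "-2 < l2" "l2 < -1/2" "Im (ch.prim l2 (of_real (sqrt (1/2)))) = Im (c2.prim l2 \<i>)"
    using exists_l2 by blast
  interpret period_free l1 l2
    using l1 l2 by unfold_locales
  show ?thesis
  proof (rule exI[of _ l1], rule exI[of _ l2], intro ballI conjI)
    fix a assume a: "a \<in> punctured_curve"
    note f = Re_integral_map_eq[OF a]
    show "Re_integral_well_defined punctured_curve (omega l1 l2) a"
      using Re_integral_well_defined_omega[OF a] .
    show "harmonic_map punctured_curve (Re_integral_map punctured_curve (omega l1 l2) a)"
      using harmonic_map_F f by blast
    have "inj_on (Re_integral_map punctured_curve (omega l1 l2) a) punctured_curve"
      using inj_on_F by (auto simp: inj_on_def f)
    then show "proper_embedding punctured_curve (Re_integral_map punctured_curve (omega l1 l2) a)"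
      unfolding proper_embedding_def using proper_map_F immersion_F f by blast
  qed
qed

end
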